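(* Let $d\ge1$, let $I_1,\dots,I_d\subset\mathbb R$ be open intervals (bounded or unbounded), $\mathbf I=I_1\times\dots\times I_d$, and let $f\colon\mathbf I\to\mathbb R$ be a function. Let $\boldsymbol\alpha=(\alpha_1,\dots,\alpha_d)\in\mathbf I$ and let $\mathbf n=(n_1,\dots,n_d)\in\mathbb N^d$ be such that $n_i\ge1$ for $i=1,\dots,d$. Put $$\mathbf B=\{(b_1,\dots,b_d)\in\{L,r\}^d: b_i=r\text{ whenever }n_i\ge2,\ i=1,\dots,d\}.$$ Then $f$ is box-$\mathbf n$-convex if and only if it is of the form $$f(x_1,\dots,x_d)=W(x_1,\dots,x_d)+\sum_{\mathbf b\in\mathbf B}\int_{\mathbf I}\prod_{j=1}^d\frac{(x_j-u_j)^{n_j-1}}{(n_j-1)!}\chi_{\alpha_j,x_j}^{b_j}(u_j)\,d\mu_{\mathbf b}(u_1,\dots,u_d)$$ for all $(x_1,\dots,x_d)\in\mathbf I$, where $W\colon\mathbf I\to\mathbb R$ is a pseudo-polynomial of degree $(n_1-1,\dots,n_d-1)$ and $\mu_{\mathbf b}$ $(\mathbf b\in\mathbf B)$ are Borel measures on $\mathbf I$ such that $\mu_{\mathbf b}(K)<\infty$ for every compact $K\subset\mathbf I$ and, for each $i=1,\dots,d$, if $b_i=L$ then the marginal measure of $\mu_{\mathbf b}$ corresponding to the $i$th coordinate is discrete. (Here $0^0=1$.)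
   Context: $\mathbb N=\{0,1,2,\dots\}$. Divided differences: for a real function $g$ of one variable and pairwise distinct points, $[x_0;g]=g(x_0)$ and $[x_0,\dots,x_n;g]=\dfrac{[x_1,\dots,x_n;g]-[x_0,\dots,x_{n-1};g]}{x_n-x_0}$ for $n\ge1$. Multiple divided differences: for $f\colon\mathbf I\to\mathbb R$, $\mathbf n\in\mathbb N^d$, and vectors $\mathbf x_i=(x_{i0},\dots,x_{in_i})\in I_i^{n_i+1}$ with pairwise distinct coordinates ($i=1,\dots,d$), $[\mathbf x_1;\dots;\mathbf x_d;f]$ is defined by induction on $d$: for $d=1$ it is $[x_{10},\dots,x_{1n_1};f]$; for $d>1$ it is $[x_{d0},\dots,x_{dn_d};g]$, where $g(x)=[\mathbf x_1;\dots;\mathbf x_{d-1};f(\cdot,\dots,\cdot,x)]$ for $x\in I_d$. $f$ is box-$\mathbf n$-convex if $[\mathbf x_1;\dots;\mathbf x_d;f]\ge0$ for all such $\mathbf x_1,\dots,\mathbf x_d$. A pseudo-polynomial of degree $(m_1,\dots,m_d)$ is a function $W(x_1,\dots,x_d)=\sum_{i=1}^d\sum_{k=0}^{m_i}A_{ik}(x_1,\dots,x_{i-1},x_{i+1},\dots,x_d)\,x_i^k$, where $A_{ik}\colon\prod_{j\ne i}I_j\to\mathbb R$ are arbitrary functions (constants if $d=1$). For $x,y\in\mathbb R$: $\chi_{x,y}^L=\mathbf 1_{(-\infty,y)}-\mathbf 1_{(-\infty,x)}$ and $\chi_{x,y}^r=\mathbf 1_{(-\infty,y]}-\mathbf 1_{(-\infty,x]}$.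 Borel measures are nonnegative. The marginal measure of $\mu$ corresponding to the $i$th coordinate is the image of $\mu$ under $(u_1,\dots,u_d)\mapsto u_i$. A measure is discrete if it is concentrated on a countable set. *)

theory Defs
  imports "HOL-Analysis.Analysis"
begin

text \<open>
  Points of \<open>I\<^sub>1 \<times> \<dots> \<times> I\<^sub>d\<close> are the extensional functions in \<^term>\<open>PiE {1..d} I\<close>.  As a
  subset of \<^typ>\<open>nat \<Rightarrow> real\<close> (product topology) this set is homeomorphic to
  \<open>I\<^sub>1 \<times> \<dots> \<times> I\<^sub>d\<close>, all coordinates outside \<open>{1..d}\<close> being fixed to \<^term>\<open>undefined\<close>.  Hence
  \<^const>\<open>compact\<close> and \<^term>\<open>restrict_space borel (PiE {1..d} I)\<close> have their usual meaning on it.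
\<close>

abbreviation cuboid :: "nat \<Rightarrow> (nat \<Rightarrow> real set) \<Rightarrow> (nat \<Rightarrow> real) set"
  where "cuboid d I \<equiv> PiE {1..d} I"

text \<open>\<open>divdiff n x g\<close> is \<open>[x 0, \<dots>, x n; g]\<close>; the values of \<open>x\<close> beyond \<open>n\<close> are irrelevant.\<close>

primrec divdiff :: "nat \<Rightarrow> (nat \<Rightarrow> real) \<Rightarrow> (real \<Rightarrow> real) \<Rightarrow> real" where
  "divdiff 0 x g = g (x 0)"
| "divdiff (Suc n) x g =
     (divdiff n (\<lambda>j. x (Suc j)) g - divdiff n x g) / (x (Suc n) - x 0)"

text \<open>
  \<open>mdivdiff d n x f\<close> is \<open>[x 1; \<dots>; x d; f]\<close> with \<open>x i = (x i 0, \<dots>, x i (n i))\<close>.  The base case is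
  the value of \<open>f\<close> at the only point of the empty product, so that for \<open>d = 1\<close> the recursion
  yields the one-variable divided difference.
\<close>

primrec mdivdiff ::
  "nat \<Rightarrow> (nat \<Rightarrow> nat) \<Rightarrow> (nat \<Rightarrow> nat \<Rightarrow> real) \<Rightarrow> ((nat \<Rightarrow> real) \<Rightarrow> real) \<Rightarrow> real" where
  "mdivdiff 0 n x f = f (\<lambda>_. undefined)"
| "mdivdiff (Suc d) n x f =
     divdiff (n (Suc d)) (x (Suc d)) (\<lambda>t. mdivdiff d n x (\<lambda>y. f (y(Suc d := t))))"

definition box_convex ::
  "nat \<Rightarrow> (nat \<Rightarrow> real set) \<Rightarrow> (nat \<Rightarrow> nat) \<Rightarrow> ((nat \<Rightarrow> real) \<Rightarrow> real) \<Rightarrow> bool" where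
  "box_convex d I n f \<longleftrightarrow>
     (\<forall>x. (\<forall>i\<in>{1..d}. (\<forall>j\<le>n i. x i j \<in> I i) \<and> inj_on (x i) {..n i}) \<longrightarrow>
          0 \<le> mdivdiff d n x f)"

text \<open>
  The coefficient \<open>A i k\<close> only sees the coordinates other than \<open>i\<close>; for \<open>d = 1\<close> its argument is
  the unique point of the empty product, so it is a constant.
\<close>

definition pseudo_polynomial ::
  "nat \<Rightarrow> (nat \<Rightarrow> real set) \<Rightarrow> (nat \<Rightarrow> nat) \<Rightarrow> ((nat \<Rightarrow> real) \<Rightarrow> real) \<Rightarrow> bool" where
  "pseudo_polynomial d I m W \<longleftrightarrow>
     (\<exists>A :: nat \<Rightarrow> nat \<Rightarrow> (nat \<Rightarrow> real) \<Rightarrow> real. \<forall>x\<in>cuboid d I.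
        W x = (\<Sum>i=1..d. \<Sum>k=0..m i. A i k (restrict x ({1..d} - {i})) * x i ^ k))"

datatype side = L | R

fun chi :: "side \<Rightarrow> real \<Rightarrow> real \<Rightarrow> real \<Rightarrow> real" where
  "chi L x y u = indicator {..<y} u - indicator {..<x} u"
| "chi R x y u = indicator {..y} u - indicator {..x} u"

definition sides :: "nat \<Rightarrow> (nat \<Rightarrow> nat) \<Rightarrow> (nat \<Rightarrow> side) set" where
  "sides d n = {b \<in> PiE {1..d} (\<lambda>_. {L, R}). \<forall>i\<in>{1..d}. 2 \<le> n i \<longrightarrow> b i = R}"

definition borel_measure_on :: "'a::topological_space set \<Rightarrow> 'a measure \<Rightarrow> bool" where
  "borel_measure_on S M \<longleftrightarrow> sets M = sets (restrict_space borel S)"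

definition finite_on_compacts :: "'a::topological_space set \<Rightarrow> 'a measure \<Rightarrow> bool" where
  "finite_on_compacts S M \<longleftrightarrow> (\<forall>K. compact K \<and> K \<subseteq> S \<longrightarrow> emeasure M K < \<infinity>)"

definition marginal :: "nat \<Rightarrow> (nat \<Rightarrow> real) measure \<Rightarrow> real measure" where
  "marginal i M = distr M borel (\<lambda>u. u i)"

definition discrete_measure :: "'a measure \<Rightarrow> bool" where
  "discrete_measure M \<longleftrightarrow> (\<exists>C. countable C \<and> (AE x in M. x \<in> C))"

end

theory Submission imports Defs begin

text \<open>
  Divided differences are finite linear combinations of point evaluations, and a multiple divided
  difference is the tensor product of its factors; two functions differ by a pseudo-polynomial iff all
  their multiple divided differences of order \<open>n\<close> agree.  Applied to the kernels, these functionals give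
  nonnegative products (the divided differences of a truncated power are B-splines), which is the
  easy direction.

  For the converse let first all \<open>n i = 1\<close>.  Then \<open>f\<close> defines a finitely additive measure on boxes
  whose faces are cuts of the line.  It is realised by adding one coordinate at a time, using
  Radon-Nikodym densities as conditional distribution functions.  A cut at \<open>u\<close> may lie to the left or to
  the right of \<open>u\<close> itself; the countably many cuts lying to the right with positive mass produce the
  sides \<open>L\<close>, all others are described by \<open>R\<close>.  If some \<open>n i \<ge> 2\<close>, normalise \<open>f\<close> by
  interpolation in the other coordinates.  Its right derivative in coordinate \<open>i\<close> exists and is
  box-convex of the order lowered by one, and integrating the representation of the derivative gives the
  one of \<open>f\<close> by Fubini's theorem, because the kernel of order \<open>n i\<close> is the primitive of the kernel of
  order \<open>n i - 1\<close>.
\<close>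

text \<open>A pseudo-polynomial has arbitrary coefficients, so for \<open>d \<ge> 2\<close> the
  function \<open>f\<close> need not be measurable, and its sections in one coordinate need not be
  differentiable or even locally bounded. Nothing analytic can be done to \<open>f\<close> itself.
  Interpolation errors in the other coordinates remove the arbitrary part: each section of the
  result is a multiple of an ordinary convex function of order \<open>n i\<close>. For the same
  reason a representation is only ever tested by divided differences, and \<open>W\<close> is
  defined at the very end as whatever is left over. These tests are finite combinations of values,
  so limits and integrals pass through them without any joint regularity.

  The order-one case is where sides become unavoidable: increments of \<open>f\<close> may jump from
  the left, from the right or from both at the same place, and the way the jump is shared may depend
  on the other coordinates. A distribution of points cannot record this, a joint law of cuts can.
  Only positions of positive mass need the extra bit, hence the discrete marginals for side
  \<open>L\<close>.\<close>

section \<open>Finitely supported functionals and their tensor products\<close>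

text \<open>Generated by closure rules rather than given as a weighted sum over a support: every
  interchange below, with limits, integrals or another functional, is then an induction over four
  rules, and no support has to be chosen.\<close>

inductive fin_functional :: "'a set \<Rightarrow> (('a \<Rightarrow> real) \<Rightarrow> real) \<Rightarrow> bool" for S :: "'a set" where
  eval: "p \<in> S \<Longrightarrow> fin_functional S (\<lambda>\<phi>. \<phi> p)"
| zero: "fin_functional S (\<lambda>\<phi>. 0)"
| add: "fin_functional S K \<Longrightarrow> fin_functional S \<Lambda> \<Longrightarrow> fin_functional S (\<lambda>\<phi>. K \<phi> + \<Lambda> \<phi>)"
| scale: "fin_functional S \<Lambda> \<Longrightarrow> fin_functional S (\<lambda>\<phi>. c * \<Lambda> \<phi>)"

lemma fin_functional_cong:
  assumes "fin_functional S \<Lambda>" "\<And>p. p \<in> S \<Longrightarrow> \<phi> p = \<psi> p"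
  shows "\<Lambda> \<phi> = \<Lambda> \<psi>"
  using assms by (induction) auto

lemma fin_functional_sum:
  assumes "finite A" "\<And>a. a \<in> A \<Longrightarrow> fin_functional S (\<Lambda> a)"
  shows "fin_functional S (\<lambda>\<phi>. \<Sum>a\<in>A. \<Lambda> a \<phi>)"
  using assms by (induction A rule: finite_induct) (auto intro: fin_functional.intros)

lemma fin_functional_diff:
  assumes "fin_functional S K" "fin_functional S \<Lambda>"
  shows "fin_functional S (\<lambda>\<phi>. K \<phi> - \<Lambda> \<phi>)"
  using fin_functional.add[OF assms(1) fin_functional.scale[OF assms(2), of "-1"]] by simp

lemma fin_functional_weighted_sum:
  assumes "finite P" "P \<subseteq> S"
  shows "fin_functional S (\<lambda>\<phi>. \<Sum>p\<in>P. w p * \<phi> p)"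
  using assms by (intro fin_functional_sum fin_functional.scale fin_functional.eval) auto

lemma fin_functional_comp:
  assumes "fin_functional S \<Lambda>" "\<And>p. p \<in> S \<Longrightarrow> h p \<in> S'"
  shows "fin_functional S' (\<lambda>\<phi>. \<Lambda> (\<lambda>p. \<phi> (h p)))"
  using assms by induction (auto intro: fin_functional.intros)

context
  fixes S :: "'a set" and \<Lambda> :: "('a \<Rightarrow> real) \<Rightarrow> real"
  assumes \<Lambda>: "fin_functional S \<Lambda>"
begin

lemma fin_functional_zero_fun: "\<Lambda> (\<lambda>p. 0) = 0"
  using \<Lambda> by induction auto

lemma fin_functional_add_fun: "\<Lambda> (\<lambda>p. \<phi> p + \<psi> p) = \<Lambda> \<phi> + \<Lambda> \<psi>"
  using \<Lambda> by induction (auto simp: algebra_simps)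

lemma fin_functional_scale_fun: "\<Lambda> (\<lambda>p. c * \<phi> p) = c * \<Lambda> \<phi>"
  using \<Lambda> by induction (auto simp: algebra_simps)

lemma fin_functional_scale_fun_right: "\<Lambda> (\<lambda>p. \<phi> p * c) = \<Lambda> \<phi> * c"
  using fin_functional_scale_fun[of c \<phi>] by (simp add: mult.commute)

lemma fin_functional_diff_fun: "\<Lambda> (\<lambda>p. \<phi> p - \<psi> p) = \<Lambda> \<phi> - \<Lambda> \<psi>"
  using fin_functional_add_fun[of \<phi> "\<lambda>p. -1 * \<psi> p"] fin_functional_scale_fun[of "-1" \<psi>] by simp

lemma fin_functional_sum_fun: "\<Lambda> (\<lambda>p. \<Sum>a\<in>A. \<phi> a p) = (\<Sum>a\<in>A. \<Lambda> (\<phi> a))"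
  by (induction A rule: infinite_finite_induct)
    (auto simp: fin_functional_zero_fun fin_functional_add_fun)

lemma fin_functional_commute:
  assumes "fin_functional S' K"
  shows "\<Lambda> (\<lambda>s. K (\<lambda>t. \<phi> s t)) = K (\<lambda>t. \<Lambda> (\<lambda>s. \<phi> s t))"
  using assms
proof induction
  case zero
  then show ?case by (simp add: fin_functional_zero_fun)
qed (auto simp: fin_functional_add_fun fin_functional_scale_fun)

lemma fin_functional_tendsto:
  assumes "\<And>p. p \<in> S \<Longrightarrow> ((\<lambda>k. \<phi> k p) \<longlongrightarrow> \<psi> p) F"
  shows "((\<lambda>k. \<Lambda> (\<phi> k)) \<longlongrightarrow> \<Lambda> \<psi>) F"
  using \<Lambda> assms by induction (auto intro!: tendsto_intros)

lemma fin_functional_integral: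
  assumes "\<And>p. p \<in> S \<Longrightarrow> integrable M (\<phi> p)"
  shows "integrable M (\<lambda>u. \<Lambda> (\<lambda>p. \<phi> p u))"
    and "\<Lambda> (\<lambda>p. \<integral>u. \<phi> p u \<partial>M) = (\<integral>u. \<Lambda> (\<lambda>p. \<phi> p u) \<partial>M)"
proof -
  have "integrable M (\<lambda>u. \<Lambda> (\<lambda>p. \<phi> p u)) \<and>
      \<Lambda> (\<lambda>p. \<integral>u. \<phi> p u \<partial>M) = (\<integral>u. \<Lambda> (\<lambda>p. \<phi> p u) \<partial>M)"
    using \<Lambda> assms by induction auto
  then show "integrable M (\<lambda>u. \<Lambda> (\<lambda>p. \<phi> p u))"
    and "\<Lambda> (\<lambda>p. \<integral>u. \<phi> p u \<partial>M) = (\<integral>u. \<Lambda> (\<lambda>p. \<phi> p u) \<partial>M)" by auto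
qed

lemma fin_functional_has_integral:
  assumes "\<And>p. p \<in> S \<Longrightarrow> (\<phi> p has_integral \<psi> p) A"
  shows "((\<lambda>u. \<Lambda> (\<lambda>p. \<phi> p u)) has_integral \<Lambda> \<psi>) A"
  using \<Lambda> assms
  by induction (auto intro: has_integral_add has_integral_mult_right)

end

section \<open>Tensor products with one functional per coordinate\<close>

primrec tensor ::
  "nat \<Rightarrow> (nat \<Rightarrow> (real \<Rightarrow> real) \<Rightarrow> real) \<Rightarrow> ((nat \<Rightarrow> real) \<Rightarrow> real) \<Rightarrow> real" where
  "tensor 0 \<Lambda> f = f (\<lambda>_. undefined)"
| "tensor (Suc d) \<Lambda> f = \<Lambda> (Suc d) (\<lambda>t. tensor d \<Lambda> (\<lambda>y. f (y(Suc d := t))))"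

text \<open>The factors of \<open>tensor\<close> may be arbitrary, since evaluations, increments and
  interpolation errors will occur next to divided differences in one and the same product.\<close>

lemma mdivdiff_eq_tensor: "mdivdiff d n x f = tensor d (\<lambda>i. divdiff (n i) (x i)) f"
  by (induction d arbitrary: f) auto

lemma cuboid_upd_Suc: "y \<in> cuboid d I \<Longrightarrow> t \<in> I (Suc d) \<Longrightarrow> y(Suc d := t) \<in> cuboid (Suc d) I"
  by (auto simp: PiE_iff extensional_def)

lemma cuboid_upd: "y \<in> cuboid d I \<Longrightarrow> i \<in> {1..d} \<Longrightarrow> t \<in> I i \<Longrightarrow> y(i := t) \<in> cuboid d I"
  by (auto simp: PiE_iff extensional_def)

lemma tensor_cong_functional:
  "(\<And>i. i \<in> {1..d} \<Longrightarrow> \<Lambda> i = \<Lambda>' i) \<Longrightarrow> tensor d \<Lambda> f = tensor d \<Lambda>' f"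
  by (induction d arbitrary: f) auto

lemma fin_functional_tensor:
  assumes "\<And>i. i \<in> {1..d} \<Longrightarrow> fin_functional (I i) (\<Lambda> i)"
  shows "fin_functional (cuboid d I) (tensor d \<Lambda>)"
  using assms
proof (induction d)
  case 0
  have "(\<lambda>_. undefined) \<in> cuboid 0 I" by auto
  then show ?case using fin_functional.eval[of "\<lambda>_. undefined" "cuboid 0 I"] by (simp add: fun_eq_iff)
next
  case (Suc d)
  have IH: "fin_functional (cuboid d I) (tensor d \<Lambda>)" using Suc by auto
  have step: "fin_functional (cuboid (Suc d) I) (\<lambda>f. K (\<lambda>t. tensor d \<Lambda> (\<lambda>y. f (y(Suc d := t)))))"
    if "fin_functional (I (Suc d)) K" for K
    using that
  proof induction
    case (eval p)
    then show ?case
      by (intro fin_functional_comp[OF IH] cuboid_upd_Suc)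
  qed (auto intro: fin_functional.intros)
  show ?case using step[OF Suc.prems[of "Suc d"]] by (simp add: fun_eq_iff)
qed

lemma tensor_eval:
  assumes "x \<in> cuboid d I"
  shows "tensor d (\<lambda>i \<phi>. \<phi> (x i)) f = f x"
  using assms
proof (induction d arbitrary: f x)
  case 0
  then show ?case by (auto simp: PiE_iff extensional_def intro!: arg_cong[of _ _ f])
next
  case (Suc d)
  have x: "restrict x {1..d} \<in> cuboid d I" using Suc.prems by (auto simp: PiE_iff)
  have "tensor d (\<lambda>i \<phi>. \<phi> (x i)) (\<lambda>y. f (y(Suc d := x (Suc d)))) =
      tensor d (\<lambda>i \<phi>. \<phi> (restrict x {1..d} i)) (\<lambda>y. f (y(Suc d := x (Suc d))))"
    by (rule tensor_cong_functional) auto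
  also have "\<dots> = f ((restrict x {1..d})(Suc d := x (Suc d)))" by (rule Suc.IH[OF x])
  also have "(restrict x {1..d})(Suc d := x (Suc d)) = x"
    using Suc.prems by (auto simp: PiE_iff extensional_def fun_eq_iff)
  finally show ?case unfolding tensor.simps .
qed

lemma tensor_prod:
  assumes "\<And>i. i \<in> {1..d} \<Longrightarrow> fin_functional (I i) (\<Lambda> i)"
  shows "tensor d \<Lambda> (\<lambda>x. \<Prod>j=1..d. k j (x j)) = (\<Prod>j=1..d. \<Lambda> j (k j))"
  using assms
proof (induction d)
  case (Suc d)
  have T: "fin_functional (cuboid d I) (tensor d \<Lambda>)" using Suc by (intro fin_functional_tensor) auto
  have "(\<Prod>j=1..d. k j ((y(Suc d := t)) j)) = (\<Prod>j=1..d. k j (y j))" for t and y :: "nat \<Rightarrow> real"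
    by (rule prod.cong) auto
  then have "tensor (Suc d) \<Lambda> (\<lambda>x. \<Prod>j=1..Suc d. k j (x j)) =
      \<Lambda> (Suc d) (\<lambda>t. tensor d \<Lambda> (\<lambda>y. (\<Prod>j=1..d. k j (y j)) * k (Suc d) t))"
    by (simp add: prod.nat_ivl_Suc')
  also have "\<dots> = \<Lambda> (Suc d) (\<lambda>t. (\<Prod>j=1..d. \<Lambda> j (k j)) * k (Suc d) t)"
    using Suc by (simp add: fin_functional_scale_fun_right[OF T])
  also have "\<dots> = (\<Prod>j=1..Suc d. \<Lambda> j (k j))"
    using Suc.prems[of "Suc d"] by (simp add: fin_functional_scale_fun prod.nat_ivl_Suc')
  finally show ?case .
qed simp

text \<open>Functionals in different coordinates commute, so the factor in coordinate
  \<open>i\<close> can be pulled outermost. What remains is a function of the single variable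
  \<open>t\<close>, to which the one-variable theory applies.\<close>

lemma tensor_extract:
  assumes "\<And>i. i \<in> {1..d} \<Longrightarrow> fin_functional (I i) (\<Lambda> i)" and "i \<in> {1..d}"
  shows "tensor d \<Lambda> f = \<Lambda> i (\<lambda>t. tensor d (\<Lambda>(i := (\<lambda>\<phi>. \<phi> t))) f)"
  using assms
proof (induction d arbitrary: f)
  case (Suc d)
  show ?case
  proof (cases "i = Suc d")
    case True
    have "tensor d (\<Lambda>(i := (\<lambda>\<phi>. \<phi> t))) g = tensor d \<Lambda> g" for t g
      by (rule tensor_cong_functional) (use True in auto)
    then show ?thesis unfolding tensor.simps True by simp
  next
    case False
    then have i: "i \<in> {1..d}" using Suc.prems by auto
    have IH: "tensor d \<Lambda> g = \<Lambda> i (\<lambda>t. tensor d (\<Lambda>(i := (\<lambda>\<phi>. \<phi> t))) g)" for g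
      by (rule Suc.IH[OF _ i]) (use Suc.prems in auto)
    have "tensor (Suc d) \<Lambda> f =
        \<Lambda> (Suc d) (\<lambda>s. \<Lambda> i (\<lambda>t. tensor d (\<Lambda>(i := (\<lambda>\<phi>. \<phi> t))) (\<lambda>y. f (y(Suc d := s)))))"
      unfolding tensor.simps IH ..
    also have "\<dots> = \<Lambda> i (\<lambda>t. \<Lambda> (Suc d) (\<lambda>s. tensor d (\<Lambda>(i := (\<lambda>\<phi>. \<phi> t))) (\<lambda>y. f (y(Suc d := s)))))"
      using Suc.prems i by (intro fin_functional_commute[of "I (Suc d)" _ "I i"]) auto
    finally show ?thesis using False unfolding tensor.simps by simp
  qed
qed simp

lemma tensor_update_diff:
  assumes "\<And>j. j \<in> {1..d} \<Longrightarrow> fin_functional (I j) (\<Lambda> j)" and i: "i \<in> {1..d}"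
    and "fin_functional (I i) K" "fin_functional (I i) K'"
  shows "tensor d (\<Lambda>(i := (\<lambda>\<phi>. K \<phi> - K' \<phi>))) f = tensor d (\<Lambda>(i := K)) f - tensor d (\<Lambda>(i := K')) f"
proof -
  have *: "tensor d (\<Lambda>(i := J)) f = J (\<lambda>t. tensor d (\<Lambda>(i := (\<lambda>\<phi>. \<phi> t))) f)"
    if "fin_functional (I i) J" for J
    using tensor_extract[of d I "\<Lambda>(i := J)" i f] assms(1) i that by auto
  show ?thesis
    using assms(3,4) by (simp add: * fin_functional_diff)
qed

lemma tensor_zero_functional:
  assumes "\<And>j. j \<in> {1..d} \<Longrightarrow> fin_functional (I j) (\<Lambda> j)" and i: "i \<in> {1..d}"
    and "\<Lambda> i = (\<lambda>\<phi>. 0)"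
  shows "tensor d \<Lambda> f = 0"
  using tensor_extract[where f = f, OF assms(1) i] assms(3) by simp

lemma tensor_scale:
  assumes "\<And>i. i \<in> {1..d} \<Longrightarrow> fin_functional (I i) (\<Lambda> i)"
  shows "tensor d (\<lambda>i \<phi>. c i * \<Lambda> i \<phi>) f = (\<Prod>i=1..d. c i) * tensor d \<Lambda> f"
  using assms
proof (induction d arbitrary: f)
  case (Suc d)
  then show ?case
    using fin_functional_scale_fun[OF Suc.prems[of "Suc d"]] by (simp add: prod.nat_ivl_Suc')
qed simp

text \<open>If a function of \<open>x\<close> was itself obtained from \<open>f\<close> by
  functionals depending on one coordinate each, a further tensor product fuses with them coordinate
  by coordinate. This handles both the normalisation by interpolation and the anchoring of
  increments at a base point.\<close>

lemma tensor_compose: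
  assumes "\<And>i. i \<in> {1..d} \<Longrightarrow> fin_functional (I i) (\<Lambda> i)"
    and "\<And>i t. i \<in> {1..d} \<Longrightarrow> t \<in> I i \<Longrightarrow> fin_functional (I' i) (M i t)"
  shows "tensor d \<Lambda> (\<lambda>x. tensor d (\<lambda>i. M i (x i)) f) = tensor d (\<lambda>i \<phi>. \<Lambda> i (\<lambda>t. M i t \<phi>)) f"
  using assms
proof (induction d arbitrary: f)
  case (Suc d)
  have T: "fin_functional (cuboid d I) (tensor d \<Lambda>)" using Suc by (intro fin_functional_tensor) auto
  have c: "tensor d (\<lambda>i. M i ((y(Suc d := t)) i)) g = tensor d (\<lambda>i. M i (y i)) g"
    for t and y :: "nat \<Rightarrow> real" and g
    by (rule tensor_cong_functional) auto
  have "tensor (Suc d) \<Lambda> (\<lambda>x. tensor (Suc d) (\<lambda>i. M i (x i)) f) =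
      \<Lambda> (Suc d) (\<lambda>t. tensor d \<Lambda> (\<lambda>y. M (Suc d) t
        (\<lambda>r. tensor d (\<lambda>i. M i (y i)) (\<lambda>z. f (z(Suc d := r))))))"
    unfolding tensor.simps c by simp
  also have "\<dots> = \<Lambda> (Suc d) (\<lambda>t. M (Suc d) t (\<lambda>r. tensor d \<Lambda>
        (\<lambda>y. tensor d (\<lambda>i. M i (y i)) (\<lambda>z. f (z(Suc d := r))))))"
    by (rule fin_functional_cong[OF Suc.prems(1)])
      (auto intro!: fin_functional_commute[OF T] Suc.prems(2))
  also have "\<dots> = tensor (Suc d) (\<lambda>i \<phi>. \<Lambda> i (\<lambda>t. M i t \<phi>)) f"
    using Suc by simp
  finally show ?case .
qed simp

text \<open>The counterpart of \<open>tensor_extract\<close>: here the factor in coordinate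
  \<open>i\<close> is moved innermost, where it meets the sections of \<open>f\<close>.\<close>

lemma tensor_kill:
  assumes "\<And>j. j \<in> {1..d} \<Longrightarrow> fin_functional (I j) (\<Lambda> j)" and "i \<in> {1..d}"
    and "\<And>x. x \<in> cuboid d I \<Longrightarrow> \<Lambda> i (\<lambda>t. f (x(i := t))) = 0"
  shows "tensor d \<Lambda> f = 0"
  using assms
proof (induction d arbitrary: f)
  case (Suc d)
  show ?case
  proof (cases "i = Suc d")
    case i: True
    have T: "fin_functional (cuboid d I) (tensor d \<Lambda>)" using Suc by (intro fin_functional_tensor) auto
    have "tensor (Suc d) \<Lambda> f = tensor d \<Lambda> (\<lambda>y. \<Lambda> i (\<lambda>t. f (y(i := t))))"
      unfolding tensor.simps i
      using Suc.prems(1) by (intro fin_functional_commute[OF _ T]) auto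
    also have "\<dots> = tensor d \<Lambda> (\<lambda>y. 0)"
    \<comment> \<open>The hypothesis speaks of points of the larger cuboid. If \<open>I i\<close> is
      empty there are none, but then a functional on \<open>I i\<close> reads no values and
      vanishes.\<close>
    proof (cases "I i = {}")
      case True
      then have "\<Lambda> i \<phi> = 0" for \<phi>
        using fin_functional_cong[OF Suc.prems(1)[OF Suc.prems(2)], of \<phi> "\<lambda>_. 0"]
          fin_functional_zero_fun[OF Suc.prems(1)[OF Suc.prems(2)]] by simp
      then show ?thesis by simp
    next
      case False
      then obtain s where s: "s \<in> I i" by auto
      have "\<Lambda> i (\<lambda>t. f (y(i := t))) = 0" if "y \<in> cuboid d I" for y
      proof -
        have "y(Suc d := s) \<in> cuboid (Suc d) I"
          using that s unfolding i by (rule cuboid_upd_Suc)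
        from Suc.prems(3)[OF this] show ?thesis unfolding i fun_upd_upd .
      qed
      then show ?thesis by (rule fin_functional_cong[OF T])
    qed
    finally show ?thesis by (simp add: fin_functional_zero_fun[OF T])
  next
    case False
    then have i: "i \<in> {1..d}" using Suc.prems by auto
    have "tensor d \<Lambda> (\<lambda>y. f (y(Suc d := s))) = 0" if "s \<in> I (Suc d)" for s
    proof (rule Suc.IH[OF _ i])
      fix x assume "x \<in> cuboid d I"
      then have "x(Suc d := s) \<in> cuboid (Suc d) I" using that by (rule cuboid_upd_Suc)
      from Suc.prems(3)[OF this] show "\<Lambda> i (\<lambda>t. f (x(i := t, Suc d := s))) = 0"
        unfolding fun_upd_twist[OF False] .
    qed (use Suc.prems in auto)
    then have "tensor (Suc d) \<Lambda> f = \<Lambda> (Suc d) (\<lambda>t. 0)"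
      unfolding tensor.simps by (intro fin_functional_cong[OF Suc.prems(1)]) auto
    then show ?thesis using fin_functional_zero_fun[OF Suc.prems(1)[of "Suc d"]] by simp
  qed
qed simp


section \<open>Divided differences\<close>

text \<open>The explicit sum depends only on the set of nodes, so the symmetry of divided
  differences is built in.\<close>

definition dd :: "real set \<Rightarrow> (real \<Rightarrow> real) \<Rightarrow> real" where
  "dd S \<phi> = (\<Sum>p\<in>S. \<phi> p / (\<Prod>q\<in>S - {p}. p - q))"

lemma fin_functional_dd:
  assumes "finite S" "S \<subseteq> J"
  shows "fin_functional J (dd S)"
  using fin_functional_weighted_sum[OF assms, of "\<lambda>p. 1 / (\<Prod>q\<in>S - {p}. p - q)"]
  by (simp add: dd_def[abs_def])

lemma fin_functional_ddI:
  assumes "card S = Suc n" "S \<subseteq> J"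
  shows "fin_functional J (dd S)"
  using assms card_ge_0_finite[of S] by (intro fin_functional_dd) auto

lemma dd_cong: "(\<And>p. p \<in> S \<Longrightarrow> \<phi> p = \<psi> p) \<Longrightarrow> dd S \<phi> = dd S \<psi>"
  by (simp add: dd_def)

text \<open>The factor \<open>t - a\<close> vanishes at the new node and cancels the new factor in
  the denominators at the old ones.\<close>

lemma dd_insert_mult:
  assumes "finite S" "a \<notin> S"
  shows "dd (insert a S) (\<lambda>t. (t - a) * \<phi> t) = dd S \<phi>"
proof -
  have "(p - a) * \<phi> p / (\<Prod>q\<in>insert a S - {p}. p - q) = \<phi> p / (\<Prod>q\<in>S - {p}. p - q)"
    if "p \<in> S" for p
  proof -
    have "insert a S - {p} = insert a (S - {p})" "p \<noteq> a" using that assms by auto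
    then show ?thesis using assms by simp
  qed
  then show ?thesis using assms by (simp add: dd_def)
qed

lemma dd_linear:
  assumes "finite S"
  shows "dd S (\<lambda>t. \<phi> t + \<psi> t) = dd S \<phi> + dd S \<psi>"
    and "dd S (\<lambda>t. \<phi> t - \<psi> t) = dd S \<phi> - dd S \<psi>"
    and "dd S (\<lambda>t. c * \<phi> t) = c * dd S \<phi>"
    and "dd S (\<lambda>t. \<phi> t / c) = dd S \<phi> / c"
    and "dd S (\<lambda>t. \<Sum>a\<in>A. \<Phi> a t) = (\<Sum>a\<in>A. dd S (\<Phi> a))"
  using fin_functional_scale_fun[OF fin_functional_dd[OF assms subset_UNIV], of "1 / c" \<phi>]
  by (simp_all add: fin_functional_dd[OF assms subset_UNIV, THEN fin_functional_add_fun]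
      fin_functional_dd[OF assms subset_UNIV, THEN fin_functional_diff_fun]
      fin_functional_dd[OF assms subset_UNIV, THEN fin_functional_scale_fun]
      fin_functional_dd[OF assms subset_UNIV, THEN fin_functional_sum_fun])

text \<open>Both divided differences on the right live on the full node set after multiplication by
  \<open>t - a\<close> and \<open>t - b\<close>, by \<open>dd_insert_mult\<close>; these factors
  differ by the constant \<open>b - a\<close>.\<close>

lemma dd_recursion:
  assumes "finite S" "a \<notin> S" "b \<notin> S" "a \<noteq> b"
  shows "(b - a) * dd (insert a (insert b S)) \<phi> = dd (insert b S) \<phi> - dd (insert a S) \<phi>"
proof -
  let ?T = "insert a (insert b S)"
  have "dd (insert b S) \<phi> = dd ?T (\<lambda>t. (t - a) * \<phi> t)"
    using assms by (intro dd_insert_mult[symmetric]) auto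
  moreover have "dd (insert a S) \<phi> = dd ?T (\<lambda>t. (t - b) * \<phi> t)"
    using dd_insert_mult[of "insert a S" b \<phi>] assms by (simp add: insert_commute)
  moreover have "dd ?T (\<lambda>t. (b - a) * \<phi> t) = dd ?T (\<lambda>t. (t - a) * \<phi> t - (t - b) * \<phi> t)"
    by (simp add: algebra_simps)
  ultimately show ?thesis using assms by (simp add: dd_linear)
qed

lemma divdiff_eq_dd:
  assumes "inj_on x {..n}"
  shows "divdiff n x \<phi> = dd (x ` {..n}) \<phi>"
  using assms
proof (induction n arbitrary: x)
  case 0
  then show ?case by (simp add: dd_def)
next
  case (Suc n)
  let ?S = "x ` {1..n}"
  have 1: "divdiff n x \<phi> = dd (insert (x 0) ?S) \<phi>"
  proof -
    have "{..n} = insert 0 {1..n}" by auto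
    moreover have "inj_on x {..n}" using Suc.prems by (auto simp: inj_on_def)
    ultimately show ?thesis using Suc.IH[of x] by simp
  qed
  have 2: "divdiff n (\<lambda>j. x (Suc j)) \<phi> = dd (insert (x (Suc n)) ?S) \<phi>"
  proof -
    have "inj_on (\<lambda>j. x (Suc j)) {..n}" using Suc.prems by (auto simp: inj_on_def)
    moreover have "(\<lambda>j. x (Suc j)) ` {..n} = x ` Suc ` {..n}" by (simp add: image_image)
    moreover have "Suc ` {..n} = insert (Suc n) {1..n}" by (auto simp: image_Suc_atMost)
    ultimately show ?thesis using Suc.IH by simp
  qed
  have 3: "x ` {..Suc n} = insert (x 0) (insert (x (Suc n)) ?S)"
  proof -
    have "{..Suc n} = insert 0 (insert (Suc n) {1..n})" by auto
    then show ?thesis by simp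
  qed
  have "x 0 \<notin> ?S" "x (Suc n) \<notin> ?S" "x 0 \<noteq> x (Suc n)"
    using Suc.prems by (auto simp: inj_on_eq_iff)
  then show ?case
    using dd_recursion[of ?S "x 0" "x (Suc n)" \<phi>] 1 2 3 by (simp add: field_simps)
qed

lemma dd_const:
  assumes "2 \<le> card S"
  shows "dd S (\<lambda>t. c) = 0"
  using assms
proof (induction "card S" arbitrary: S rule: less_induct)
  case less
  then obtain a where a: "a \<in> S" by fastforce
  have fin: "finite S" using less.prems card_ge_0_finite[of S] by simp
  have "card (S - {a}) \<ge> 1" using a less.prems fin by simp
  then have "S - {a} \<noteq> {}" by (intro notI) simp
  then obtain b where b: "b \<in> S - {a}" by blast
  define T where "T = S - {a} - {b}"
  have S: "S = insert a (insert b T)" "a \<notin> T" "b \<notin> T" "a \<noteq> b" "finite T"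
    using a b fin by (auto simp: T_def)
  have c: "card S = Suc (Suc (card T))" using S by simp
  \<comment> \<open>With a single node left both sides are \<open>c\<close>; with more nodes both
    vanish by induction.\<close>
  have "dd (insert b T) (\<lambda>t. c) = dd (insert a T) (\<lambda>t. c)"
  proof (cases "T = {}")
    case True
    then show ?thesis by (simp add: dd_def)
  next
    case False
    then have "card T \<ge> 1" using S by (simp add: card_gt_0_iff Suc_le_eq)
    then have "dd (insert b T) (\<lambda>t. c) = 0" "dd (insert a T) (\<lambda>t. c) = 0"
      using S c by (auto intro!: less.hyps)
    then show ?thesis by simp
  qed
  then show ?case using dd_recursion[of T a b "\<lambda>t. c"] S by simp
qed

text \<open>Write \<open>t ^ Suc k\<close> as \<open>(t - a) * t ^ k + a * t ^ k\<close>; the first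
  summand drops the node \<open>a\<close>. The value 1 for \<open>Suc k\<close> needs the value 1 on
  the smaller set and the value 0 on \<open>S\<close>, so both claims are proved in one
  induction.\<close>

lemma dd_power:
  assumes "finite S"
  shows "Suc k < card S \<Longrightarrow> dd S (\<lambda>t. t ^ k) = 0"
    and "card S = Suc k \<Longrightarrow> dd S (\<lambda>t. t ^ k) = 1"
proof -
  have "(Suc k < card S \<longrightarrow> dd S (\<lambda>t. t ^ k) = 0) \<and> (card S = Suc k \<longrightarrow> dd S (\<lambda>t. t ^ k) = 1)"
    using assms
  proof (induction k arbitrary: S)
    case 0
    have "dd S (\<lambda>t. 1) = 1" if "card S = 1"
      using that by (auto simp: card_1_singleton_iff dd_def)
    then show ?case using dd_const[of S 1] by auto
  next
    case (Suc k)
    show ?case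
    proof (cases "card S \<ge> Suc (Suc k)")
      case True
      then obtain a where a: "a \<in> S" by fastforce
      define T where "T = S - {a}"
      have S: "S = insert a T" "a \<notin> T" "finite T" using a Suc.prems by (auto simp: T_def)
      have "dd S (\<lambda>t. t ^ Suc k) = dd S (\<lambda>t. (t - a) * t ^ k + a * t ^ k)"
        by (simp add: algebra_simps)
      also have "\<dots> = dd T (\<lambda>t. t ^ k) + a * dd S (\<lambda>t. t ^ k)"
        using S dd_insert_mult[of T a "\<lambda>t. t ^ k"] by (simp add: dd_linear)
      finally show ?thesis
        using Suc.IH[OF S(3)] Suc.IH[OF Suc.prems] S True by auto
    qed auto
  qed
  then show "Suc k < card S \<Longrightarrow> dd S (\<lambda>t. t ^ k) = 0"
    and "card S = Suc k \<Longrightarrow> dd S (\<lambda>t. t ^ k) = 1" by auto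
qed

lemma dd_poly:
  assumes "Suc (degree p) < card S"
  shows "dd S (poly p) = 0"
proof -
  have fin: "finite S" using assms card_ge_0_finite[of S] by simp
  have "dd S (poly p) = (\<Sum>i\<le>degree p. coeff p i * dd S (\<lambda>t. t ^ i))"
    using dd_linear(5)[OF fin, of "\<lambda>i t. coeff p i * t ^ i" "{..degree p}"] fin
    by (simp add: poly_altdef[abs_def] dd_linear)
  also have "\<dots> = 0" using assms fin by (intro sum.neutral) (auto simp: dd_power)
  finally show ?thesis .
qed

section \<open>Lagrange interpolation and its error\<close>

definition lagrange_basis :: "real set \<Rightarrow> real \<Rightarrow> real poly" where
  "lagrange_basis T p = smult (1 / (\<Prod>q\<in>T - {p}. p - q)) (\<Prod>q\<in>T - {p}. [:- q, 1:])"

lemma degree_lagrange_basis: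
  assumes "finite T" "p \<in> T"
  shows "degree (lagrange_basis T p) < card T"
proof -
  have "degree (lagrange_basis T p) \<le> degree (\<Prod>q\<in>T - {p}. [:- q, 1:])"
    unfolding lagrange_basis_def by (rule degree_smult_le)
  also have "\<dots> \<le> (\<Sum>q\<in>T - {p}. degree [:- q, 1:])"
    using degree_prod_sum_le[of "T - {p}" "\<lambda>q. [:- q, 1:]"] assms by (simp add: o_def)
  also have "\<dots> = card T - 1" using assms by simp
  also have "\<dots> < card T" using assms card_gt_0_iff[of T] by (metis diff_less empty_iff zero_less_one)
  finally show ?thesis .
qed

text \<open>The last argument is the function, so that \<open>interp_error T s\<close> is a
  functional and can serve as a factor of \<open>tensor\<close>.\<close>

definition interp_error :: "real set \<Rightarrow> real \<Rightarrow> (real \<Rightarrow> real) \<Rightarrow> real" where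
  "interp_error T s \<phi> = \<phi> s - (\<Sum>p\<in>T. poly (lagrange_basis T p) s * \<phi> p)"

text \<open>Newton's form of the remainder. In the explicit sum for the nodes
  \<open>insert s T\<close> the term at \<open>s\<close> contributes \<open>\<phi> s\<close>, and
  the term at \<open>p\<close> a Lagrange basis value with a minus sign coming from
  \<open>(s - p) / (p - s)\<close>.\<close>

lemma interp_error_eq_dd:
  assumes "finite T" "s \<notin> T"
  shows "interp_error T s \<phi> = (\<Prod>q\<in>T. s - q) * dd (insert s T) \<phi>"
proof -
  let ?w = "\<Prod>q\<in>T. s - q"
  have w: "?w \<noteq> 0" using assms by auto
  have "?w * (\<phi> p / (\<Prod>q\<in>insert s T - {p}. p - q)) = - (poly (lagrange_basis T p) s * \<phi> p)"
    if p: "p \<in> T" for p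
  proof -
    have "?w = (s - p) * (\<Prod>q\<in>T - {p}. s - q)" using assms p by (simp add: prod.remove)
    moreover have "insert s T - {p} = insert s (T - {p})" using p assms by auto
    then have "(\<Prod>q\<in>insert s T - {p}. p - q) = (p - s) * (\<Prod>q\<in>T - {p}. p - q)"
      using assms by simp
    moreover have "(s - p) * A * (f / ((p - s) * B)) = - (1 / B * A * f)" for A B f :: real
    proof -
      have "s \<noteq> p" using p assms by auto
      then have "(s - p) / (p - s) = -1" by (simp add: field_simps)
      moreover have "(s - p) * A * (f / ((p - s) * B)) = (s - p) / (p - s) * (1 / B * A * f)" by simp
      ultimately show ?thesis by simp
    qed
    ultimately show ?thesis
      by (simp add: lagrange_basis_def poly_prod)
  qed
  then have "?w * (\<Sum>p\<in>T. \<phi> p / (\<Prod>q\<in>insert s T - {p}. p - q)) =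
      - (\<Sum>p\<in>T. poly (lagrange_basis T p) s * \<phi> p)"
    by (simp add: sum_distrib_left sum_negf del: Diff_insert_absorb)
  moreover have "insert s T - {s} = T" using assms by auto
  ultimately show ?thesis
    using assms w by (simp add: interp_error_def dd_def distrib_left)
qed

lemma poly_lagrange_basis_node:
  assumes "finite T" "p \<in> T" "s \<in> T"
  shows "poly (lagrange_basis T p) s = (if s = p then 1 else 0)"
proof (cases "s = p")
  case True
  have "(\<Prod>q\<in>T - {p}. p - q) \<noteq> 0" using assms by auto
  then show ?thesis using True by (simp add: lagrange_basis_def poly_prod)
next
  case False
  then have "(\<Prod>q\<in>T - {p}. s - q) = 0" using assms by auto
  then show ?thesis using False by (simp add: lagrange_basis_def poly_prod)
qed

lemma interp_error_node:
  assumes "finite T" "s \<in> T"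
  shows "interp_error T s \<phi> = 0"
proof -
  have "(\<Sum>p\<in>T. poly (lagrange_basis T p) s * \<phi> p) = (\<Sum>p\<in>T. if s = p then \<phi> p else 0)"
    using assms by (intro sum.cong) (auto simp: poly_lagrange_basis_node)
  then show ?thesis using assms by (simp add: interp_error_def)
qed

lemma fin_functional_interp_error:
  assumes "finite T" "T \<subseteq> J" "s \<in> J"
  shows "fin_functional J (interp_error T s)"
  unfolding interp_error_def[abs_def]
  using assms by (intro fin_functional_diff fin_functional_weighted_sum fin_functional.eval)

text \<open>The interpolating polynomial has degree below \<open>card T\<close>, too small to be
  seen by more than \<open>card T\<close> nodes. Passing to the error therefore preserves the
  divided differences that define convexity.\<close>

lemma dd_interp_error:
  assumes "finite S" "finite T" "card T < card S"
  shows "dd S (\<lambda>s. interp_error T s \<phi>) = dd S \<phi>"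
proof -
  have "dd S (poly (lagrange_basis T p)) = 0" if "p \<in> T" for p
    using degree_lagrange_basis[OF assms(2) that] assms(3) by (intro dd_poly) auto
  moreover have "dd S (\<lambda>s. \<Sum>p\<in>T. \<phi> p * poly (lagrange_basis T p) s) =
      (\<Sum>p\<in>T. \<phi> p * dd S (poly (lagrange_basis T p)))"
    using assms by (simp add: dd_linear)
  ultimately show ?thesis using assms(1) by (simp add: interp_error_def dd_linear mult.commute)
qed

section \<open>One-variable convexity and truncated powers\<close>

definition n_convex :: "nat \<Rightarrow> real set \<Rightarrow> (real \<Rightarrow> real) \<Rightarrow> bool" where
  "n_convex n J \<phi> \<longleftrightarrow> (\<forall>S. S \<subseteq> J \<and> card S = Suc n \<longrightarrow> 0 \<le> dd S \<phi>)"

text \<open>The nodes are moved upwards one at a time.\<close>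

lemma dd_exchange_mono:
  assumes conv: "n_convex n J \<phi>" and "finite K"
    and "finite Z" "Z \<subseteq> J" "card Z + card K = n"
    and "\<And>k. k \<in> K \<Longrightarrow> a k \<in> J \<and> b k \<in> J \<and> a k < b k"
    and "inj_on a K" "inj_on b K" "a ` K \<inter> b ` K = {}" "a ` K \<inter> Z = {}" "b ` K \<inter> Z = {}"
  shows "dd (a ` K \<union> Z) \<phi> \<le> dd (b ` K \<union> Z) \<phi>"
  using assms(2-)
proof (induction K arbitrary: Z rule: finite_induct)
  case (insert k K)
  let ?Q = "a ` K \<union> Z"
  have k: "a k \<in> J" "b k \<in> J" "a k < b k" using insert.prems(4)[of k] by auto
  have new: "a k \<notin> ?Q" "b k \<notin> ?Q" using insert by auto
  have Q: "finite ?Q" "?Q \<subseteq> J" using insert by auto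
  have "card ?Q = card K + card Z"
    using insert by (subst card_Un_disjoint) (auto simp: card_image)
  then have "card (insert (a k) (insert (b k) ?Q)) = Suc n"
    using new Q k insert by simp
  \<comment> \<open>Replacing \<open>a k\<close> by \<open>b k\<close> changes the divided
    difference by \<open>b k - a k\<close> times one with \<open>Suc n\<close> nodes, which
    convexity makes nonnegative.\<close>
  then have "0 \<le> dd (insert (a k) (insert (b k) ?Q)) \<phi>"
    using conv k Q by (auto simp: n_convex_def)
  then have "dd (insert (a k) ?Q) \<phi> \<le> dd (insert (b k) ?Q) \<phi>"
    using dd_recursion[OF Q(1) new] k by (metis diff_ge_0_iff_ge less_imp_le less_irrefl mult_nonneg_nonneg)
  also have "insert (b k) ?Q = a ` K \<union> insert (b k) Z" by auto
  also have "dd (a ` K \<union> insert (b k) Z) \<phi> \<le> dd (b ` K \<union> insert (b k) Z) \<phi>"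
  proof (rule insert.IH)
    show "a ` K \<inter> insert (b k) Z = {}" "b ` K \<inter> insert (b k) Z = {}"
      using insert.prems insert.hyps by (auto simp: inj_on_def)
  qed (use insert.prems insert.hyps k in \<open>auto simp: inj_on_def\<close>)
  finally show ?case by simp
qed simp

text \<open>As \<open>S\<close> lies entirely to the left of \<open>T\<close>, any bijection between
  them moves every node upwards.\<close>

lemma dd_separated_mono:
  assumes conv: "n_convex n J \<phi>" and "card S = n" "card T = n" "S \<subseteq> J" "T \<subseteq> J"
    and lt: "\<And>s t. s \<in> S \<Longrightarrow> t \<in> T \<Longrightarrow> s < t" and "0 < n"
  shows "dd S \<phi> \<le> dd T \<phi>"
proof -
  have fin: "finite S" "finite T" using assms card_ge_0_finite by metis+
  obtain h where h: "bij_betw h S T" using fin assms by (metis finite_same_card_bij)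
  have "dd ((\<lambda>s. s) ` S \<union> {}) \<phi> \<le> dd (h ` S \<union> {}) \<phi>"
    using fin assms h
    by (intro dd_exchange_mono[OF conv]) (auto simp: bij_betw_def dest: lt)
  then show ?thesis using h by (simp add: bij_betw_def)
qed

text \<open>As a function of \<open>t\<close> this is the unit step at \<open>u\<close>; the side
  chooses its value at the jump, left continuous for \<open>L\<close> and right continuous for
  \<open>R\<close>.\<close>

fun plus_indicator :: "side \<Rightarrow> real \<Rightarrow> real \<Rightarrow> real" where
  "plus_indicator L u t = (if u < t then 1 else 0)"
| "plus_indicator R u t = (if u \<le> t then 1 else 0)"

lemma chi_eq_plus_indicator: "chi b x y u = plus_indicator b u y - plus_indicator b u x"
  by (cases b) (auto simp: indicator_def)

text \<open>The Cox-de Boor recursion for B-splines. For \<open>u\<close> between the extreme nodes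
  \<open>lo\<close> and \<open>hi\<close>, the divided difference is a combination of the two
  obtained by dropping \<open>hi\<close> or \<open>lo\<close>, with weights
  \<open>(u - lo) / (hi - lo)\<close> and \<open>(hi - u) / (hi - lo)\<close>. For \<open>u\<close>
  outside, the truncated power agrees on the nodes with zero or with a polynomial of too small
  degree.\<close>

lemma dd_truncated_power_nonneg:
  assumes "card S = Suc (Suc n)"
  shows "0 \<le> dd S (\<lambda>t. (t - u) ^ n * plus_indicator b u t)"
  using assms
proof (induction n arbitrary: S)
  case 0
  then obtain p q where S: "S = {p, q}" "p \<noteq> q"
    by (metis One_nat_def Suc_1 card_2_iff)
  have "dd S (plus_indicator b u) * (q - p) =
      plus_indicator b u q - plus_indicator b u p"
    using dd_recursion[of "{}" p q "plus_indicator b u"] S by (simp add: dd_def mult.commute)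
  then have *: "dd S (plus_indicator b u) =
      (plus_indicator b u q - plus_indicator b u p) / (q - p)"
    using S by (simp add: field_simps)
  have "0 \<le> dd S (plus_indicator b u)"
    unfolding * using S by (cases b; cases "p < q") (auto simp: zero_le_divide_iff)
  then show ?case by simp
next
  case (Suc n)
  let ?h = "\<lambda>t. (t - u) ^ n * plus_indicator b u t"
  have fin: "finite S" and ne: "S \<noteq> {}" using Suc.prems card_ge_0_finite[of S] by auto
  define lo hi where "lo = Min S" and "hi = Max S"
  have lo: "lo \<in> S" "\<And>s. s \<in> S \<Longrightarrow> lo \<le> s" and hi: "hi \<in> S" "\<And>s. s \<in> S \<Longrightarrow> s \<le> hi"
    using fin ne by (auto simp: lo_def hi_def)
  have "lo \<noteq> hi"
  proof
    assume "lo = hi"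
    then have "S \<subseteq> {lo}" using lo hi by force
    then show False using Suc.prems card_mono[of "{lo}" S] by simp
  qed
  then have lt: "lo < hi" using lo hi by force
  define T where "T = S - {lo, hi}"
  have S: "S = insert lo (insert hi T)" "lo \<notin> T" "hi \<notin> T" "finite T"
    using lo hi fin by (auto simp: T_def)
  have "card T = Suc n" using Suc.prems S lt by simp
  then have A: "0 \<le> dd (insert lo T) ?h" and B: "0 \<le> dd (insert hi T) ?h"
    using S by (auto intro!: Suc.IH)
  have rec: "dd S ?h = (dd (insert hi T) ?h - dd (insert lo T) ?h) / (hi - lo)"
    using dd_recursion[of T lo hi ?h] S lt by (simp add: field_simps)
  \<comment> \<open>Split one factor as \<open>t - u = (t - lo) + (lo - u)\<close>: the first part
    removes the node \<open>lo\<close>, the second is constant.\<close>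
  have "dd S (\<lambda>t. (t - u) ^ Suc n * plus_indicator b u t) =
      dd S (\<lambda>t. (t - lo) * ?h t + (lo - u) * ?h t)"
    by (rule dd_cong) (simp add: algebra_simps)
  also have "\<dots> = dd (insert hi T) ?h + (lo - u) * dd S ?h"
    using dd_insert_mult[of "insert hi T" lo ?h] S lt fin by (simp add: dd_linear)
  also have "\<dots> = ((hi - u) * dd (insert hi T) ?h + (u - lo) * dd (insert lo T) ?h) / (hi - lo)"
    unfolding rec using lt by (simp add: field_simps)
  finally have *: "dd S (\<lambda>t. (t - u) ^ Suc n * plus_indicator b u t) =
    ((hi - u) * dd (insert hi T) ?h + (u - lo) * dd (insert lo T) ?h) / (hi - lo)" .
  consider "u < lo" | "hi < u" | "lo \<le> u" "u \<le> hi" by linarith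
  then show ?case
  proof cases
    case 1
    then have "u < s" if "s \<in> S" for s using lo(2)[OF that] by linarith
    then have "plus_indicator b u s = 1" if "s \<in> S" for s using that by (cases b) force+
    then have "dd S (\<lambda>t. (t - u) ^ Suc n * plus_indicator b u t) = dd S (poly ([:- u, 1:] ^ Suc n))"
      by (intro dd_cong) (simp add: poly_power del: power_Suc)
    also have "\<dots> = 0"
      using Suc.prems by (intro dd_poly) (simp add: degree_power_eq del: power_Suc)
    finally show ?thesis by simp
  next
    case 2
    then have "s < u" if "s \<in> S" for s using hi(2)[OF that] by linarith
    then have "plus_indicator b u s = 0" if "s \<in> S" for s using that by (cases b) force+
    then have "dd S (\<lambda>t. (t - u) ^ Suc n * plus_indicator b u t) = dd S (\<lambda>t. 0 * 0)"
      by (intro dd_cong) simp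
    then show ?thesis by (simp add: dd_def)
  next
    case 3
    then show ?thesis unfolding * using A B lt by (intro divide_nonneg_pos add_nonneg_nonneg mult_nonneg_nonneg) auto
  qed
qed

definition kernel :: "nat \<Rightarrow> side \<Rightarrow> real \<Rightarrow> real \<Rightarrow> real \<Rightarrow> real" where
  "kernel n b a x u = (x - u) ^ (n - 1) / fact (n - 1) * chi b a x u"

text \<open>The part of the kernel depending on the base point is a polynomial of degree \<open>n - 1\<close>.\<close>

lemma dd_kernel:
  assumes "card S = Suc n" "1 \<le> n"
  shows "dd S (\<lambda>x. kernel n b a x u) =
    dd S (\<lambda>t. (t - u) ^ (n - 1) * plus_indicator b u t) / fact (n - 1)"
proof -
  have fin: "finite S" using assms card_ge_0_finite[of S] by simp
  have "dd S (\<lambda>t. (t - u) ^ (n - 1)) = dd S (poly ([:- u, 1:] ^ (n - 1)))"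
    by (intro dd_cong) (simp add: poly_power)
  also have "\<dots> = 0" using assms by (intro dd_poly) (simp add: degree_power_eq)
  finally have 0: "dd S (\<lambda>t. (t - u) ^ (n - 1)) = 0" .
  have "dd S (\<lambda>x. kernel n b a x u) = dd S (\<lambda>t. (t - u) ^ (n - 1) * plus_indicator b u t / fact (n - 1)
      - (plus_indicator b u a / fact (n - 1)) * (t - u) ^ (n - 1))"
    by (rule dd_cong) (simp add: kernel_def chi_eq_plus_indicator field_simps)
  then show ?thesis using fin 0 by (simp add: dd_linear)
qed

lemma dd_kernel_nonneg:
  assumes "card S = Suc n" "1 \<le> n"
  shows "0 \<le> dd S (\<lambda>x. kernel n b a x u)"
  unfolding dd_kernel[OF assms]
  using dd_truncated_power_nonneg[of S "n - 1" u b] assms by simp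

text \<open>The two steps differ only at \<open>t = u\<close>, where the power with positive
  exponent vanishes.\<close>

lemma dd_kernel_side:
  assumes "card S = Suc n" "2 \<le> n"
  shows "dd S (\<lambda>x. kernel n L a x u) = dd S (\<lambda>x. kernel n R a x u)"
proof -
  have "(t - u) ^ (n - 1) * plus_indicator L u t = (t - u) ^ (n - 1) * plus_indicator R u t" for t
    using assms by (cases "t = u") auto
  then show ?thesis using assms by (simp only: dd_kernel)
qed


section \<open>Functions convex of higher order\<close>

definition primitive_on :: "real set \<Rightarrow> (real \<Rightarrow> real) \<Rightarrow> (real \<Rightarrow> real) \<Rightarrow> bool" where
  "primitive_on J \<Phi> \<phi> \<longleftrightarrow> (\<forall>a\<in>J. \<forall>b\<in>J. a \<le> b \<longrightarrow> (\<phi> has_integral \<Phi> b - \<Phi> a) {a..b})"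

lemma primitive_on_sum_powers:
  "primitive_on J (\<lambda>t. \<Sum>i<m. c i / Suc i * t ^ Suc i) (\<lambda>t. \<Sum>i<m. c i * t ^ i)"
  unfolding primitive_on_def
proof (intro ballI impI fundamental_theorem_of_calculus)
  fix a b x :: real
  have "((\<lambda>t. \<Sum>i<m. c i / Suc i * t ^ Suc i) has_real_derivative (\<Sum>i<m. c i / Suc i * (Suc i * x ^ i))) (at x within {a..b})"
    by (intro DERIV_sum DERIV_cmult) (auto intro!: derivative_eq_intros simp del: power_Suc)
  moreover have "(\<Sum>i<m. c i / Suc i * (Suc i * x ^ i)) = (\<Sum>i<m. c i * x ^ i)"
    by (intro sum.cong) auto
  ultimately show "((\<lambda>t. \<Sum>i<m. c i / Suc i * t ^ Suc i) has_vector_derivative (\<Sum>i<m. c i * x ^ i)) (at x within {a..b})"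
    by (simp add: has_real_derivative_iff_has_vector_derivative)
qed

lemma primitive_on_unique:
  assumes "primitive_on J \<Phi> \<phi>" "primitive_on J \<Psi> \<psi>"
    and "\<And>t. t \<in> J \<Longrightarrow> \<phi> t = \<psi> t" and J: "is_interval J" and "a \<in> J" "b \<in> J"
  shows "\<Phi> b - \<Phi> a = \<Psi> b - \<Psi> a"
proof -
  have *: "\<Phi> y - \<Phi> x = \<Psi> y - \<Psi> x" if "x \<in> J" "y \<in> J" "x \<le> y" for x y
  proof (rule has_integral_unique)
    have "(\<psi> has_integral \<Psi> y - \<Psi> x) {x..y}" using assms(2) that by (auto simp: primitive_on_def)
    then show "(\<phi> has_integral \<Psi> y - \<Psi> x) {x..y}"
    proof (rule has_integral_eq[rotated])
      fix t assume "t \<in> {x..y}"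
      then have "t \<in> J" using that J by (auto intro: mem_is_interval_1_I)
      then show "\<psi> t = \<phi> t" using assms(3) by simp
    qed
    show "(\<phi> has_integral \<Phi> y - \<Phi> x) {x..y}" using assms(1) that by (auto simp: primitive_on_def)
  qed
  show ?thesis using *[of a b] *[of b a] assms by argo
qed

lemma infinite_open_real:
  fixes J :: "real set"
  assumes "open J" "J \<noteq> {}"
  shows "infinite J"
  using assms finite_imp_not_open by blast

lemma open_real_between:
  fixes J :: "real set"
  assumes "open J" "x \<in> J"
  shows "\<exists>y\<in>J. y < x" "\<exists>y\<in>J. x < y"
proof -
  obtain e where e: "e > 0" "ball x e \<subseteq> J" using assms openE by blast
  have "x - e / 2 \<in> ball x e" "x + e / 2 \<in> ball x e" using e by (auto simp: dist_real_def)
  then have "x - e / 2 \<in> J" "x + e / 2 \<in> J" using e(2) by auto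
  then show "\<exists>y\<in>J. y < x" "\<exists>y\<in>J. x < y" using e(1)
    by (auto intro: bexI[of _ "x - e / 2"] bexI[of _ "x + e / 2"])
qed

text \<open>Vanishing divided differences on \<open>Suc m\<close> nodes make \<open>\<phi>\<close>
  equal on \<open>J\<close> to its interpolating polynomial of degree below \<open>m\<close>. Up to
  a constant \<open>\<Phi>\<close> is then a polynomial of degree at most \<open>m\<close>, which
  \<open>Suc (Suc m)\<close> nodes annihilate. This is how agreement of derivatives is lifted to
  agreement of the functions.\<close>

lemma dd_primitive_eq_0:
  assumes prim: "primitive_on J \<Phi> \<phi>" and J: "open J" "is_interval J"
    and kill: "\<And>S. S \<subseteq> J \<Longrightarrow> card S = Suc m \<Longrightarrow> dd S \<phi> = 0"
    and S: "S \<subseteq> J" "card S = Suc (Suc m)"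
  shows "dd S \<Phi> = 0"
proof -
  have "infinite J" using S J by (intro infinite_open_real) auto
  then obtain T where T: "finite T" "card T = m" "T \<subseteq> J"
    using infinite_arbitrarily_large by metis
  have "interp_error T s \<phi> = 0" if "s \<in> J" for s
  proof (cases "s \<in> T")
    case True
    then show ?thesis using interp_error_node T by simp
  next
    case False
    then show ?thesis using interp_error_eq_dd[OF T(1) False] kill[of "insert s T"] T that by auto
  qed
  then have 1: "\<phi> s = (\<Sum>p\<in>T. poly (lagrange_basis T p) s * \<phi> p)" if "s \<in> J" for s
    using that by (simp add: interp_error_def)
  have 2: "poly (lagrange_basis T p) s = (\<Sum>i<m. coeff (lagrange_basis T p) i * s ^ i)" if "p \<in> T" for p s
    using degree_lagrange_basis[OF T(1) that] T(2)
    unfolding poly_altdef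
    by (intro sum.mono_neutral_left) (auto simp: coeff_eq_0)
  define c where "c i = (\<Sum>p\<in>T. coeff (lagrange_basis T p) i * \<phi> p)" for i
  have 3: "\<phi> s = (\<Sum>i<m. c i * s ^ i)" if "s \<in> J" for s
  proof -
    have "\<phi> s = (\<Sum>p\<in>T. \<Sum>i<m. coeff (lagrange_basis T p) i * s ^ i * \<phi> p)"
      unfolding 1[OF that] by (intro sum.cong) (auto simp: 2 sum_distrib_right)
    also have "\<dots> = (\<Sum>i<m. c i * s ^ i)"
      by (subst sum.swap) (simp add: c_def sum_distrib_left mult_ac)
    finally show ?thesis .
  qed
  obtain a where a: "a \<in> S" using S by fastforce
  have fin: "finite S" using S card_ge_0_finite[of S] by simp
  let ?\<Psi> = "\<lambda>t. \<Sum>i<m. c i / Suc i * t ^ Suc i"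
  have "\<Phi> s = ?\<Psi> s + (\<Phi> a - ?\<Psi> a)" if "s \<in> S" for s
    using primitive_on_unique[OF prim primitive_on_sum_powers[where c = c and m = m] 3 J(2), of a s] a that S(1)
    by (auto simp: algebra_simps)
  then have "dd S \<Phi> = dd S (\<lambda>s. ?\<Psi> s + (\<Phi> a - ?\<Psi> a))" by (rule dd_cong)
  also have "\<dots> = (\<Sum>i<m. c i / Suc i * dd S (\<lambda>s. s ^ Suc i))"
    using fin S by (simp add: dd_linear dd_const del: power_Suc)
  also have "\<dots> = 0"
    using fin S by (intro sum.neutral) (simp add: dd_power del: power_Suc)
  finally show ?thesis .
qed

section \<open>Right derivatives and their integrals\<close>

definition right_deriv :: "(real \<Rightarrow> real) \<Rightarrow> real \<Rightarrow> real" where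
  "right_deriv \<phi> x = Lim (at_right 0) (\<lambda>h. (\<phi> (x + h) - \<phi> x) / h)"

text \<open>Two properties are bundled: the limit transfers convexity to the derivative, and the
  integral recovers the function from it.\<close>

definition right_primitive_on :: "real set \<Rightarrow> (real \<Rightarrow> real) \<Rightarrow> (real \<Rightarrow> real) \<Rightarrow> bool" where
  "right_primitive_on J \<Phi> \<phi> \<longleftrightarrow> primitive_on J \<Phi> \<phi> \<and>
     (\<forall>x\<in>J. ((\<lambda>h. (\<Phi> (x + h) - \<Phi> x) / h) \<longlongrightarrow> \<phi> x) (at_right 0))"

lemma right_primitive_on_right_deriv:
  assumes "right_primitive_on J \<Phi> \<phi>" "x \<in> J"
  shows "right_deriv \<Phi> x = \<phi> x"
  unfolding right_deriv_def using assms by (intro tendsto_Lim) (auto simp: right_primitive_on_def)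

lemma right_primitive_on_cong:
  assumes "right_primitive_on J \<Phi> \<phi>" "is_interval J" "\<And>x. x \<in> J \<Longrightarrow> \<phi> x = \<psi> x"
  shows "right_primitive_on J \<Phi> \<psi>"
proof -
  have "(\<psi> has_integral I) {a..b}" if "(\<phi> has_integral I) {a..b}" "a \<in> J" "b \<in> J" for a b I
    using that(1)
  proof (rule has_integral_eq[rotated])
    fix t assume "t \<in> {a..b}"
    then have "t \<in> J" using that assms(2) by (auto intro: mem_is_interval_1_I)
    then show "\<phi> t = \<psi> t" using assms(3) by simp
  qed
  then show ?thesis using assms by (auto simp: right_primitive_on_def primitive_on_def)
qed

lemma right_primitive_on_add:
  assumes "right_primitive_on J \<Phi> \<phi>" "right_primitive_on J \<Psi> \<psi>"
  shows "right_primitive_on J (\<lambda>t. \<Phi> t + \<Psi> t) (\<lambda>t. \<phi> t + \<psi> t)"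
  unfolding right_primitive_on_def primitive_on_def
proof (intro conjI ballI impI)
  fix a b assume "a \<in> J" "b \<in> J" "a \<le> b"
  then have "((\<lambda>t. \<phi> t + \<psi> t) has_integral (\<Phi> b - \<Phi> a) + (\<Psi> b - \<Psi> a)) {a..b}"
    using assms by (intro has_integral_add) (auto simp: right_primitive_on_def primitive_on_def)
  then show "((\<lambda>t. \<phi> t + \<psi> t) has_integral \<Phi> b + \<Psi> b - (\<Phi> a + \<Psi> a)) {a..b}"
    by (simp add: algebra_simps)
next
  fix x assume "x \<in> J"
  then have "((\<lambda>h. (\<Phi> (x + h) - \<Phi> x) / h + (\<Psi> (x + h) - \<Psi> x) / h) \<longlongrightarrow> \<phi> x + \<psi> x) (at_right 0)"
    using assms by (intro tendsto_add) (auto simp: right_primitive_on_def)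
  then show "((\<lambda>h. (\<Phi> (x + h) + \<Psi> (x + h) - (\<Phi> x + \<Psi> x)) / h) \<longlongrightarrow> \<phi> x + \<psi> x) (at_right 0)"
    by (simp add: add_divide_distrib diff_divide_distrib algebra_simps)
qed

lemma right_primitive_on_scale:
  assumes "right_primitive_on J \<Phi> \<phi>"
  shows "right_primitive_on J (\<lambda>t. c * \<Phi> t) (\<lambda>t. c * \<phi> t)"
  unfolding right_primitive_on_def primitive_on_def
proof (intro conjI ballI impI)
  fix a b assume "a \<in> J" "b \<in> J" "a \<le> b"
  then have "((\<lambda>t. c * \<phi> t) has_integral c * (\<Phi> b - \<Phi> a)) {a..b}"
    using assms by (intro has_integral_mult_right) (auto simp: right_primitive_on_def primitive_on_def)
  then show "((\<lambda>t. c * \<phi> t) has_integral c * \<Phi> b - c * \<Phi> a) {a..b}"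
    by (simp add: algebra_simps)
next
  fix x assume "x \<in> J"
  then have "((\<lambda>h. c * ((\<Phi> (x + h) - \<Phi> x) / h)) \<longlongrightarrow> c * \<phi> x) (at_right 0)"
    using assms by (intro tendsto_mult_left) (auto simp: right_primitive_on_def)
  then show "((\<lambda>h. (c * \<Phi> (x + h) - c * \<Phi> x) / h) \<longlongrightarrow> c * \<phi> x) (at_right 0)"
    by (simp add: right_diff_distrib diff_divide_distrib)
qed

lemma right_primitive_on_power:
  "right_primitive_on J (\<lambda>t. t ^ Suc m) (\<lambda>t. Suc m * t ^ m)"
  unfolding right_primitive_on_def primitive_on_def
proof (intro conjI ballI impI)
  fix a b :: real assume "a \<le> b"
  have "((\<lambda>t. t ^ Suc m) has_vector_derivative Suc m * x ^ m) (at x within {a..b})" for x :: real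
    unfolding has_real_derivative_iff_has_vector_derivative[symmetric]
    by (auto intro!: derivative_eq_intros simp del: power_Suc)
  then show "((\<lambda>t. Suc m * t ^ m) has_integral b ^ Suc m - a ^ Suc m) {a..b}"
    using \<open>a \<le> b\<close> by (intro fundamental_theorem_of_calculus) auto
next
  fix x :: real
  have "((\<lambda>t. t ^ Suc m) has_real_derivative Suc m * x ^ m) (at x)"
    by (auto intro!: derivative_eq_intros simp del: power_Suc)
  then have "((\<lambda>h. ((x + h) ^ Suc m - x ^ Suc m) / h) \<longlongrightarrow> Suc m * x ^ m) (at 0)"
    by (simp add: DERIV_def)
  then show "((\<lambda>h. ((x + h) ^ Suc m - x ^ Suc m) / h) \<longlongrightarrow> Suc m * x ^ m) (at_right 0)"
    by (rule tendsto_mono[rotated]) (simp add: at_within_le_at)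
qed

text \<open>As \<open>J\<close> is open, every segment in \<open>J\<close> lies to the right of some
  \<open>c\<close> in \<open>J\<close>. The local derivatives fit together because each of them is a
  right limit determined by \<open>\<Phi>\<close>.\<close>

lemma right_primitive_on_local:
  assumes "\<And>c. c \<in> J \<Longrightarrow> \<exists>\<phi>. right_primitive_on (J \<inter> {c<..}) \<Phi> \<phi>"
    and J: "open J" "is_interval J"
  shows "right_primitive_on J \<Phi> (right_deriv \<Phi>)"
proof -
  have below: "\<exists>c\<in>J. c < x" if "x \<in> J" for x using open_real_between(1)[OF J(1) that] .
  have int: "is_interval (J \<inter> {c<..})" for c using J by (simp add: is_interval_Int is_interval_oi)
  have loc: "right_primitive_on (J \<inter> {c<..}) \<Phi> (right_deriv \<Phi>)" if c: "c \<in> J" for c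
  proof -
    obtain \<phi> where \<phi>: "right_primitive_on (J \<inter> {c<..}) \<Phi> \<phi>" using assms(1)[OF c] by auto
    show ?thesis
      using right_primitive_on_cong[OF \<phi> int] right_primitive_on_right_deriv[OF \<phi>] by simp
  qed
  show ?thesis
    unfolding right_primitive_on_def primitive_on_def
  proof (intro conjI ballI impI)
    fix a b assume ab: "a \<in> J" "b \<in> J" "a \<le> b"
    obtain c where c: "c \<in> J" "c < a" using below[OF ab(1)] by auto
    show "(right_deriv \<Phi> has_integral \<Phi> b - \<Phi> a) {a..b}"
      using loc[OF c(1)] c ab by (auto simp: right_primitive_on_def primitive_on_def)
  next
    fix x assume x: "x \<in> J"
    obtain c where c: "c \<in> J" "c < x" using below[OF x] by auto
    show "((\<lambda>h. (\<Phi> (x + h) - \<Phi> x) / h) \<longlongrightarrow> right_deriv \<Phi> x) (at_right 0)"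
      using loc[OF c(1)] c x by (auto simp: right_primitive_on_def)
  qed
qed

text \<open>On a partition into \<open>Suc N\<close> equal pieces the bounds telescope to
  \<open>(D b - D a) * (b - a) / Suc N\<close>, which tends to 0.\<close>

lemma const_if_increment_le:
  fixes E D :: "real \<Rightarrow> real"
  assumes "a \<le> b"
    and le: "\<And>x y. a \<le> x \<Longrightarrow> x \<le> y \<Longrightarrow> y \<le> b \<Longrightarrow> \<bar>E y - E x\<bar> \<le> (D y - D x) * (y - x)"
  shows "E b = E a"
proof -
  have bound: "\<bar>E b - E a\<bar> \<le> (D b - D a) * (b - a) / real (Suc N)" for N
  proof -
    define h where "h = (b - a) / Suc N"
    define x where "x i = a + real i * h" for i
    have h: "h \<ge> 0" using assms by (simp add: h_def)
    have xN: "x (Suc N) = b" by (simp add: x_def h_def)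
    have x0: "x 0 = a" by (simp add: x_def)
    have xle: "x i \<le> b" if "i \<le> Suc N" for i
    proof -
      have "real i * h \<le> real (Suc N) * h" using that h by (intro mult_right_mono) auto
      then show ?thesis using xN by (simp add: x_def)
    qed
    have "E b - E a = (\<Sum>i<Suc N. E (x (Suc i)) - E (x i))"
      using sum_lessThan_telescope[of "\<lambda>i. E (x i)" "Suc N"] xN x0 by simp
    also have "\<bar>\<dots>\<bar> \<le> (\<Sum>i<Suc N. \<bar>E (x (Suc i)) - E (x i)\<bar>)" by (rule sum_abs)
    also have "\<dots> \<le> (\<Sum>i<Suc N. (D (x (Suc i)) - D (x i)) * h)"
    proof (intro sum_mono)
      fix i assume i: "i \<in> {..<Suc N}"
      have "x (Suc i) - x i = h" by (simp add: x_def algebra_simps)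
      then show "\<bar>E (x (Suc i)) - E (x i)\<bar> \<le> (D (x (Suc i)) - D (x i)) * h"
        using le[of "x i" "x (Suc i)"] xle[of "Suc i"] h i by (simp add: x_def)
    qed
    also have "\<dots> = (D b - D a) * h"
      using sum_lessThan_telescope[of "\<lambda>i. D (x i)" "Suc N"] xN x0
      unfolding sum_distrib_right[symmetric] by simp
    finally show ?thesis by (simp add: h_def)
  qed
  have "(\<lambda>N. (D b - D a) * (b - a) / real (Suc N)) \<longlonglongrightarrow> 0"
    using LIMSEQ_Suc[OF lim_const_over_n[of "(D b - D a) * (b - a)"]] by simp
  then have "\<bar>E b - E a\<bar> \<le> 0" by (rule LIMSEQ_le_const) (use bound in auto)
  then show ?thesis by simp
qed

lemma dd_two: "x \<noteq> y \<Longrightarrow> dd {x, y} \<phi> = (\<phi> y - \<phi> x) / (y - x)"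
  using dd_recursion[of "{}" x y \<phi>] by (simp add: dd_def field_simps)

text \<open>A convex function is the integral of its right derivative \<open>D\<close>: over
  \<open>[x, y]\<close> both the increment of \<open>\<phi>\<close> and the integral of
  \<open>D\<close> lie between \<open>D x * (y - x)\<close> and \<open>D y * (y - x)\<close>, which
  is the situation of \<open>const_if_increment_le\<close>.\<close>

lemma right_primitive_on_convex:
  assumes conv: "n_convex 2 J \<phi>" and J: "open J" "is_interval J"
  shows "\<exists>D. right_primitive_on J \<phi> D"
proof -
  define sl where "sl x y = (\<phi> y - \<phi> x) / (y - x)" for x y
  have sl: "sl x y \<le> sl y z" "sl x y \<le> sl x z" "sl x z \<le> sl y z"
    if "x \<in> J" "z \<in> J" "x < y" "y < z" for x y z
  proof -
    have y: "y \<in> J" using that J(2) by (meson less_imp_le mem_is_interval_1_I)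
    have pos: "0 \<le> dd {x, y, z} \<phi>"
      using conv that y by (auto simp: n_convex_def)
    have "(z - x) * dd {x, y, z} \<phi> = sl y z - sl x y"
      using dd_recursion[of "{y}" x z \<phi>] that
      by (simp add: insert_commute sl_def dd_two[of x y] dd_two[of y z])
    then show "sl x y \<le> sl y z" using pos that by (smt (verit) mult_nonneg_nonneg)
    have "(z - y) * dd {x, y, z} \<phi> = sl x z - sl x y"
      using dd_recursion[of "{x}" y z \<phi>] that
      by (simp add: insert_commute sl_def dd_two[of x z] dd_two[of x y])
    then show "sl x y \<le> sl x z" using pos that by (smt (verit) mult_nonneg_nonneg)
    have "(y - x) * dd {x, y, z} \<phi> = sl y z - sl x z"
      using dd_recursion[of "{z}" x y \<phi>] that
      by (simp add: insert_commute sl_def dd_two[of x z] dd_two[of y z])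
    then show "sl x z \<le> sl y z" using pos that by (smt (verit) mult_nonneg_nonneg)
  qed
  \<comment> \<open>The infimum of the slopes to the right of \<open>x\<close>; any slope to the
    left of \<open>x\<close> is a lower bound, and one exists because \<open>J\<close> is
    open.\<close>
  define D where "D x = Inf (sl x ` (J \<inter> {x<..}))" for x
  note above = open_real_between(2)[OF J(1)] and below = open_real_between(1)[OF J(1)]
  have D_le: "D x \<le> sl x y" if "x \<in> J" "y \<in> J" "x < y" for x y
  proof -
    obtain w where w: "w \<in> J" "w < x" using below[OF \<open>x \<in> J\<close>] by blast
    have "bdd_below (sl x ` (J \<inter> {x<..}))"
      using sl(1)[OF w(1) _ w(2)] by (intro bdd_belowI[of _ "sl w x"]) auto
    then show ?thesis unfolding D_def using that by (intro cInf_lower) auto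
  qed
  have D_ge: "sl x y \<le> D y" if "x \<in> J" "y \<in> J" "x < y" for x y
    unfolding D_def using sl(1)[OF that(1) _ that(3)] above[OF that(2)]
    by (intro cInf_greatest) auto
  have D_mono: "D x \<le> D y" if "x \<in> J" "y \<in> J" "x \<le> y" for x y
    using D_le[of x y] D_ge[of x y] that by (cases "x = y") auto
  have lim: "((\<lambda>h. (\<phi> (x + h) - \<phi> x) / h) \<longlongrightarrow> D x) (at_right 0)" if x: "x \<in> J" for x
  proof (rule tendstoI)
    fix e :: real assume e: "e > 0"
    have "\<exists>s\<in>sl x ` (J \<inter> {x<..}). s < D x + e"
      using above[OF x] e unfolding D_def by (intro cInf_lessD) auto
    then obtain y where y: "y \<in> J" "x < y" "sl x y < D x + e" by auto
    have "dist ((\<phi> (x + h) - \<phi> x) / h) (D x) < e" if h: "0 < h" "h < y - x" for h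
    proof -
      have "x + h \<in> J" using x y h J(2) mem_is_interval_1_I[of J x y "x + h"] by auto
      then have "D x \<le> sl x (x + h)" using x h by (intro D_le) auto
      moreover have "sl x (x + h) \<le> sl x y" using x y h by (intro sl(2)) auto
      ultimately show ?thesis using y by (simp add: sl_def dist_real_def)
    qed
    then show "\<forall>\<^sub>F h in at_right 0. dist ((\<phi> (x + h) - \<phi> x) / h) (D x) < e"
      unfolding eventually_at_right_field using y by (intro exI[of _ "y - x"]) auto
  qed
  have int: "(D has_integral \<phi> b - \<phi> a) {a..b}" if ab: "a \<in> J" "b \<in> J" "a \<le> b" for a b
  proof -
    have J': "x \<in> J" if "x \<in> {a..b}" for x
      using that ab J(2) by (auto intro: mem_is_interval_1_I)
    have Dint: "D integrable_on {x..y}" if "a \<le> x" "y \<le> b" for x y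
      using that by (intro integrable_on_mono_on) (auto simp: mono_on_def intro!: D_mono J')
    define E where "E x = \<phi> x - integral {a..x} D" for x
    have "E b = E a"
    proof (rule const_if_increment_le[OF ab(3)])
      fix x y assume xy: "a \<le> x" "x \<le> y" "y \<le> b"
      have JJ: "x \<in> J" "y \<in> J" using xy by (auto intro!: J')
      have "integral {a..x} D + integral {x..y} D = integral {a..y} D"
        using Henstock_Kurzweil_Integration.integral_combine[OF xy(1,2) Dint[of a y]] xy by simp
      then have E: "E y - E x = (\<phi> y - \<phi> x) - integral {x..y} D" by (simp add: E_def)
      have "integral {x..y} (\<lambda>_. D x) \<le> integral {x..y} D"
        using xy JJ by (intro integral_le Dint) (auto intro!: D_mono J')
      moreover have "integral {x..y} D \<le> integral {x..y} (\<lambda>_. D y)"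
        using xy JJ by (intro integral_le Dint) (auto intro!: D_mono J')
      moreover have "D x * (y - x) \<le> \<phi> y - \<phi> x \<and> \<phi> y - \<phi> x \<le> D y * (y - x)"
        using D_le[of x y] D_ge[of x y] JJ xy
        by (cases "x = y") (auto simp: sl_def pos_le_divide_eq pos_divide_le_eq)
      ultimately show "\<bar>E y - E x\<bar> \<le> (D y - D x) * (y - x)"
        using xy unfolding E by (auto simp: algebra_simps)
    qed
    then have "integral {a..b} D = \<phi> b - \<phi> a" by (simp add: E_def)
    then show ?thesis using Dint[of a b] by (simp add: has_integral_integrable_integral)
  qed
  show ?thesis
    using lim int by (auto simp: right_primitive_on_def primitive_on_def)
qed

text \<open>Below a point of \<open>J\<close> the divided differences of order \<open>n\<close> are bounded from below on the rest
  of \<open>J\<close>, so subtracting a multiple of \<open>t ^ n\<close> lowers the order of convexity by one.\<close>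

lemma n_convex_right_primitive:
  assumes "2 \<le> n" "n_convex n J \<phi>" "open J" "is_interval J"
  shows "right_primitive_on J \<phi> (right_deriv \<phi>)"
  using assms
proof (induction n arbitrary: J \<phi> rule: nat_induct_at_least)
  case base
  obtain D where D: "right_primitive_on J \<phi> D" using right_primitive_on_convex base by blast
  show ?case
    using right_primitive_on_cong[OF D] base right_primitive_on_right_deriv[OF D] by simp
next
  case (Suc n)
  show ?case
  proof (rule right_primitive_on_local)
    fix c assume c: "c \<in> J"
    obtain e where e: "e > 0" "ball c e \<subseteq> J" using Suc.prems c openE by blast
    have "infinite {c - e<..<c}" using e(1) by (simp add: infinite_Ioo)
    then obtain T where T: "finite T" "card T = Suc n" "T \<subseteq> {c - e<..<c}"
      using infinite_arbitrarily_large by metis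
    have "{c - e<..<c} \<subseteq> ball c e" by (auto simp: dist_real_def)
    then have TJ: "T \<subseteq> J" using T(3) e by blast
    \<comment> \<open>Every node set in \<open>?J\<close> lies to the right of \<open>T\<close>, so
      \<open>l\<close> is a lower bound for its divided difference; on \<open>Suc n\<close> nodes
      that of \<open>t ^ n\<close> equals 1.\<close>
    define l where "l = dd T \<phi>"
    let ?J = "J \<inter> {c<..}"
    have "n_convex n ?J (\<lambda>t. \<phi> t + (- l) * t ^ n)"
      unfolding n_convex_def
    proof (intro allI impI, elim conjE)
      fix S assume S: "S \<subseteq> ?J" "card S = Suc n"
      have fin: "finite S" using S card_ge_0_finite[of S] by simp
      have "l \<le> dd S \<phi>"
        unfolding l_def
        using T S TJ by (intro dd_separated_mono[OF Suc.prems(1)]) force+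
      then show "0 \<le> dd S (\<lambda>t. \<phi> t + (- l) * t ^ n)"
        using dd_power(2)[OF fin, of n] S fin by (simp add: dd_linear del: mult_minus_left)
    qed
    moreover have "open ?J" "is_interval ?J" using Suc.prems
      by (auto simp: is_interval_Int is_interval_oi)
    ultimately have 1: "right_primitive_on ?J (\<lambda>t. \<phi> t + (- l) * t ^ n) (right_deriv (\<lambda>t. \<phi> t + (- l) * t ^ n))"
      by (rule Suc.IH)
    obtain m where m: "n = Suc m" using Suc.hyps by (cases n) auto
    have "right_primitive_on ?J (\<lambda>t. l * t ^ n) (\<lambda>t. l * (Suc m * t ^ m))"
      unfolding m by (intro right_primitive_on_scale right_primitive_on_power)
    from right_primitive_on_add[OF 1 this]
    show "\<exists>D. right_primitive_on ?J \<phi> D" by auto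
  qed (use Suc.prems in auto)
qed

text \<open>Shifting all nodes by \<open>h > 0\<close> cannot decrease the divided difference on
  \<open>Suc m\<close> nodes. So the difference quotients have nonnegative divided differences, and
  this survives the limit.\<close>

lemma n_convex_deriv:
  assumes conv: "n_convex (Suc m) J \<phi>" and J: "open J"
    and lim: "\<And>x. x \<in> J \<Longrightarrow> ((\<lambda>h. (\<phi> (x + h) - \<phi> x) / h) \<longlongrightarrow> \<psi> x) (at_right 0)"
  shows "n_convex m J \<psi>"
  unfolding n_convex_def
proof (intro allI impI, elim conjE)
  fix S assume S: "S \<subseteq> J" "card S = Suc m"
  have fin: "finite S" using S card_ge_0_finite[of S] by simp
  have "((\<lambda>h. dd S (\<lambda>x. (\<phi> (x + h) - \<phi> x) / h)) \<longlongrightarrow> dd S \<psi>) (at_right 0)"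
    using S fin by (intro fin_functional_tendsto[OF fin_functional_dd[of S S]] lim) auto
  moreover have "\<forall>\<^sub>F h in at_right 0. 0 \<le> dd S (\<lambda>x. (\<phi> (x + h) - \<phi> x) / h)"
  proof -
    have pos: "\<forall>\<^sub>F h::real in at_right 0. 0 < h" by (simp add: eventually_at_right_less)
    have "\<forall>\<^sub>F h in at_right 0. \<forall>x\<in>S. x + h \<in> J"
    proof (intro eventually_ball_finite fin ballI)
      fix x assume "x \<in> S"
      have "((\<lambda>h. x + h) \<longlongrightarrow> x + 0) (at_right 0)" by (intro tendsto_intros)
      then show "\<forall>\<^sub>F h in at_right 0. x + h \<in> J"
        using J S \<open>x \<in> S\<close> by (intro topological_tendstoD) auto
    qed
    \<comment> \<open>For small \<open>h\<close> no shifted node hits an old one, as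
      \<open>dd_exchange_mono\<close> requires.\<close>
    moreover have "\<forall>\<^sub>F h in at_right 0. \<forall>x\<in>S. \<forall>y\<in>S. x + h \<noteq> y"
    proof (intro eventually_ball_finite fin ballI)
      fix x y assume "x \<in> S" "y \<in> S"
      show "\<forall>\<^sub>F h in at_right 0. x + h \<noteq> y"
      proof (cases "x < y")
        case True
        then show ?thesis unfolding eventually_at_right_field by (intro exI[of _ "y - x"]) auto
      next
        case False
        show ?thesis using pos by eventually_elim (use False in auto)
      qed
    qed
    ultimately show ?thesis using pos
    proof eventually_elim
      case (elim h)
      have "dd ((\<lambda>x. x) ` S \<union> {}) \<phi> \<le> dd ((\<lambda>x. x + h) ` S \<union> {}) \<phi>"
        using elim S fin by (intro dd_exchange_mono[OF conv]) auto
      also have "dd ((\<lambda>x. x + h) ` S \<union> {}) \<phi> = dd S (\<lambda>x. \<phi> (x + h))"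
      proof -
        have "(\<Prod>q\<in>(\<lambda>x. x + h) ` S - {p + h}. p + h - q) = (\<Prod>q\<in>S - {p}. p - q)" if "p \<in> S" for p
        proof -
          have "(\<lambda>x. x + h) ` S - {p + h} = (\<lambda>x. x + h) ` (S - {p})" by auto
          then show ?thesis by (simp add: prod.reindex)
        qed
        then show ?thesis by (simp add: dd_def sum.reindex)
      qed
      finally have "0 \<le> (dd S (\<lambda>x. \<phi> (x + h)) - dd S \<phi>) / h" using elim by simp
      also have "\<dots> = dd S (\<lambda>x. (\<phi> (x + h) - \<phi> x) / h)" using fin by (simp add: dd_linear)
      finally show ?case .
    qed
  qed
  ultimately show "0 \<le> dd S \<psi>"
    by (rule tendsto_lowerbound) simp
qed

text \<open>Moves the dependence on \<open>t\<close> from the functional into its argument. With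
  \<open>s\<close> fixed, limits and integrals in \<open>t\<close> can then be taken through one
  fixed functional.\<close>

lemma tensor_eval_shift:
  assumes "i \<in> {1..d}"
  shows "tensor d (\<Lambda>(i := (\<lambda>\<phi>. \<phi> t))) f = tensor d (\<Lambda>(i := (\<lambda>\<phi>. \<phi> s))) (\<lambda>x. f (x(i := t)))"
  using assms
proof (induction d arbitrary: f)
  case (Suc d)
  show ?case
  proof (cases "i = Suc d")
    case True
    have "tensor d (\<Lambda>(i := (\<lambda>\<phi>. \<phi> r))) g = tensor d \<Lambda> g" for r g
      by (rule tensor_cong_functional) (use True in auto)
    then show ?thesis unfolding tensor.simps True by simp
  next
    case False
    then have i: "i \<in> {1..d}" using Suc.prems by auto
    have IH: "tensor d (\<Lambda>(i := (\<lambda>\<phi>. \<phi> t))) g = tensor d (\<Lambda>(i := (\<lambda>\<phi>. \<phi> s))) (\<lambda>x. g (x(i := t)))" for g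
      by (rule Suc.IH[OF i])
    have "(\<Lambda>(i := (\<lambda>\<phi>. \<phi> r))) (Suc d) = \<Lambda> (Suc d)" for r using False by simp
    then show ?thesis unfolding tensor.simps by (simp only: IH fun_upd_twist[OF False])
  qed
qed simp


section \<open>Pseudo-polynomials and kernels\<close>

definition node_family :: "nat \<Rightarrow> (nat \<Rightarrow> real set) \<Rightarrow> (nat \<Rightarrow> nat) \<Rightarrow> (nat \<Rightarrow> real set) \<Rightarrow> bool" where
  "node_family d I n S \<longleftrightarrow> (\<forall>i\<in>{1..d}. S i \<subseteq> I i \<and> card (S i) = Suc (n i))"

lemma node_familyD:
  assumes "node_family d I n S" "i \<in> {1..d}"
  shows "S i \<subseteq> I i" "card (S i) = Suc (n i)" "finite (S i)" "fin_functional (I i) (dd (S i))"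
  using assms card_ge_0_finite[of "S i"] fin_functional_ddI[of "S i" "n i" "I i"]
  by (auto simp: node_family_def)

lemma fin_functional_tensor_dd:
  assumes "node_family d I n S"
  shows "fin_functional (cuboid d I) (tensor d (\<lambda>i. dd (S i)))"
  using node_familyD(4)[OF assms] by (rule fin_functional_tensor)

text \<open>By symmetry, ordered tuples of distinct nodes and node sets give the same
  conditions.\<close>

lemma box_convex_iff_dd:
  "box_convex d I n f \<longleftrightarrow> (\<forall>S. node_family d I n S \<longrightarrow> 0 \<le> tensor d (\<lambda>i. dd (S i)) f)"
proof
  assume f: "box_convex d I n f"
  show "\<forall>S. node_family d I n S \<longrightarrow> 0 \<le> tensor d (\<lambda>i. dd (S i)) f"
  proof (intro allI impI)
    fix S assume S: "node_family d I n S"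
    have "\<exists>x. bij_betw x {..n i} (S i)" if "i \<in> {1..d}" for i
      using ex_bij_betw_nat_finite[OF node_familyD(3)[OF S that]] node_familyD(2)[OF S that]
      by (simp add: atLeast0LessThan lessThan_Suc_atMost)
    then obtain x where x: "\<And>i. i \<in> {1..d} \<Longrightarrow> bij_betw (x i) {..n i} (S i)" by metis
    then have x': "x i ` {..n i} = S i" "inj_on (x i) {..n i}" if "i \<in> {1..d}" for i
      using that by (auto simp: bij_betw_def)
    have "\<forall>i\<in>{1..d}. (\<forall>j\<le>n i. x i j \<in> I i) \<and> inj_on (x i) {..n i}"
      using x' node_familyD(1)[OF S] by blast
    then have "0 \<le> mdivdiff d n x f" using f by (simp add: box_convex_def)
    also have "mdivdiff d n x f = tensor d (\<lambda>i. dd (S i)) f"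
      unfolding mdivdiff_eq_tensor
      by (rule tensor_cong_functional) (simp add: divdiff_eq_dd x' fun_eq_iff)
    finally show "0 \<le> tensor d (\<lambda>i. dd (S i)) f" .
  qed
next
  assume f: "\<forall>S. node_family d I n S \<longrightarrow> 0 \<le> tensor d (\<lambda>i. dd (S i)) f"
  show "box_convex d I n f"
    unfolding box_convex_def
  proof (intro allI impI)
    fix x :: "nat \<Rightarrow> nat \<Rightarrow> real"
    assume x: "\<forall>i\<in>{1..d}. (\<forall>j\<le>n i. x i j \<in> I i) \<and> inj_on (x i) {..n i}"
    have "node_family d I n (\<lambda>i. x i ` {..n i})"
      using x by (auto simp: node_family_def card_image)
    moreover have "mdivdiff d n x f = tensor d (\<lambda>i. dd (x i ` {..n i})) f"
      unfolding mdivdiff_eq_tensor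
      using x by (intro tensor_cong_functional) (simp add: divdiff_eq_dd fun_eq_iff)
    ultimately show "0 \<le> mdivdiff d n x f" using f by simp
  qed
qed

text \<open>The coefficient \<open>A i k\<close> does not see coordinate \<open>i\<close>, so it is
  constant along the sections in that coordinate, where \<open>dd (S i)\<close> annihilates the
  power.\<close>

lemma tensor_dd_pseudo_polynomial:
  assumes W: "pseudo_polynomial d I (\<lambda>i. n i - 1) W" and n: "\<And>i. i \<in> {1..d} \<Longrightarrow> 1 \<le> n i"
    and S: "node_family d I n S"
  shows "tensor d (\<lambda>i. dd (S i)) W = 0"
proof -
  obtain A where A: "\<And>x. x \<in> cuboid d I \<Longrightarrow>
      W x = (\<Sum>i=1..d. \<Sum>k=0..n i - 1. A i k (restrict x ({1..d} - {i})) * x i ^ k)"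
    using W by (auto simp: pseudo_polynomial_def)
  have T: "fin_functional (cuboid d I) (tensor d (\<lambda>i. dd (S i)))"
    by (rule fin_functional_tensor_dd[OF S])
  have "tensor d (\<lambda>i. dd (S i)) (\<lambda>x. A i k (restrict x ({1..d} - {i})) * x i ^ k) = 0"
    if i: "i \<in> {1..d}" and k: "k \<in> {0..n i - 1}" for i k
  proof (rule tensor_kill[OF node_familyD(4)[OF S] i])
    fix x :: "nat \<Rightarrow> real"
    have "restrict (x(i := t)) ({1..d} - {i}) = restrict x ({1..d} - {i})" for t
      by (auto simp: fun_eq_iff)
    moreover have "dd (S i) (\<lambda>t. t ^ k) = 0"
      using node_familyD[OF S i] n[OF i] k by (intro dd_power) auto
    ultimately show "dd (S i) (\<lambda>t. A i k (restrict (x(i := t)) ({1..d} - {i})) * (x(i := t)) i ^ k) = 0"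
      using node_familyD[OF S i] by (simp add: dd_linear)
  qed
  then have "(\<Sum>i=1..d. \<Sum>k=0..n i - 1.
      tensor d (\<lambda>i. dd (S i)) (\<lambda>x. A i k (restrict x ({1..d} - {i})) * x i ^ k)) = 0"
    by (intro sum.neutral ballI)
  moreover have "tensor d (\<lambda>i. dd (S i)) W = tensor d (\<lambda>i. dd (S i))
      (\<lambda>x. \<Sum>i=1..d. \<Sum>k=0..n i - 1. A i k (restrict x ({1..d} - {i})) * x i ^ k)"
    by (rule fin_functional_cong[OF T A])
  ultimately show ?thesis
    by (simp add: fin_functional_sum_fun[OF T])
qed

text \<open>Interpolating in the coordinates one after the other writes \<open>W\<close> as a telescoping sum of
  terms that are polynomial in one coordinate; the remainder is a multiple of a divided difference.\<close>

lemma pseudo_polynomialI_dd: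
  assumes kill: "\<And>S. node_family d I n S \<Longrightarrow> tensor d (\<lambda>i. dd (S i)) W = 0"
    and I: "\<And>i. i \<in> {1..d} \<Longrightarrow> open (I i) \<and> I i \<noteq> {}"
    and n: "\<And>i. i \<in> {1..d} \<Longrightarrow> 1 \<le> n i"
  shows "pseudo_polynomial d I (\<lambda>i. n i - 1) W"
proof -
  have "\<exists>T. finite T \<and> card T = n i \<and> T \<subseteq> I i" if "i \<in> {1..d}" for i
    using infinite_arbitrarily_large[OF infinite_open_real] I[OF that] by metis
  then obtain T where T: "\<And>i. i \<in> {1..d} \<Longrightarrow> finite (T i) \<and> card (T i) = n i \<and> T i \<subseteq> I i"
    by metis
  \<comment> \<open>Coordinates below \<open>k\<close> carry the interpolation error, the others an
    evaluation. So \<open>\<Lambda> 1 x\<close> evaluates at \<open>x\<close> and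
    \<open>\<Lambda> (Suc d) x\<close> is the full error.\<close>
  define \<Lambda> :: "nat \<Rightarrow> (nat \<Rightarrow> real) \<Rightarrow> nat \<Rightarrow> (real \<Rightarrow> real) \<Rightarrow> real" where
    "\<Lambda> k x = (\<lambda>j. if j < k then interp_error (T j) (x j) else (\<lambda>\<phi>. \<phi> (x j)))" for k x
  define A where "A k r y =
    (\<Sum>p\<in>T k. coeff (lagrange_basis (T k) p) r * tensor d ((\<Lambda> k y)(k := (\<lambda>\<phi>. \<phi> p))) W)" for k r y
  have "W x = (\<Sum>k=1..d. \<Sum>r=0..n k - 1. A k r (restrict x ({1..d} - {k})) * x k ^ r)"
    if x: "x \<in> cuboid d I" for x
  proof -
    have xI: "x j \<in> I j" if "j \<in> {1..d}" for j using x that by auto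
    have fin: "fin_functional (I j) (interp_error (T j) (x j))" "fin_functional (I j) (\<lambda>\<phi>. \<phi> (x j))"
      if "j \<in> {1..d}" for j
      using T[OF that] xI[OF that] by (auto intro!: fin_functional_interp_error fin_functional.eval)
    then have fin\<Lambda>: "fin_functional (I j) (\<Lambda> k x j)" if "j \<in> {1..d}" for j k
      using that by (auto simp: \<Lambda>_def)
    have first: "tensor d (\<Lambda> 1 x) W = W x"
    proof -
      have "tensor d (\<Lambda> 1 x) W = tensor d (\<lambda>j \<phi>. \<phi> (x j)) W"
        by (rule tensor_cong_functional) (auto simp: \<Lambda>_def)
      then show ?thesis by (simp add: tensor_eval[OF x])
    qed
    \<comment> \<open>If a coordinate of \<open>x\<close> is an interpolation node, its factor
      vanishes. Otherwise Newton's remainder makes the full error a multiple of a divided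
      difference, which \<open>kill\<close> annihilates.\<close>
    have last: "tensor d (\<Lambda> (Suc d) x) W = 0"
    proof (cases "\<exists>i\<in>{1..d}. x i \<in> T i")
      case True
      then obtain i where i: "i \<in> {1..d}" "x i \<in> T i" by auto
      have "\<Lambda> (Suc d) x i = (\<lambda>\<phi>. 0)"
        using i T[OF i(1)] by (auto simp: \<Lambda>_def interp_error_node fun_eq_iff)
      from tensor_zero_functional[where \<Lambda> = "\<Lambda> (Suc d) x" and I = I, OF fin\<Lambda> i(1) this] show ?thesis .
    next
      case False
      define S where "S i = insert (x i) (T i)" for i
      have S: "node_family d I n S"
        using False T xI by (auto simp: node_family_def S_def)
      have "tensor d (\<Lambda> (Suc d) x) W = tensor d (\<lambda>i \<phi>. (\<Prod>q\<in>T i. x i - q) * dd (S i) \<phi>) W"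
        using False T by (intro tensor_cong_functional) (auto simp: \<Lambda>_def S_def interp_error_eq_dd fun_eq_iff)
      also have "\<dots> = (\<Prod>i=1..d. \<Prod>q\<in>T i. x i - q) * tensor d (\<lambda>i. dd (S i)) W"
        by (rule tensor_scale[OF node_familyD(4)[OF S]])
      finally show ?thesis using kill[OF S] by simp
    qed
    have step: "tensor d (\<Lambda> k x) W - tensor d (\<Lambda> (Suc k) x) W =
        (\<Sum>r=0..n k - 1. A k r (restrict x ({1..d} - {k})) * x k ^ r)" if k: "k \<in> {1..d}" for k
    proof -
      \<comment> \<open>Passing from \<open>k\<close> to \<open>Suc k\<close> subtracts the
        interpolating polynomial in coordinate \<open>k\<close> alone; its degree is at most
        \<open>n k - 1\<close>.\<close>
      define P where "P = (\<lambda>\<phi>. \<Sum>p\<in>T k. poly (lagrange_basis (T k) p) (x k) * \<phi> p)"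
      have finP: "fin_functional (I k) P"
        unfolding P_def using T[OF k] by (intro fin_functional_weighted_sum) auto
      have 1: "\<Lambda> k x = (\<Lambda> k x)(k := (\<lambda>\<phi>. \<phi> (x k)))" by (auto simp: \<Lambda>_def)
      have 2: "\<Lambda> (Suc k) x = (\<Lambda> k x)(k := (\<lambda>\<phi>. \<phi> (x k) - P \<phi>))"
        by (auto simp: \<Lambda>_def fun_eq_iff interp_error_def P_def)
      have "tensor d (\<Lambda> (Suc k) x) W = tensor d (\<Lambda> k x) W - tensor d ((\<Lambda> k x)(k := P)) W"
        unfolding 2 using tensor_update_diff[where f = W and \<Lambda> = "\<Lambda> k x" and I = I, OF fin\<Lambda> k fin(2)[OF k] finP] 1 by simp
      moreover have "tensor d ((\<Lambda> k x)(k := P)) W = P (\<lambda>t. tensor d ((\<Lambda> k x)(k := (\<lambda>\<phi>. \<phi> t))) W)"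
      proof -
        have "fin_functional (I j) (((\<Lambda> k x)(k := P)) j)" if "j \<in> {1..d}" for j
          using fin\<Lambda>[OF that] finP by auto
        from tensor_extract[where f = W and \<Lambda> = "(\<Lambda> k x)(k := P)" and I = I, OF this k] show ?thesis by simp
      qed
      \<comment> \<open>The factor in coordinate \<open>k\<close> has been overwritten, so only the
        other coordinates of \<open>x\<close> enter. This makes the coefficient admissible.\<close>
      moreover have "tensor d ((\<Lambda> k x)(k := (\<lambda>\<phi>. \<phi> t))) W =
          tensor d ((\<Lambda> k (restrict x ({1..d} - {k})))(k := (\<lambda>\<phi>. \<phi> t))) W" for t
        by (rule tensor_cong_functional) (auto simp: \<Lambda>_def)
      ultimately have "tensor d (\<Lambda> k x) W - tensor d (\<Lambda> (Suc k) x) W =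
        (\<Sum>p\<in>T k. poly (lagrange_basis (T k) p) (x k) *
          tensor d ((\<Lambda> k (restrict x ({1..d} - {k})))(k := (\<lambda>\<phi>. \<phi> p))) W)"
        by (simp add: P_def)
      also have "\<dots> = (\<Sum>p\<in>T k. \<Sum>r=0..n k - 1. coeff (lagrange_basis (T k) p) r * x k ^ r *
          tensor d ((\<Lambda> k (restrict x ({1..d} - {k})))(k := (\<lambda>\<phi>. \<phi> p))) W)"
      proof (intro sum.cong refl)
        fix p assume p: "p \<in> T k"
        have "degree (lagrange_basis (T k) p) \<le> n k - 1"
          using degree_lagrange_basis[of "T k" p] T[OF k] p by auto
        then have "poly (lagrange_basis (T k) p) (x k) =
            (\<Sum>r=0..n k - 1. coeff (lagrange_basis (T k) p) r * x k ^ r)"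
          unfolding poly_altdef by (intro sum.mono_neutral_left) (auto simp: coeff_eq_0)
        then show "poly (lagrange_basis (T k) p) (x k) *
            tensor d ((\<Lambda> k (restrict x ({1..d} - {k})))(k := (\<lambda>\<phi>. \<phi> p))) W =
          (\<Sum>r=0..n k - 1. coeff (lagrange_basis (T k) p) r * x k ^ r *
            tensor d ((\<Lambda> k (restrict x ({1..d} - {k})))(k := (\<lambda>\<phi>. \<phi> p))) W)"
          by (simp add: sum_distrib_right)
      qed
      also have "\<dots> = (\<Sum>r=0..n k - 1. A k r (restrict x ({1..d} - {k})) * x k ^ r)"
        by (subst sum.swap) (simp add: A_def sum_distrib_left mult_ac)
      finally show ?thesis .
    qed
    have "W x = (\<Sum>k=1..d. tensor d (\<Lambda> k x) W - tensor d (\<Lambda> (Suc k) x) W)"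
      using sum_Suc_diff[of 1 d "\<lambda>k. - tensor d (\<Lambda> k x) W"] first last by simp
    then show ?thesis by (simp only: step cong: sum.cong)
  qed
  then show ?thesis unfolding pseudo_polynomial_def by blast
qed

section \<open>Kernels: integration in the endpoint, bounds and integrability\<close>

lemma plus_indicator_power: "1 \<le> m \<Longrightarrow> (t - u) ^ m * plus_indicator b u t = max 0 (t - u) ^ m"
  by (cases b) (auto simp: max_def)

text \<open>The kernel of order \<open>Suc m\<close> is continuous in \<open>t\<close> and, away
  from \<open>t = u\<close>, locally a polynomial with the expected derivative. The fundamental
  theorem of calculus tolerates the exceptional point \<open>u\<close>.\<close>

lemma primitive_on_kernel:
  assumes "1 \<le> m"
  shows "primitive_on J (\<lambda>t. kernel (Suc m) b a t u) (\<lambda>t. kernel m b a t u)"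
  unfolding primitive_on_def
proof (intro ballI impI)
  fix c e :: real assume ce: "c \<le> e"
  \<comment> \<open>For a positive exponent the truncated power is a power of
    \<open>max 0 (t - u)\<close> for either side, hence continuous.\<close>
  have K: "kernel (Suc m) b a t u = max 0 (t - u) ^ m / fact m - (t - u) ^ m / fact m * plus_indicator b u a" for t
    unfolding kernel_def chi_eq_plus_indicator plus_indicator_power[OF assms, of t u b, symmetric]
    by (simp add: field_simps)
  show "((\<lambda>t. kernel m b a t u) has_integral kernel (Suc m) b a e u - kernel (Suc m) b a c u) {c..e}"
  proof (rule fundamental_theorem_of_calculus_strong[of "{u}"])
    show "continuous_on {c..e} (\<lambda>t. kernel (Suc m) b a t u)"
      unfolding K by (intro continuous_intros) auto
    fix x assume x: "x \<in> {c..e} - {u}"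
    have deriv: "((\<lambda>t. (t - u) ^ m / fact m * s) has_real_derivative (x - u) ^ (m - 1) / fact (m - 1) * s) (at x)" for s
    proof -
      have "((\<lambda>t. (t - u) ^ m / fact m * s) has_real_derivative real m * (x - u) ^ (m - 1) / fact m * s) (at x)"
        by (auto intro!: derivative_eq_intros)
      moreover have "(fact m :: real) = real m * fact (m - 1)" using assms by (simp add: fact_reduce)
      ultimately show ?thesis using assms by (simp add: field_simps)
    qed
    have ev: "\<forall>\<^sub>F t in nhds x. kernel (Suc m) b a t u = (t - u) ^ m / fact m * chi b a x u"
    proof -
      have "\<forall>\<^sub>F t in nhds x. plus_indicator b u t = plus_indicator b u x"
      proof (cases "x < u")
        case True
        then have "\<forall>\<^sub>F t in nhds x. t < u" using eventually_nhds_in_open[of "{..<u}" x] by auto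
        then show ?thesis by eventually_elim (use True in \<open>cases b; auto\<close>)
      next
        case False
        then have "u < x" using x by auto
        then have "\<forall>\<^sub>F t in nhds x. u < t" using eventually_nhds_in_open[of "{u<..}" x] by auto
        then show ?thesis by eventually_elim (use \<open>u < x\<close> in \<open>cases b; auto\<close>)
      qed
      then show ?thesis by eventually_elim (simp add: kernel_def chi_eq_plus_indicator)
    qed
    have "((\<lambda>t. kernel (Suc m) b a t u) has_real_derivative (x - u) ^ (m - 1) / fact (m - 1) * chi b a x u) (at x)"
      using deriv by (subst DERIV_cong_ev[OF refl ev refl])
    then show "((\<lambda>t. kernel (Suc m) b a t u) has_vector_derivative kernel m b a x u) (at x)"
      by (simp add: kernel_def has_real_derivative_iff_has_vector_derivative)
  qed (use ce in auto)
qed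

lemma abs_kernel_le:
  assumes "p \<le> a" "a \<le> q" "p \<le> x" "x \<le> q"
  shows "\<bar>kernel n b a x u\<bar> \<le> (q - p) ^ (n - 1)"
proof (cases "p \<le> u \<and> u \<le> q")
  case True
  have "\<bar>chi b a x u\<bar> \<le> 1" by (cases b) (auto simp: indicator_def)
  moreover have "\<bar>x - u\<bar> ^ (n - 1) / fact (n - 1) \<le> (q - p) ^ (n - 1) / 1"
    using assms True by (intro frac_le power_mono) (auto simp: fact_ge_1)
  ultimately have "\<bar>x - u\<bar> ^ (n - 1) / fact (n - 1) * \<bar>chi b a x u\<bar> \<le> (q - p) ^ (n - 1) * 1"
    using assms by (intro mult_mono) auto
  then show ?thesis by (simp add: kernel_def abs_mult power_abs)
next
  case False
  then have "chi b a x u = 0" using assms by (cases b) (auto simp: indicator_def)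
  then show ?thesis using assms by (simp add: kernel_def)
qed

lemma kernel_eq_0:
  assumes "p \<le> a" "a \<le> q" "p \<le> x" "x \<le> q" "\<not> (p \<le> u \<and> u \<le> q)"
  shows "kernel n b a x u = 0"
  using assms by (cases b) (auto simp: kernel_def indicator_def)

lemma measurable_kernel:
  assumes [measurable]: "X \<in> borel_measurable M" "U \<in> borel_measurable M"
    and B: "{z\<in>space M. B z = L} \<in> sets M"
  shows "(\<lambda>z. kernel n (B z) a (X z) (U z)) \<in> borel_measurable M"
proof -
  have [measurable]: "Measurable.pred M (\<lambda>z. B z = L)" using B by (simp add: pred_def)
  have "kernel n (B z) a (X z) (U z) = (X z - U z) ^ (n - 1) / fact (n - 1) *
    (if B z = L then (if U z < X z then 1 else 0) - (if U z < a then 1 else 0)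
     else (if U z \<le> X z then 1 else 0) - (if U z \<le> a then 1 else 0))" for z
    by (cases "B z") (auto simp: kernel_def chi_eq_plus_indicator)
  then show ?thesis by simp
qed

definition kern :: "nat \<Rightarrow> (nat \<Rightarrow> nat) \<Rightarrow> (nat \<Rightarrow> real) \<Rightarrow> (nat \<Rightarrow> real) \<Rightarrow>
    (nat \<Rightarrow> side) \<Rightarrow> (nat \<Rightarrow> real) \<Rightarrow> real" where
  "kern d n \<alpha> x b u = (\<Prod>j=1..d. kernel (n j) (b j) (\<alpha> j) (x j) (u j))"

lemma measurable_kern:
  assumes "\<And>j. j \<in> {1..d} \<Longrightarrow> (\<lambda>z. X z j) \<in> borel_measurable M"
    and "\<And>j. j \<in> {1..d} \<Longrightarrow> (\<lambda>z. U z j) \<in> borel_measurable M"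
    and "\<And>j. j \<in> {1..d} \<Longrightarrow> {z\<in>space M. B z j = L} \<in> sets M"
  shows "(\<lambda>z. kern d n \<alpha> (X z) (B z) (U z)) \<in> borel_measurable M"
  unfolding kern_def using assms by (intro borel_measurable_prod measurable_kernel) auto

lemma abs_kern_le:
  assumes "\<And>j. j \<in> {1..d} \<Longrightarrow> p j \<le> \<alpha> j \<and> \<alpha> j \<le> q j \<and> p j \<le> x j \<and> x j \<le> q j"
  shows "\<bar>kern d n \<alpha> x b u\<bar> \<le> (\<Prod>j=1..d. (q j - p j) ^ (n j - 1))"
  unfolding kern_def abs_prod
proof (intro prod_mono conjI abs_ge_zero)
  fix j assume "j \<in> {1..d}"
  from assms[OF this] show "\<bar>kernel (n j) (b j) (\<alpha> j) (x j) (u j)\<bar> \<le> (q j - p j) ^ (n j - 1)"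
    by (intro abs_kernel_le) auto
qed

lemma kern_eq_0:
  assumes "\<And>j. j \<in> {1..d} \<Longrightarrow> p j \<le> \<alpha> j \<and> \<alpha> j \<le> q j \<and> p j \<le> x j \<and> x j \<le> q j"
    and "\<exists>j\<in>{1..d}. \<not> (p j \<le> u j \<and> u j \<le> q j)"
  shows "kern d n \<alpha> x b u = 0"
proof -
  obtain j where j: "j \<in> {1..d}" "\<not> (p j \<le> u j \<and> u j \<le> q j)" using assms(2) by auto
  then have "kernel (n j) (b j) (\<alpha> j) (x j) (u j) = 0"
    using assms(1)[OF j(1)] by (intro kernel_eq_0[of "p j" _ "q j"]) auto
  then show ?thesis unfolding kern_def using j(1) by (intro prod_zero) auto
qed

text \<open>A bounded function that vanishes off a set of finite measure. The maps \<open>U\<close>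
  and \<open>B\<close> leave the underlying space open, so that both the measure on pairs and the
  single measures on the cuboid are covered.\<close>

lemma integrable_kern:
  assumes U: "\<And>j. j \<in> {1..d} \<Longrightarrow> (\<lambda>z. U z j) \<in> borel_measurable M"
    and B: "\<And>j. j \<in> {1..d} \<Longrightarrow> {z\<in>space M. B z j = L} \<in> sets M"
    and px: "\<And>j. j \<in> {1..d} \<Longrightarrow> p j \<le> \<alpha> j \<and> \<alpha> j \<le> q j \<and> p j \<le> x j \<and> x j \<le> q j"
    and fin: "emeasure M {z\<in>space M. \<forall>j\<in>{1..d}. p j \<le> U z j \<and> U z j \<le> q j} < \<infinity>"
  shows "integrable M (\<lambda>z. kern d n \<alpha> x (B z) (U z))"
proof (rule integrableI_bounded_set[OF _ _ fin])
  have [measurable]: "(\<lambda>z. U z j) \<in> borel_measurable M" if "j \<in> {1..d}" for j using U that .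
  show "{z\<in>space M. \<forall>j\<in>{1..d}. p j \<le> U z j \<and> U z j \<le> q j} \<in> sets M"
    using U by measurable
  show "(\<lambda>z. kern d n \<alpha> x (B z) (U z)) \<in> borel_measurable M"
    using U B by (intro measurable_kern) auto
  show "AE z in M. z \<in> {z\<in>space M. \<forall>j\<in>{1..d}. p j \<le> U z j \<and> U z j \<le> q j} \<longrightarrow>
      norm (kern d n \<alpha> x (B z) (U z)) \<le> (\<Prod>j=1..d. (q j - p j) ^ (n j - 1))"
    unfolding real_norm_def by (intro AE_I2 impI abs_kern_le px)
  show "AE z in M. z \<notin> {z\<in>space M. \<forall>j\<in>{1..d}. p j \<le> U z j \<and> U z j \<le> q j} \<longrightarrow>
      kern d n \<alpha> x (B z) (U z) = 0"
    by (intro AE_I2 impI kern_eq_0[OF px]) auto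
qed

lemma tensor_dd_kern:
  assumes "node_family d I n S"
  shows "tensor d (\<lambda>i. dd (S i)) (\<lambda>x. kern d n \<alpha> x b u) =
    (\<Prod>j=1..d. dd (S j) (\<lambda>t. kernel (n j) (b j) (\<alpha> j) t (u j)))"
  unfolding kern_def by (rule tensor_prod[OF node_familyD(4)[OF assms]])

lemma tensor_dd_kern_nonneg:
  assumes S: "node_family d I n S" and n: "\<And>i. i \<in> {1..d} \<Longrightarrow> 1 \<le> n i"
  shows "0 \<le> tensor d (\<lambda>i. dd (S i)) (\<lambda>x. kern d n \<alpha> x b u)"
  unfolding tensor_dd_kern[OF S]
  using node_familyD[OF S] n by (intro prod_nonneg) (auto intro!: dd_kernel_nonneg)

lemma tensor_dd_kern_side:
  assumes S: "node_family d I n S"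
    and b: "\<And>i. i \<in> {1..d} \<Longrightarrow> b i = b' i \<or> 2 \<le> n i"
  shows "tensor d (\<lambda>i. dd (S i)) (\<lambda>x. kern d n \<alpha> x b u) =
    tensor d (\<lambda>i. dd (S i)) (\<lambda>x. kern d n \<alpha> x b' u)"
  unfolding tensor_dd_kern[OF S]
proof (rule prod.cong[OF refl])
  fix j assume j: "j \<in> {1..d}"
  show "dd (S j) (\<lambda>x. kernel (n j) (b j) (\<alpha> j) x (u j)) = dd (S j) (\<lambda>x. kernel (n j) (b' j) (\<alpha> j) x (u j))"
    using b[OF j] dd_kernel_side[OF node_familyD(2)[OF S j], of "\<alpha> j" "u j"]
    by (cases "b j"; cases "b' j") auto
qed


section \<open>Measures on pairs of a point and a choice of sides\<close>

text \<open>Enumerate the rationals of \<open>J\<close> and take minima and maxima of initial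
  segments: they stay in \<open>J\<close> and pass every point of \<open>J\<close>. This treats
  bounded and unbounded intervals alike.\<close>

lemma interval_exhaustion:
  fixes J :: "real set"
  assumes J: "open J" "J \<noteq> {}"
  obtains a c :: "nat \<Rightarrow> real" where "decseq a" "incseq c" "\<And>k. a k \<in> J" "\<And>k. c k \<in> J" "\<And>k. a k \<le> c k"
    "\<And>t. t \<in> J \<Longrightarrow> \<exists>k. a k < t \<and> t < c k"
proof -
  obtain x0 where x0: "x0 \<in> J" using J by auto
  have count: "countable (J \<inter> \<rat>)" using countable_rat by blast
  have rat: "\<exists>q\<in>J \<inter> \<rat>. q < t" "\<exists>q\<in>J \<inter> \<rat>. t < q" if t: "t \<in> J" for t
  proof -
    obtain e where e: "e > 0" "ball t e \<subseteq> J" using J t openE by blast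
    obtain q where q: "q \<in> \<rat>" "t - e < q" "q < t" using Rats_dense_in_real[of "t - e" t] e by auto
    obtain r where r: "r \<in> \<rat>" "t < r" "r < t + e" using Rats_dense_in_real[of t "t + e"] e by auto
    have "q \<in> ball t e" "r \<in> ball t e" using q r by (auto simp: dist_real_def)
    then have "q \<in> J" "r \<in> J" using e(2) by auto
    then show "\<exists>q\<in>J \<inter> \<rat>. q < t" "\<exists>q\<in>J \<inter> \<rat>. t < q" using q r by auto
  qed
  have ne: "J \<inter> \<rat> \<noteq> {}" using rat x0 by blast
  define q where "q = from_nat_into (J \<inter> \<rat>)"
  have q: "q k \<in> J" for k using from_nat_into[OF ne, of k] by (simp add: q_def)
  have surj: "\<exists>k. q k = t" if "t \<in> J \<inter> \<rat>" for t
    using from_nat_into_surj[OF count that] by (simp add: q_def)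
  show ?thesis
  proof
    show "decseq (\<lambda>k. Min (q ` {..k}))" by (auto intro!: decseq_SucI Min_antimono)
    show "incseq (\<lambda>k. Max (q ` {..k}))" by (auto intro!: incseq_SucI Max_mono)
    have sub: "q ` {..k} \<subseteq> J" for k using q by auto
    show "Min (q ` {..k}) \<in> J" for k by (rule subsetD[OF sub Min_in]) auto
    show "Max (q ` {..k}) \<in> J" for k by (rule subsetD[OF sub Max_in]) auto
    show "Min (q ` {..k}) \<le> Max (q ` {..k})" for k by (rule order_trans[of _ "q k"]) auto
    fix t assume t: "t \<in> J"
    obtain k l where kl: "q k < t" "t < q l" using rat[OF t] surj by metis
    have "Min (q ` {..max k l}) \<le> q k" "q l \<le> Max (q ` {..max k l})" by auto
    then show "\<exists>k. Min (q ` {..k}) < t \<and> t < Max (q ` {..k})" using kl by (metis le_less_trans less_le_trans)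
  qed
qed

lemma box_exhaustion:
  assumes I: "\<And>i. i \<in> {1..d} \<Longrightarrow> open (I i) \<and> I i \<noteq> {}"
  shows "\<exists>a c :: nat \<Rightarrow> nat \<Rightarrow> real.
    (\<forall>k. \<forall>i\<in>{1..d}. a k i \<in> I i \<and> c k i \<in> I i \<and> a k i \<le> c k i) \<and>
    (\<forall>k l. k \<le> l \<longrightarrow> (\<forall>i\<in>{1..d}. a l i \<le> a k i \<and> c k i \<le> c l i)) \<and>
    (\<forall>u. (\<forall>i\<in>{1..d}. u i \<in> I i) \<longrightarrow> (\<exists>k. \<forall>i\<in>{1..d}. a k i < u i \<and> u i < c k i))"
proof -
  have "\<exists>a c. (\<forall>k::nat. a k \<in> I i \<and> c k \<in> I i \<and> a k \<le> c k) \<and> decseq a \<and> incseq c \<and>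
      (\<forall>t\<in>I i. \<exists>k. a k < t \<and> t < c k)" if "i \<in> {1..d}" for i
    using interval_exhaustion[of "I i"] I[OF that] by metis
  then obtain a c where ac: "\<And>i k. i \<in> {1..d} \<Longrightarrow> a i k \<in> I i \<and> c i k \<in> I i \<and> a i k \<le> c i k"
      "\<And>i. i \<in> {1..d} \<Longrightarrow> decseq (a i) \<and> incseq (c i)"
      "\<And>i t. i \<in> {1..d} \<Longrightarrow> t \<in> I i \<Longrightarrow> \<exists>k::nat. a i k < t \<and> t < c i k" by metis
  have mono: "a i l \<le> a i k \<and> c i k \<le> c i l" if "i \<in> {1..d}" "k \<le> l" for i k l
    using ac(2)[OF that(1)] that(2) by (auto simp: decseq_def incseq_def)
  have ex: "\<exists>k. \<forall>i\<in>{1..d}. a i k < u i \<and> u i < c i k" if u: "\<forall>i\<in>{1..d}. u i \<in> I i" for u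
  proof -
    have "\<exists>k. a i k < u i \<and> u i < c i k" if "i \<in> {1..d}" for i using ac(3) u that by blast
    then obtain k where k: "\<And>i. i \<in> {1..d} \<Longrightarrow> a i (k i) < u i \<and> u i < c i (k i)" by metis
    \<comment> \<open>The element 0 keeps the maximum meaningful for \<open>d = 0\<close>.\<close>
    define m where "m = Max (insert 0 (k ` {1..d}))"
    have "a i m < u i \<and> u i < c i m" if i: "i \<in> {1..d}" for i
    proof -
      have "k i \<le> m" unfolding m_def using i by (intro Max_ge) auto
      then show ?thesis using k[OF i] mono[OF i, of "k i" m] by linarith
    qed
    then show ?thesis by blast
  qed
  show ?thesis
  proof (rule exI[of _ "\<lambda>k i. a i k"], rule exI[of _ "\<lambda>k i. c i k"], intro conjI)
    show "\<forall>k. \<forall>i\<in>{1..d}. a i k \<in> I i \<and> c i k \<in> I i \<and> a i k \<le> c i k" using ac(1) by simp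
    show "\<forall>k l. k \<le> l \<longrightarrow> (\<forall>i\<in>{1..d}. a i l \<le> a i k \<and> c i k \<le> c i l)" using mono by simp
    show "\<forall>u. (\<forall>i\<in>{1..d}. u i \<in> I i) \<longrightarrow> (\<exists>k. \<forall>i\<in>{1..d}. a i k < u i \<and> u i < c i k)"
      using ex by simp
  qed
qed

text \<open>Tychonoff's theorem in the full product: the coordinates outside \<open>{1..d}\<close>
  range over the singleton \<open>{undefined}\<close>.\<close>

lemma compact_cuboid:
  assumes "\<And>i. i \<in> {1..d} \<Longrightarrow> compact (S i)"
  shows "compact (cuboid d S)"
proof -
  define S' where "S' i = (if i \<in> {1..d} then S i else {undefined})" for i
  have "cuboid d S = PiE UNIV S'" by (auto simp: S'_def PiE_iff extensional_def split: if_splits)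
  moreover have "compactin (product_topology (\<lambda>i. euclidean) UNIV) (PiE UNIV S')"
    using assms by (subst compactin_PiE) (auto simp: S'_def)
  ultimately show ?thesis by (simp add: euclidean_product_topology)
qed

abbreviation side_families :: "nat \<Rightarrow> (nat \<Rightarrow> side) set" where
  "side_families d \<equiv> PiE {1..d} (\<lambda>_. UNIV)"

lemma UNIV_side: "UNIV = {L, R}"
  using side.exhaust by blast

lemma finite_side_families: "finite (side_families d)"
  by (intro finite_PiE) (auto simp: UNIV_side)

definition pair_space :: "nat \<Rightarrow> (nat \<Rightarrow> real set) \<Rightarrow> ((nat \<Rightarrow> real) \<times> (nat \<Rightarrow> side)) measure" where
  "pair_space d I = restrict_space borel (cuboid d I) \<Otimes>\<^sub>M count_space (side_families d)"

lemma space_pair_space: "space (pair_space d I) = cuboid d I \<times> side_families d"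
  by (simp add: pair_space_def space_pair_measure space_restrict_space)

text \<open>All measures \<open>\<mu>\<^sub>b\<close> are handled at once, as one measure on pairs \<open>(u, b)\<close>.\<close>

definition representing :: "nat \<Rightarrow> (nat \<Rightarrow> real set) \<Rightarrow> ((nat \<Rightarrow> real) \<times> (nat \<Rightarrow> side)) measure \<Rightarrow> bool" where
  "representing d I N \<longleftrightarrow> sets N = sets (pair_space d I) \<and>
    (\<forall>K. compact K \<and> K \<subseteq> cuboid d I \<longrightarrow> emeasure N (K \<times> side_families d) < \<infinity>) \<and>
    (\<forall>i\<in>{1..d}. \<exists>C. countable C \<and> (AE z in N. snd z i = L \<longrightarrow> fst z i \<in> C))"

lemma measurable_coord: "(\<lambda>u. u j) \<in> borel_measurable (restrict_space borel (A :: (nat \<Rightarrow> real) set))"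
  by (intro measurable_restrict_space1 borel_measurable_continuous_onI) simp

context
  fixes N d I assumes sets_N: "sets N = sets (pair_space d I)"
begin

lemma space_representing: "space N = cuboid d I \<times> side_families d"
  using sets_eq_imp_space_eq[OF sets_N] by (simp add: space_pair_space)

lemma measurable_fst_representing: "fst \<in> measurable N (restrict_space borel (cuboid d I))"
  using measurable_fst[of "restrict_space borel (cuboid d I)" "count_space (side_families d)"]
  by (simp add: measurable_cong_sets[OF sets_N refl] pair_space_def)

lemma measurable_snd_representing: "snd \<in> measurable N (count_space (side_families d))"
  using measurable_snd[of "restrict_space borel (cuboid d I)" "count_space (side_families d)"]
  by (simp add: measurable_cong_sets[OF sets_N refl] pair_space_def)

lemma measurable_coord_representing: "(\<lambda>z. fst z j) \<in> borel_measurable N"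
  using measurable_compose[OF measurable_fst_representing measurable_coord] .

lemma sets_snd_representing: "{z\<in>space N. P (snd z)} \<in> sets N"
proof -
  have "{z\<in>space N. P (snd z)} = snd -` {b\<in>side_families d. P b} \<inter> space N"
    by (auto simp: space_representing)
  also have "\<dots> \<in> sets N" using measurable_snd_representing by (rule measurable_sets) auto
  finally show ?thesis .
qed

end

lemma representing_sets: "representing d I N \<Longrightarrow> sets N = sets (pair_space d I)"
  by (simp add: representing_def)

lemma interval_subset:
  fixes J :: "real set"
  shows "is_interval J \<Longrightarrow> p \<in> J \<Longrightarrow> q \<in> J \<Longrightarrow> {p..q} \<subseteq> J"
  by (meson atLeastAtMost_iff mem_is_interval_1_I subsetI)

lemma representing_box_finite:
  assumes N: "representing d I N"
    and pq: "\<And>j. j \<in> {1..d} \<Longrightarrow> is_interval (I j) \<and> p j \<in> I j \<and> q j \<in> I j"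
  shows "emeasure N {z\<in>space N. \<forall>j\<in>{1..d}. p j \<le> fst z j \<and> fst z j \<le> q j} < \<infinity>"
proof -
  let ?K = "cuboid d (\<lambda>j. {p j..q j})"
  have sub: "?K \<subseteq> cuboid d I"
    using pq interval_subset by (intro PiE_mono) blast
  have "{z\<in>space N. \<forall>j\<in>{1..d}. p j \<le> fst z j \<and> fst z j \<le> q j} = ?K \<times> side_families d"
    using sub unfolding space_representing[OF representing_sets[OF N]] by (auto simp: PiE_iff)
  moreover have "emeasure N (?K \<times> side_families d) < \<infinity>"
    using N sub compact_cuboid[of d "\<lambda>j. {p j..q j}"] unfolding representing_def by auto
  ultimately show ?thesis by simp
qed

lemma minmax_mem: "(a::real) \<in> J \<Longrightarrow> b \<in> J \<Longrightarrow> min a b \<in> J \<and> max a b \<in> J"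
  by (auto simp: min_def max_def)

context
  fixes N d I and \<alpha> :: "nat \<Rightarrow> real"
  assumes N: "representing d I N"
    and I: "\<And>i. i \<in> {1..d} \<Longrightarrow> open (I i) \<and> is_interval (I i)"
    and \<alpha>: "\<alpha> \<in> cuboid d I"
begin

lemma representing_integrable:
  assumes x: "x \<in> cuboid d I"
  shows "integrable N (\<lambda>z. kern d n \<alpha> x (snd z) (fst z))"
proof (rule integrable_kern[where p = "\<lambda>j. min (\<alpha> j) (x j)" and q = "\<lambda>j. max (\<alpha> j) (x j)"])
  show "emeasure N {z \<in> space N. \<forall>j\<in>{1..d}. min (\<alpha> j) (x j) \<le> fst z j \<and> fst z j \<le> max (\<alpha> j) (x j)} < \<infinity>"
  proof (rule representing_box_finite[OF N])
    fix j assume "j \<in> {1..d}"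
    then show "is_interval (I j) \<and> min (\<alpha> j) (x j) \<in> I j \<and> max (\<alpha> j) (x j) \<in> I j"
      using I x \<alpha> by (intro conjI minmax_mem[THEN conjunct1] minmax_mem[THEN conjunct2]) (auto simp: PiE_iff)
  qed
  show "(\<lambda>z. fst z j) \<in> borel_measurable N" for j
    by (rule measurable_coord_representing[OF representing_sets[OF N]])
  show "{z \<in> space N. snd z j = L} \<in> sets N" for j
    by (rule sets_snd_representing[OF representing_sets[OF N]])
qed auto

lemma representing_tensor:
  assumes S: "node_family d I n S"
  shows "tensor d (\<lambda>i. dd (S i)) (\<lambda>x. \<integral>z. kern d n' \<alpha> x (snd z) (fst z) \<partial>N) =
    (\<integral>z. tensor d (\<lambda>i. dd (S i)) (\<lambda>x. kern d n' \<alpha> x (snd z) (fst z)) \<partial>N)"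
  by (rule fin_functional_integral(2)[OF fin_functional_tensor_dd[OF S] representing_integrable])

lemma representing_sigma_finite: "sigma_finite_measure N"
proof -
  have ne: "open (I i) \<and> I i \<noteq> {}" if "i \<in> {1..d}" for i using I[OF that] \<alpha> that by auto
  obtain a c :: "nat \<Rightarrow> nat \<Rightarrow> real" where
      ac: "\<forall>k. \<forall>i\<in>{1..d}. a k i \<in> I i \<and> c k i \<in> I i \<and> a k i \<le> c k i"
      and ex: "\<forall>u. (\<forall>i\<in>{1..d}. u i \<in> I i) \<longrightarrow> (\<exists>k. \<forall>i\<in>{1..d}. a k i < u i \<and> u i < c k i)"
    using box_exhaustion[of d I] ne by blast
  define A where "A k = {z\<in>space N. \<forall>j\<in>{1..d}. a k j \<le> fst z j \<and> fst z j \<le> c k j}" for k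
  show ?thesis
  proof
    show "\<exists>B. countable B \<and> B \<subseteq> sets N \<and> \<Union> B = space N \<and> (\<forall>a\<in>B. emeasure N a \<noteq> \<infinity>)"
    proof (intro exI[of _ "range A"] conjI ballI)
      have [measurable]: "(\<lambda>z. fst z j) \<in> borel_measurable N" for j
        by (rule measurable_coord_representing[OF representing_sets[OF N]])
      show "range A \<subseteq> sets N" by (auto simp: A_def)
      show "emeasure N B \<noteq> \<infinity>" if "B \<in> range A" for B
      proof -
        from that obtain k where B: "B = A k" by auto
        have "emeasure N (A k) < \<infinity>" unfolding A_def
          using ac I by (intro representing_box_finite[OF N]) auto
        then show ?thesis using B by simp
      qed
      have "z \<in> \<Union> (range A)" if z: "z \<in> space N" for z
      proof -
        obtain k where "\<forall>j\<in>{1..d}. a k j < fst z j \<and> fst z j < c k j"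
        proof -
          have "\<forall>i\<in>{1..d}. fst z i \<in> I i"
            using z space_representing[OF representing_sets[OF N]] by auto
          then show ?thesis using ex that by blast
        qed
        then have "z \<in> A k" using z unfolding A_def by (auto intro: less_imp_le)
        then show ?thesis by blast
      qed
      then show "\<Union> (range A) = space N" by (auto simp: A_def)
    qed auto
  qed
qed

text \<open>Fubini exchanges the integral over \<open>t\<close> with that over \<open>N\<close>, and
  for fixed \<open>z\<close> the integral over \<open>t\<close> is given by
  \<open>primitive_on_kernel\<close>.\<close>

lemma representing_has_integral:
  assumes x: "x \<in> cuboid d I" and i: "i \<in> {1..d}" and m: "1 \<le> m i"
    and c: "c \<in> I i" and e: "e \<in> I i" and ce: "c \<le> e"
  defines "n \<equiv> m(i := Suc (m i))"
  shows "((\<lambda>t. \<integral>z. kern d m \<alpha> (x(i := t)) (snd z) (fst z) \<partial>N) has_integral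
    (\<integral>z. kern d n \<alpha> (x(i := e)) (snd z) (fst z) \<partial>N) -
    (\<integral>z. kern d n \<alpha> (x(i := c)) (snd z) (fst z) \<partial>N)) {c..e}"
proof -
  note N' = representing_sets[OF N]
  interpret N: sigma_finite_measure N by (rule representing_sigma_finite)
  interpret P: pair_sigma_finite lborel N by standard
  \<comment> \<open>The box from \<open>p\<close> to \<open>q\<close> contains
    \<open>\<alpha>\<close> and all points \<open>x(i := t)\<close> with \<open>t\<close> in
    \<open>[c, e]\<close>. All kernels involved vanish outside it, which gives joint
    integrability.\<close>
  define p q where "p j = min (\<alpha> j) (if j = i then c else x j)"
    and "q j = max (\<alpha> j) (if j = i then e else x j)" for j
  have pq: "p j \<le> \<alpha> j \<and> \<alpha> j \<le> q j \<and> p j \<le> (x(i := t)) j \<and> (x(i := t)) j \<le> q j"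
    if "t \<in> {c..e}" for t j
    using that by (auto simp: p_def q_def)
  define B where "B = {z\<in>space N. \<forall>j\<in>{1..d}. p j \<le> fst z j \<and> fst z j \<le> q j}"
  have [measurable]: "(\<lambda>z. fst z j) \<in> borel_measurable N" for j
    by (rule measurable_coord_representing[OF N'])
  have [measurable]: "B \<in> sets N" by (auto simp: B_def)
  have finB: "emeasure N B < \<infinity>"
    unfolding B_def
  proof (rule representing_box_finite[OF N])
    fix j assume "j \<in> {1..d}"
    then show "is_interval (I j) \<and> p j \<in> I j \<and> q j \<in> I j"
      using I x \<alpha> c e by (auto simp: PiE_iff p_def q_def min_def max_def)
  qed
  define k where "k t z = kern d m \<alpha> (x(i := t)) (snd z) (fst z)" for t z
  define C where "C = (\<Prod>j=1..d. (q j - p j) ^ (m j - 1))"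
  have k_le: "\<bar>k t z\<bar> \<le> C" if "t \<in> {c..e}" for t z
    unfolding k_def C_def using pq[OF that] by (rule abs_kern_le)
  have k_0: "k t z = 0" if "t \<in> {c..e}" "z \<in> space N - B" for t z
    unfolding k_def using pq[OF that(1)] by (rule kern_eq_0) (use that(2) in \<open>auto simp: B_def\<close>)
  have kmeas[measurable]: "case_prod k \<in> borel_measurable (lborel \<Otimes>\<^sub>M N)"
  proof -
    have [measurable]: "Measurable.pred N (\<lambda>z. snd z j = L)" for j
      using sets_snd_representing[OF N', of "\<lambda>b. b j = L"] by (simp add: pred_def)
    have "(\<lambda>w. kern d m \<alpha> (x(i := fst w)) (snd (snd w)) (fst (snd w))) \<in> borel_measurable (lborel \<Otimes>\<^sub>M N)"
    proof (rule measurable_kern)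
      show "(\<lambda>z. (x(i := fst z)) j) \<in> borel_measurable (lborel \<Otimes>\<^sub>M N)" for j
        by (cases "j = i") auto
      show "(\<lambda>z. fst (snd z) j) \<in> borel_measurable (lborel \<Otimes>\<^sub>M N)" for j by measurable
      show "{z \<in> space (lborel \<Otimes>\<^sub>M N). snd (snd z) j = L} \<in> sets (lborel \<Otimes>\<^sub>M N)" for j by measurable
    qed
    then show ?thesis unfolding k_def case_prod_beta' .
  qed
  have k_sec[measurable]: "(\<lambda>t. k t z) \<in> borel_measurable lborel" if "z \<in> space N" for z
    using measurable_Pair_compose_split[OF kmeas measurable_ident_sets[OF refl] measurable_const[OF that]] by simp
  have joint: "integrable (lborel \<Otimes>\<^sub>M N) (\<lambda>(t, z). indicator {c..e} t * k t z)"
  proof (rule integrableI_bounded_set[of "{c..e} \<times> B"])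
    show "emeasure (lborel \<Otimes>\<^sub>M N) ({c..e} \<times> B) < \<infinity>"
      using finB ce by (simp add: N.emeasure_pair_measure_Times ennreal_mult_less_top)
    show "AE w in lborel \<Otimes>\<^sub>M N. w \<in> {c..e} \<times> B \<longrightarrow> norm (case w of (t, z) \<Rightarrow> indicator {c..e} t * k t z) \<le> C"
      using k_le by auto
    show "AE w in lborel \<Otimes>\<^sub>M N. w \<notin> {c..e} \<times> B \<longrightarrow> (case w of (t, z) \<Rightarrow> indicator {c..e} t * k t z) = 0"
    proof (rule AE_I2, intro impI)
      fix w assume w: "w \<in> space (lborel \<Otimes>\<^sub>M N)" "w \<notin> {c..e} \<times> B"
      have "k (fst w) (snd w) = 0" if "fst w \<in> {c..e}"
        using w that by (intro k_0) (auto simp: space_pair_measure)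
      then show "(case w of (t, z) \<Rightarrow> indicator {c..e} t * k t z) = 0"
        by (auto simp: case_prod_beta indicator_def)
    qed
  qed (auto simp: case_prod_beta intro!: borel_measurable_times)
  have "(\<integral>t. \<integral>z. indicator {c..e} t * k t z \<partial>N \<partial>lborel) = (\<integral>z. \<integral>t. indicator {c..e} t * k t z \<partial>lborel \<partial>N)"
    by (rule P.Fubini_integral[OF joint, symmetric])
  also have "\<dots> = (\<integral>z. kern d n \<alpha> (x(i := e)) (snd z) (fst z) - kern d n \<alpha> (x(i := c)) (snd z) (fst z) \<partial>N)"
  proof (rule Bochner_Integration.integral_cong[OF refl])
    fix z assume z: "z \<in> space N"
    \<comment> \<open>Only the factor in coordinate \<open>i\<close> depends on \<open>t\<close> and
      on the raised order; the rest is the constant \<open>r\<close>.\<close>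
    define r where "r = (\<Prod>j\<in>{1..d} - {i}. kernel (m j) (snd z j) (\<alpha> j) (x j) (fst z j))"
    have split: "kern d n' \<alpha> (x(i := t)) (snd z) (fst z) = kernel (n' i) (snd z i) (\<alpha> i) t (fst z i) * r"
      if "\<And>j. j \<noteq> i \<Longrightarrow> n' j = m j" for n' t
      unfolding kern_def r_def using i that by (subst prod.remove[of _ i]) (auto intro!: prod.cong)
    have "((\<lambda>t. k t z) has_integral kern d n \<alpha> (x(i := e)) (snd z) (fst z) - kern d n \<alpha> (x(i := c)) (snd z) (fst z)) {c..e}"
    proof -
      have "((\<lambda>t. kernel (m i) (snd z i) (\<alpha> i) t (fst z i)) has_integral
        kernel (Suc (m i)) (snd z i) (\<alpha> i) e (fst z i) - kernel (Suc (m i)) (snd z i) (\<alpha> i) c (fst z i)) {c..e}"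
        using primitive_on_kernel[OF m, of UNIV] ce by (auto simp: primitive_on_def)
      from has_integral_mult_left[OF this, of r] show ?thesis
        by (simp add: k_def split n_def left_diff_distrib)
    qed
    \<comment> \<open>The primitive is stated with the gauge integral, Fubini with the Lebesgue
      integral; boundedness makes the two agree.\<close>
    moreover have "set_integrable lborel {c..e} (\<lambda>t. k t z)"
      unfolding set_integrable_def
    proof (rule integrableI_bounded_set[of "{c..e}"])
      show "(\<lambda>t. indicator {c..e} t *\<^sub>R k t z) \<in> borel_measurable lborel"
        using k_sec[OF z] by measurable
      show "AE t in lborel. t \<in> {c..e} \<longrightarrow> norm (indicator {c..e} t *\<^sub>R k t z) \<le> C"
        using k_le by auto
    qed (use ce in auto)
    from set_borel_integral_eq_integral(2)[OF this]
    have "(\<integral>t. indicator {c..e} t * k t z \<partial>lborel) = integral {c..e} (\<lambda>t. k t z)"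
      by (simp add: set_lebesgue_integral_def)
    ultimately show "(\<integral>t. indicator {c..e} t * k t z \<partial>lborel) =
        kern d n \<alpha> (x(i := e)) (snd z) (fst z) - kern d n \<alpha> (x(i := c)) (snd z) (fst z)"
      by (simp add: integral_unique)
  qed
  also have "\<dots> = (\<integral>z. kern d n \<alpha> (x(i := e)) (snd z) (fst z) \<partial>N) - (\<integral>z. kern d n \<alpha> (x(i := c)) (snd z) (fst z) \<partial>N)"
    using cuboid_upd[OF x i] c e by (intro Bochner_Integration.integral_diff representing_integrable)
  finally have eq: "(\<integral>t. \<integral>z. indicator {c..e} t * k t z \<partial>N \<partial>lborel) = \<dots>" .
  have "integrable lborel (\<lambda>t. \<integral>z. indicator {c..e} t * k t z \<partial>N)"
    using P.integrable_fst'[OF joint] by simp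
  then have si: "set_integrable lborel {c..e} (\<lambda>t. \<integral>z. k t z \<partial>N)"
    by (simp add: set_integrable_def)
  from set_borel_integral_eq_integral[OF this] eq
  have "(\<lambda>t. \<integral>z. k t z \<partial>N) integrable_on {c..e}"
    "integral {c..e} (\<lambda>t. \<integral>z. k t z \<partial>N) = (\<integral>z. kern d n \<alpha> (x(i := e)) (snd z) (fst z) \<partial>N) - (\<integral>z. kern d n \<alpha> (x(i := c)) (snd z) (fst z) \<partial>N)"
    by (simp_all add: set_lebesgue_integral_def)
  then show ?thesis unfolding k_def by (simp add: has_integral_iff)
qed

end


section \<open>Raising the order in one coordinate\<close>

lemma kern_unfold:
  "kern d n \<alpha> x b u = (\<Prod>j=1..d. (x j - u j) ^ (n j - 1) / fact (n j - 1) * chi (b j) (\<alpha> j) (x j) (u j))"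
  by (simp add: kern_def kernel_def)

lemma cuboid_box_eq:
  assumes "cuboid d (\<lambda>j. {p j..q j}) \<subseteq> cuboid d I"
  shows "{u \<in> cuboid d I. \<forall>j\<in>{1..d}. p j \<le> u j \<and> u j \<le> q j} = cuboid d (\<lambda>j. {p j..q j :: real})"
proof (intro equalityI subsetI)
  fix u assume "u \<in> {u \<in> cuboid d I. \<forall>j\<in>{1..d}. p j \<le> u j \<and> u j \<le> q j}"
  then show "u \<in> cuboid d (\<lambda>j. {p j..q j})" by (simp add: PiE_iff)
next
  fix u assume u: "u \<in> cuboid d (\<lambda>j. {p j..q j})"
  then have "u \<in> cuboid d I" using assms by blast
  then show "u \<in> {u \<in> cuboid d I. \<forall>j\<in>{1..d}. p j \<le> u j \<and> u j \<le> q j}"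
    using u by (simp add: PiE_iff)
qed

section \<open>From the representation to box convexity, and back from the measure on pairs\<close>

lemma integrable_kern_side:
  assumes \<mu>: "borel_measure_on (cuboid d I) \<mu>" "finite_on_compacts (cuboid d I) \<mu>"
    and I: "\<And>i. i \<in> {1..d} \<Longrightarrow> is_interval (I i)"
    and \<alpha>: "\<alpha> \<in> cuboid d I" and x: "x \<in> cuboid d I"
  shows "integrable \<mu> (\<lambda>u. kern d n \<alpha> x b u)"
proof (rule integrable_kern[where p = "\<lambda>j. min (\<alpha> j) (x j)" and q = "\<lambda>j. max (\<alpha> j) (x j)"])
  have sets: "sets \<mu> = sets (restrict_space borel (cuboid d I))" using \<mu> by (simp add: borel_measure_on_def)
  then have space: "space \<mu> = cuboid d I" by (simp add: sets_eq_imp_space_eq space_restrict_space)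
  show "(\<lambda>u. u j) \<in> borel_measurable \<mu>" for j
    unfolding measurable_cong_sets[OF sets refl] by (rule measurable_coord)
  let ?K = "cuboid d (\<lambda>j. {min (\<alpha> j) (x j)..max (\<alpha> j) (x j)})"
  have sub: "?K \<subseteq> cuboid d I"
  proof (rule PiE_mono)
    fix j assume "j \<in> {1..d}"
    then show "{min (\<alpha> j) (x j)..max (\<alpha> j) (x j)} \<subseteq> I j"
      using I minmax_mem[of "\<alpha> j" "I j" "x j"] \<alpha> x by (intro interval_subset) (auto simp: PiE_iff)
  qed
  have "{u \<in> space \<mu>. \<forall>j\<in>{1..d}. min (\<alpha> j) (x j) \<le> u j \<and> u j \<le> max (\<alpha> j) (x j)} = ?K"
    unfolding space by (rule cuboid_box_eq[OF sub])
  moreover have "emeasure \<mu> ?K < \<infinity>"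
    using \<mu>(2) sub compact_cuboid[of d "\<lambda>j. {min (\<alpha> j) (x j)..max (\<alpha> j) (x j)}"]
    unfolding finite_on_compacts_def by auto
  ultimately show "emeasure \<mu> {u \<in> space \<mu>. \<forall>j\<in>{1..d}. min (\<alpha> j) (x j) \<le> u j \<and> u j \<le> max (\<alpha> j) (x j)} < \<infinity>"
    by simp
qed auto

lemma box_convex_if_representation:
  assumes I: "\<And>i. i \<in> {1..d} \<Longrightarrow> is_interval (I i)"
    and \<alpha>: "\<alpha> \<in> cuboid d I" and n: "\<And>i. i \<in> {1..d} \<Longrightarrow> 1 \<le> n i"
    and W: "pseudo_polynomial d I (\<lambda>i. n i - 1) W"
    and \<mu>: "\<And>b. b \<in> \<B> \<Longrightarrow> borel_measure_on (cuboid d I) (\<mu> b) \<and> finite_on_compacts (cuboid d I) (\<mu> b)"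
    and f: "\<And>x. x \<in> cuboid d I \<Longrightarrow> f x = W x + (\<Sum>b\<in>\<B>. \<integral>u. kern d n \<alpha> x b u \<partial>\<mu> b)"
  shows "box_convex d I n f"
  unfolding box_convex_iff_dd
proof (intro allI impI)
  fix S assume S: "node_family d I n S"
  let ?T = "tensor d (\<lambda>i. dd (S i))"
  note T = fin_functional_tensor_dd[OF S]
  have "?T f = ?T (\<lambda>x. W x + (\<Sum>b\<in>\<B>. \<integral>u. kern d n \<alpha> x b u \<partial>\<mu> b))"
    by (rule fin_functional_cong[OF T f])
  also have "\<dots> = ?T W + (\<Sum>b\<in>\<B>. ?T (\<lambda>x. \<integral>u. kern d n \<alpha> x b u \<partial>\<mu> b))"
    by (simp add: fin_functional_add_fun[OF T] fin_functional_sum_fun[OF T])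
  also have "?T W = 0" using W n S by (rule tensor_dd_pseudo_polynomial)
  also have "(\<Sum>b\<in>\<B>. ?T (\<lambda>x. \<integral>u. kern d n \<alpha> x b u \<partial>\<mu> b)) =
      (\<Sum>b\<in>\<B>. \<integral>u. ?T (\<lambda>x. kern d n \<alpha> x b u) \<partial>\<mu> b)"
    using \<mu> I \<alpha> by (intro sum.cong fin_functional_integral(2)[OF T] integrable_kern_side) auto
  finally show "0 \<le> ?T f"
    using tensor_dd_kern_nonneg[OF S n]
    by (simp add: sum_nonneg Bochner_Integration.integral_nonneg)
qed

text \<open>Agreement is demanded of divided differences only, so no pseudo-polynomial has to be
  carried through the induction on the orders.\<close>

definition represented_by ::
  "nat \<Rightarrow> (nat \<Rightarrow> real set) \<Rightarrow> (nat \<Rightarrow> nat) \<Rightarrow> (nat \<Rightarrow> real) \<Rightarrow> ((nat \<Rightarrow> real) \<Rightarrow> real) \<Rightarrow>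
    ((nat \<Rightarrow> real) \<times> (nat \<Rightarrow> side)) measure \<Rightarrow> bool" where
  "represented_by d I n \<alpha> f N \<longleftrightarrow> representing d I N \<and>
    (\<forall>S. node_family d I n S \<longrightarrow> tensor d (\<lambda>i. dd (S i)) f =
      tensor d (\<lambda>i. dd (S i)) (\<lambda>x. \<integral>z. kern d n \<alpha> x (snd z) (fst z) \<partial>N))"

text \<open>In the coordinates with \<open>n i \<ge> 2\<close> the two kernels differ by a polynomial, so the side can be
  changed to \<open>R\<close> there.\<close>

definition merge_sides :: "nat \<Rightarrow> (nat \<Rightarrow> nat) \<Rightarrow> (nat \<Rightarrow> side) \<Rightarrow> nat \<Rightarrow> side" where
  "merge_sides d n b = (\<lambda>j\<in>{1..d}. if 2 \<le> n j then R else b j)"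

lemma merge_sides_mem: "merge_sides d n b \<in> sides d n"
  using UNIV_side by (auto simp: merge_sides_def sides_def)

lemma finite_sides: "finite (sides d n)"
  by (rule finite_subset[of _ "PiE {1..d} (\<lambda>_. {L, R})"]) (auto simp: sides_def intro!: finite_PiE)

text \<open>Split \<open>N\<close> according to the merged sides and project each piece to its first
  component. The remainder \<open>W\<close> has vanishing divided differences, because merging sides
  does not affect those of the kernels.\<close>

lemma representation_if_represented_by:
  assumes I: "\<And>i. i \<in> {1..d} \<Longrightarrow> open (I i) \<and> is_interval (I i)"
    and \<alpha>: "\<alpha> \<in> cuboid d I" and n: "\<And>i. i \<in> {1..d} \<Longrightarrow> 1 \<le> n i"
    and N: "represented_by d I n \<alpha> f N"
  shows "\<exists>W \<mu>. pseudo_polynomial d I (\<lambda>i. n i - 1) W \<and>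
    (\<forall>b\<in>sides d n. borel_measure_on (cuboid d I) (\<mu> b) \<and> finite_on_compacts (cuboid d I) (\<mu> b) \<and>
      (\<forall>i\<in>{1..d}. b i = L \<longrightarrow> discrete_measure (marginal i (\<mu> b)))) \<and>
    (\<forall>x\<in>cuboid d I. f x = W x + (\<Sum>b\<in>sides d n. \<integral>u. kern d n \<alpha> x b u \<partial>\<mu> b))"
proof -
  have rep: "representing d I N" using N by (simp add: represented_by_def)
  note N' = representing_sets[OF rep]
  let ?C = "restrict_space borel (cuboid d I) :: (nat \<Rightarrow> real) measure"
  define A where "A b = {z\<in>space N. merge_sides d n (snd z) = b}" for b
  define \<mu> where "\<mu> b = distr (restrict_space N (A b)) ?C fst" for b
  have A: "A b \<in> sets N" for b unfolding A_def by (rule sets_snd_representing[OF N'])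
  have A': "A b \<inter> space N = A b" "A b \<subseteq> space N" for b by (auto simp: A_def)
  have A'': "A b \<inter> space N \<in> sets N" for b using A A' by simp
  have fst: "fst \<in> measurable (restrict_space N (A b)) ?C" for b
    by (intro measurable_restrict_space1 measurable_fst_representing[OF N'])
  have space: "space (restrict_space N (A b)) = A b" for b
    by (simp add: space_restrict_space A')
  have borel: "borel_measure_on (cuboid d I) (\<mu> b)" for b
    by (simp add: borel_measure_on_def \<mu>_def)
  have finite: "finite_on_compacts (cuboid d I) (\<mu> b)" for b
    unfolding finite_on_compacts_def
  proof (intro allI impI, elim conjE)
    fix K :: "(nat \<Rightarrow> real) set" assume K: "compact K" "K \<subseteq> cuboid d I"
    have Ks: "K \<in> sets ?C"
      using K compact_imp_closed[OF K(1)] by (auto simp: sets_restrict_space image_iff intro!: bexI[of _ K])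
    have Ks': "K \<times> side_families d \<in> sets N"
      unfolding N' pair_space_def using Ks by (intro pair_measureI) auto
    have "emeasure (\<mu> b) K = emeasure N (fst -` K \<inter> A b)"
      unfolding \<mu>_def emeasure_distr[OF fst Ks] space
      by (rule emeasure_restrict_space[OF A'']) auto
    also have "\<dots> \<le> emeasure N (K \<times> side_families d)"
    proof (rule emeasure_mono[OF _ Ks'], rule subsetI)
      fix z assume z: "z \<in> fst -` K \<inter> A b"
      then have "z \<in> cuboid d I \<times> side_families d"
        using A'(2) unfolding space_representing[OF N'] by blast
      then show "z \<in> K \<times> side_families d" using z by (simp add: mem_Times_iff)
    qed
    also have "\<dots> < \<infinity>" using rep K by (auto simp: representing_def)
    finally show "emeasure (\<mu> b) K < \<infinity>" .
  qed
  have discrete: "discrete_measure (marginal i (\<mu> b))" if i: "i \<in> {1..d}" and b: "b i = L" for i b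
  proof -
    obtain C where C: "countable C" "AE z in N. snd z i = L \<longrightarrow> fst z i \<in> C"
      using rep i unfolding representing_def by blast
    have coord: "(\<lambda>u. u i) \<in> borel_measurable (\<mu> b)"
      unfolding \<mu>_def by (simp add: measurable_coord)
    have Cb: "C \<in> sets borel" by (rule sets.countable[OF _ C(1)]) simp
    have "AE z in restrict_space N (A b). fst z i \<in> C"
      unfolding AE_restrict_space_iff[OF A'']
      using C(2)
    \<comment> \<open>A merged side is \<open>L\<close> only where the original side is
      \<open>L\<close>, so the countable set for \<open>N\<close> still works.\<close>
    proof eventually_elim
      case (elim z)
      then show ?case using i b by (auto simp: A_def merge_sides_def split: if_splits)
    qed
    then have "AE u in \<mu> b. u i \<in> C"
      unfolding \<mu>_def
    proof (subst AE_distr_iff[OF fst])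
      have "{u \<in> space ?C. u i \<in> C} = (\<lambda>u. u i) -` C \<inter> space ?C" by auto
      then show "{u \<in> space ?C. u i \<in> C} \<in> sets ?C"
        using measurable_sets[OF measurable_coord Cb] by simp
    qed auto
    then have "AE t in marginal i (\<mu> b). t \<in> C"
      unfolding marginal_def by (subst AE_distr_iff[OF coord]) (use Cb in auto)
    then show ?thesis using C(1) by (auto simp: discrete_measure_def)
  qed
  have kint: "integrable N (\<lambda>z. kern d n \<alpha> x (merge_sides d n (snd z)) (fst z))"
    and split: "(\<Sum>b\<in>sides d n. \<integral>u. kern d n \<alpha> x b u \<partial>\<mu> b) =
      (\<integral>z. kern d n \<alpha> x (merge_sides d n (snd z)) (fst z) \<partial>N)"
    if x: "x \<in> cuboid d I" for x
  proof -
    have meas: "(\<lambda>u. kern d n \<alpha> x b u) \<in> borel_measurable ?C" for b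
      by (intro measurable_kern) (auto intro: measurable_coord)
    have int: "integrable N (\<lambda>z. indicator (A b) z *\<^sub>R kern d n \<alpha> x b (fst z))"
      and eq: "(\<integral>u. kern d n \<alpha> x b u \<partial>\<mu> b) = (\<integral>z. indicator (A b) z *\<^sub>R kern d n \<alpha> x b (fst z) \<partial>N)" for b
    proof -
      have "integrable (\<mu> b) (\<lambda>u. kern d n \<alpha> x b u)"
        using I by (intro integrable_kern_side[OF borel finite _ \<alpha> x]) auto
      then have "integrable (restrict_space N (A b)) (\<lambda>z. kern d n \<alpha> x b (fst z))"
        unfolding \<mu>_def by (subst (asm) integrable_distr_eq[OF fst meas])
      then show "integrable N (\<lambda>z. indicator (A b) z *\<^sub>R kern d n \<alpha> x b (fst z))"
        by (subst (asm) integrable_restrict_space[OF A''])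
      show "(\<integral>u. kern d n \<alpha> x b u \<partial>\<mu> b) = (\<integral>z. indicator (A b) z *\<^sub>R kern d n \<alpha> x b (fst z) \<partial>N)"
        unfolding \<mu>_def integral_distr[OF fst meas] by (rule integral_restrict_space[OF A''])
    qed
    have sum: "(\<Sum>b\<in>sides d n. indicator (A b) z *\<^sub>R kern d n \<alpha> x b (fst z)) =
        kern d n \<alpha> x (merge_sides d n (snd z)) (fst z)" if z: "z \<in> space N" for z
    proof -
      have "(\<Sum>b\<in>sides d n. indicator (A b) z *\<^sub>R kern d n \<alpha> x b (fst z)) =
          (\<Sum>b\<in>sides d n. if merge_sides d n (snd z) = b then kern d n \<alpha> x b (fst z) else 0)"
        using z by (intro sum.cong) (auto simp: A_def)
      then show ?thesis by (simp add: finite_sides merge_sides_mem)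
    qed
    have "integrable N (\<lambda>z. \<Sum>b\<in>sides d n. indicator (A b) z *\<^sub>R kern d n \<alpha> x b (fst z))"
      using int by (intro Bochner_Integration.integrable_sum)
    then show "integrable N (\<lambda>z. kern d n \<alpha> x (merge_sides d n (snd z)) (fst z))"
      by (subst (asm) Bochner_Integration.integrable_cong[OF refl sum])
    have "(\<Sum>b\<in>sides d n. \<integral>u. kern d n \<alpha> x b u \<partial>\<mu> b) =
        (\<integral>z. (\<Sum>b\<in>sides d n. indicator (A b) z *\<^sub>R kern d n \<alpha> x b (fst z)) \<partial>N)"
      unfolding eq using int by (intro Bochner_Integration.integral_sum[symmetric])
    also have "\<dots> = (\<integral>z. kern d n \<alpha> x (merge_sides d n (snd z)) (fst z) \<partial>N)"
      by (intro Bochner_Integration.integral_cong refl sum)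
    finally show "(\<Sum>b\<in>sides d n. \<integral>u. kern d n \<alpha> x b u \<partial>\<mu> b) =
      (\<integral>z. kern d n \<alpha> x (merge_sides d n (snd z)) (fst z) \<partial>N)" .
  qed
  define W where "W x = f x - (\<integral>z. kern d n \<alpha> x (merge_sides d n (snd z)) (fst z) \<partial>N)" for x
  have "pseudo_polynomial d I (\<lambda>i. n i - 1) W"
  proof (rule pseudo_polynomialI_dd)
    fix S assume S: "node_family d I n S"
    let ?T = "tensor d (\<lambda>i. dd (S i))"
    note T = fin_functional_tensor_dd[OF S]
    have "?T (\<lambda>x. \<integral>z. kern d n \<alpha> x (merge_sides d n (snd z)) (fst z) \<partial>N) =
        (\<integral>z. ?T (\<lambda>x. kern d n \<alpha> x (merge_sides d n (snd z)) (fst z)) \<partial>N)"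
      by (rule fin_functional_integral(2)[OF T kint])
    also have "\<dots> = (\<integral>z. ?T (\<lambda>x. kern d n \<alpha> x (snd z) (fst z)) \<partial>N)"
      by (intro Bochner_Integration.integral_cong refl tensor_dd_kern_side[OF S])
        (auto simp: merge_sides_def)
    also have "\<dots> = ?T (\<lambda>x. \<integral>z. kern d n \<alpha> x (snd z) (fst z) \<partial>N)"
      by (rule representing_tensor[OF rep I \<alpha> S, symmetric])
    also have "\<dots> = ?T f" using N S by (simp add: represented_by_def)
    finally show "?T W = 0" by (simp add: W_def[abs_def] fin_functional_diff_fun[OF T])
  qed (use I \<alpha> n in auto)
  then show ?thesis
    using borel finite discrete split by (intro exI[of _ W] exI[of _ \<mu>]) (auto simp: W_def)
qed

text \<open>The measure for \<open>f\<close> is the one that the hypothesis \<open>IH\<close> yields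
  for the derivative \<open>F\<close>: raising the order of the kernel in coordinate
  \<open>i\<close> amounts to integrating in that coordinate.\<close>

lemma represented_by_Suc:
  assumes I: "\<And>i. i \<in> {1..d} \<Longrightarrow> open (I i) \<and> is_interval (I i)"
    and \<alpha>: "\<alpha> \<in> cuboid d I" and i: "i \<in> {1..d}" and m: "1 \<le> m i"
    and IH: "\<And>F. box_convex d I m F \<Longrightarrow> \<exists>N. represented_by d I m \<alpha> F N"
    and f: "box_convex d I (m(i := Suc (m i))) f"
  shows "\<exists>N. represented_by d I (m(i := Suc (m i))) \<alpha> f N"
proof -
  define n where "n = m(i := Suc (m i))"
  have ni: "n i = Suc (m i)" and nj: "\<And>j. j \<noteq> i \<Longrightarrow> n j = m j" by (auto simp: n_def)
  note f = f[folded n_def]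
  have "\<exists>T. finite T \<and> card T = n j \<and> T \<subseteq> I j" if "j \<in> {1..d}" for j
  proof -
    have "I j \<noteq> {}" using \<alpha> that by auto
    then show ?thesis using infinite_arbitrarily_large[OF infinite_open_real] I[OF that] by metis
  qed
  then obtain T where T: "\<And>j. j \<in> {1..d} \<Longrightarrow> finite (T j) \<and> card (T j) = n j \<and> T j \<subseteq> I j"
    by metis
  \<comment> \<open>Coordinate \<open>i\<close> is left alone, since it will be differentiated; the
    interpolation error in the others discards the part of \<open>f\<close> about which nothing is
    known.\<close>
  define M where "M j t = (if j = i then (\<lambda>\<phi>. \<phi> t) else interp_error (T j) t)" for j and t :: real
  define g where "g x = tensor d (\<lambda>j. M j (x j)) f" for x
  have finM: "fin_functional (I j) (M j t)" if "j \<in> {1..d}" "t \<in> I j" for j t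
    unfolding M_def using T[OF that(1)] that
    by (auto intro!: fin_functional_interp_error fin_functional.eval)
  have nodes_upd: "(\<lambda>j. dd (S j))(i := dd P) = (\<lambda>j. dd ((S(i := P)) j))" for S :: "nat \<Rightarrow> real set" and P
    by auto
  have family_upd: "node_family d I n' (S(i := P))"
    if "node_family d I n'' S" "\<And>j. j \<noteq> i \<Longrightarrow> n' j = n'' j" "P \<subseteq> I i" "card P = Suc (n' i)" for n' n'' S P
    using that by (auto simp: node_family_def)
  \<comment> \<open>In each coordinate other than \<open>i\<close> the interpolating polynomial has
    degree below \<open>n j\<close> and is invisible to \<open>dd (S j)\<close>.\<close>
  have Tg: "tensor d (\<lambda>j. dd (S j)) g = tensor d (\<lambda>j. dd (S j)) f" if S: "node_family d I n S" for S
  proof -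
    have "tensor d (\<lambda>j. dd (S j)) g = tensor d (\<lambda>j \<phi>. dd (S j) (\<lambda>t. M j t \<phi>)) f"
      unfolding g_def by (rule tensor_compose[OF node_familyD(4)[OF S] finM])
    also have "\<dots> = tensor d (\<lambda>j. dd (S j)) f"
    proof (rule tensor_cong_functional)
      fix j assume j: "j \<in> {1..d}"
      show "(\<lambda>\<phi>. dd (S j) (\<lambda>t. M j t \<phi>)) = dd (S j)"
        using T[OF j] node_familyD[OF S j] by (cases "j = i") (auto simp: M_def fun_eq_iff dd_interp_error)
    qed
    finally show ?thesis .
  qed
  have dd_at_i: "dd P (\<lambda>t. tensor d ((\<lambda>j. dd (S j))(i := (\<lambda>\<phi>. \<phi> t))) h) = tensor d (\<lambda>j. dd ((S(i := P)) j)) h"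
    if S: "node_family d I n' S" and P: "P \<subseteq> I i" "card P = Suc k" for n' S P k h
  proof -
    have "fin_functional (I j) (((\<lambda>j. dd (S j))(i := dd P)) j)" if "j \<in> {1..d}" for j
      using node_familyD(4)[OF S that] fin_functional_ddI[OF P(2,1)] by auto
    from tensor_extract[where \<Lambda> = "(\<lambda>j. dd (S j))(i := dd P)" and I = I and f = h, OF this i]
    show ?thesis unfolding nodes_upd[symmetric] by (simp only: fun_upd_upd fun_upd_same)
  qed
  have conv: "n_convex (n i) (I i) (\<lambda>t. tensor d ((\<lambda>j. dd (S j))(i := (\<lambda>\<phi>. \<phi> t))) f)"
    if S: "node_family d I n' S" and "\<And>j. j \<noteq> i \<Longrightarrow> n j = n' j" for n' S
    unfolding n_convex_def
  proof (intro allI impI, elim conjE)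
    fix P assume P: "P \<subseteq> I i" "card P = Suc (n i)"
    have "node_family d I n (S(i := P))" using that(2) P by (intro family_upd[OF S])
    then show "0 \<le> dd P (\<lambda>t. tensor d ((\<lambda>j. dd (S j))(i := (\<lambda>\<phi>. \<phi> t))) f)"
      unfolding dd_at_i[OF S P] using f unfolding box_convex_iff_dd by blast
  qed
  define F where "F x = right_deriv (\<lambda>s. g (x(i := s))) (x i)" for x
  have along_i: "right_primitive_on (I i) (\<lambda>t. g (x(i := t))) (\<lambda>t. F (x(i := t)))"
    if x: "x \<in> cuboid d I" for x
  proof -
    have F: "F (x(i := t)) = right_deriv (\<lambda>s. g (x(i := s))) t" for t by (simp add: F_def)
    have g_sec: "g (x(i := t)) = tensor d (\<lambda>j. if j = i then (\<lambda>\<phi>. \<phi> t) else interp_error (T j) (x j)) f" for t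
      unfolding g_def by (rule tensor_cong_functional) (auto simp: M_def)
    have fin: "fin_functional UNIV ((if j = i then (\<lambda>\<phi>. \<phi> t) else interp_error (T j) (x j)))"
      if "j \<in> {1..d}" for j t
      using T[OF that] by (auto intro!: fin_functional_interp_error fin_functional.eval)
    have "\<exists>c \<phi>. (\<forall>t. g (x(i := t)) = c * \<phi> t) \<and> right_primitive_on (I i) \<phi> (right_deriv \<phi>)"
    \<comment> \<open>If another coordinate of \<open>x\<close> is an interpolation node, the
      section is zero. Otherwise Newton's remainder turns every error into a multiple of a divided
      difference, and the section is a constant times a convex function of order
      \<open>n i\<close>.\<close>
    proof (cases "\<exists>j\<in>{1..d}. j \<noteq> i \<and> x j \<in> T j")
      case True
      then obtain j where j: "j \<in> {1..d}" "j \<noteq> i" "x j \<in> T j" by auto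
      have 0: "(if j = i then (\<lambda>\<phi>. \<phi> t) else interp_error (T j) (x j)) = (\<lambda>\<phi>. 0)" for t
        using j T[OF j(1)] by (auto simp: interp_error_node fun_eq_iff)
      have "g (x(i := t)) = 0" for t
        unfolding g_sec
        using tensor_zero_functional[where I = "\<lambda>_. UNIV" and f = f
            and \<Lambda> = "\<lambda>j. if j = i then (\<lambda>\<phi>. \<phi> t) else interp_error (T j) (x j)", OF fin j(1) 0]
        by simp
      moreover have "right_primitive_on (I i) (\<lambda>_. 0) (right_deriv (\<lambda>_. 0))"
        using I[OF i] by (intro n_convex_right_primitive[of 2]) (auto simp: n_convex_def dd_def)
      ultimately show ?thesis by (intro exI[of _ 0] exI[of _ "\<lambda>_. 0"]) auto
    next
      case False
      obtain P where P: "finite P" "card P = Suc (n i)" "P \<subseteq> I i"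
        using infinite_arbitrarily_large[OF infinite_open_real, of "I i"] I[OF i] \<alpha> i by blast
      define S where "S j = (if j = i then P else insert (x j) (T j))" for j
      have S: "node_family d I n S"
        using False T x P by (auto simp: node_family_def S_def PiE_iff)
      define c where "c j = (if j = i then 1 else \<Prod>q\<in>T j. x j - q)" for j
      have "g (x(i := t)) = (\<Prod>j=1..d. c j) * tensor d ((\<lambda>j. dd (S j))(i := (\<lambda>\<phi>. \<phi> t))) f" for t
      proof -
        have "g (x(i := t)) = tensor d (\<lambda>j \<phi>. c j * ((\<lambda>j. dd (S j))(i := (\<lambda>\<phi>. \<phi> t))) j \<phi>) f"
          unfolding g_sec
        proof (rule tensor_cong_functional)
          fix j assume "j \<in> {1..d}"
          then show "(if j = i then \<lambda>\<phi>. \<phi> t else interp_error (T j) (x j)) =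
              (\<lambda>\<phi>. c j * ((\<lambda>j. dd (S j))(i := (\<lambda>\<phi>. \<phi> t))) j \<phi>)"
            using False T by (auto simp: c_def S_def interp_error_eq_dd fun_eq_iff)
        qed
        also have "\<dots> = (\<Prod>j=1..d. c j) * tensor d ((\<lambda>j. dd (S j))(i := (\<lambda>\<phi>. \<phi> t))) f"
        proof (rule tensor_scale[where I = "\<lambda>_. UNIV"])
          fix j assume "j \<in> {1..d}"
          then show "fin_functional UNIV (((\<lambda>j. dd (S j))(i := (\<lambda>\<phi>. \<phi> t))) j)"
            using node_familyD(3)[OF S] by (auto intro!: fin_functional_dd fin_functional.eval)
        qed
        finally show ?thesis .
      qed
      moreover have "2 \<le> n i" using m ni by simp
      ultimately show ?thesis
        using n_convex_right_primitive[OF _ conv[OF S]] I[OF i]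
        by (intro exI[of _ "\<Prod>j=1..d. c j"] exI[of _ "\<lambda>t. tensor d ((\<lambda>j. dd (S j))(i := (\<lambda>\<phi>. \<phi> t))) f"]) auto
    qed
    then obtain c \<phi> where g: "(\<lambda>t. g (x(i := t))) = (\<lambda>t. c * \<phi> t)"
        and \<phi>: "right_primitive_on (I i) \<phi> (right_deriv \<phi>)" by (auto simp: fun_eq_iff)
    note c\<phi> = right_primitive_on_scale[OF \<phi>, of c]
    show ?thesis
      unfolding F g
      using right_primitive_on_cong[OF c\<phi>] I[OF i] right_primitive_on_right_deriv[OF c\<phi>] by simp
  qed
  have shift: "tensor d ((\<lambda>j. dd (S j))(i := (\<lambda>\<phi>. \<phi> t))) h =
      tensor d ((\<lambda>j. dd (S j))(i := (\<lambda>\<phi>. \<phi> (\<alpha> i)))) (\<lambda>x. h (x(i := t)))"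
    for S :: "nat \<Rightarrow> real set" and t h
    by (rule tensor_eval_shift[OF i])
  have finS: "fin_functional (cuboid d I) (tensor d ((\<lambda>j. dd (S j))(i := (\<lambda>\<phi>. \<phi> (\<alpha> i)))))"
    if "node_family d I n' S" for n' S
    using node_familyD(4)[OF that] \<alpha> i by (intro fin_functional_tensor) (auto intro!: fin_functional.eval)
  have self: "S(i := S i) = S" for S :: "nat \<Rightarrow> real set" by simp
  have "box_convex d I m F"
    unfolding box_convex_iff_dd
  proof (intro allI impI)
    fix S assume S: "node_family d I m S"
    note Tfin = finS[OF S]
    let ?\<phi> = "\<lambda>h t. tensor d ((\<lambda>j. dd (S j))(i := (\<lambda>\<phi>. \<phi> t))) h"
    \<comment> \<open>With divided differences in the other coordinates held fixed, \<open>g\<close>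
      inherits convexity of order \<open>Suc (m i)\<close> in coordinate \<open>i\<close> from
      \<open>f\<close>. Its right derivative is then convex of order \<open>m i\<close>.\<close>
    have "n_convex (Suc (m i)) (I i) (?\<phi> g)"
      unfolding n_convex_def
    proof (intro allI impI, elim conjE)
      fix P assume P: "P \<subseteq> I i" "card P = Suc (Suc (m i))"
      then have "node_family d I n (S(i := P))"
        using S nj ni by (intro family_upd[OF S]) auto
      from Tg[OF this] f this show "0 \<le> dd P (?\<phi> g)"
        unfolding dd_at_i[OF S P] box_convex_iff_dd by metis
    qed
    then have "n_convex (m i) (I i) (?\<phi> F)"
    proof (rule n_convex_deriv)
      fix t assume t: "t \<in> I i"
      have "((\<lambda>h. tensor d ((\<lambda>j. dd (S j))(i := (\<lambda>\<phi>. \<phi> (\<alpha> i)))) (\<lambda>x. (g (x(i := t + h)) - g (x(i := t))) / h)) \<longlongrightarrow> ?\<phi> F t) (at_right 0)"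
        unfolding shift[of S t F]
        using along_i t by (intro fin_functional_tendsto[OF Tfin]) (auto simp: right_primitive_on_def)
      moreover have "tensor d ((\<lambda>j. dd (S j))(i := (\<lambda>\<phi>. \<phi> (\<alpha> i)))) (\<lambda>x. (g (x(i := t + h)) - g (x(i := t))) / h) =
          (?\<phi> g (t + h) - ?\<phi> g t) / h" for h
        unfolding shift[of S t g] shift[of S "t + h" g] divide_inverse
        by (simp add: fin_functional_scale_fun_right[OF Tfin] fin_functional_diff_fun[OF Tfin])
      ultimately show "((\<lambda>h. (?\<phi> g (t + h) - ?\<phi> g t) / h) \<longlongrightarrow> ?\<phi> F t) (at_right 0)" by simp
    qed (use I[OF i] in auto)
    then have "0 \<le> dd (S i) (?\<phi> F)"
      using node_familyD[OF S i] by (auto simp: n_convex_def)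
    then show "0 \<le> tensor d (\<lambda>i. dd (S i)) F"
      unfolding dd_at_i[OF S node_familyD(1,2)[OF S i]] self .
  qed
  then obtain N where N: "represented_by d I m \<alpha> F N" using IH by blast
  then have rep: "representing d I N" by (simp add: represented_by_def)
  define K where "K n' x = (\<integral>z. kern d n' \<alpha> x (snd z) (fst z) \<partial>N)" for n' x
  have "tensor d (\<lambda>j. dd (S j)) f = tensor d (\<lambda>j. dd (S j)) (K n)" if S: "node_family d I n S" for S
  proof -
    note Tfin = finS[OF S]
    let ?T = "tensor d ((\<lambda>j. dd (S j))(i := (\<lambda>\<phi>. \<phi> (\<alpha> i))))"
    let ?\<phi> = "\<lambda>h t. tensor d ((\<lambda>j. dd (S j))(i := (\<lambda>\<phi>. \<phi> t))) h"
    let ?D = "\<lambda>x. g x - K n x" and ?h = "\<lambda>x. F x - K m x"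
    \<comment> \<open>The defect \<open>?D\<close> of the integrated representation is, along
      coordinate \<open>i\<close>, a primitive of the defect \<open>?h\<close> for \<open>F\<close>.
      The latter has vanishing divided differences of order \<open>m\<close>, so
      \<open>dd_primitive_eq_0\<close> settles order \<open>n\<close>.\<close>
    have "primitive_on (I i) (?\<phi> ?D) (?\<phi> ?h)"
      unfolding primitive_on_def
    proof (intro ballI impI)
      fix c e assume ce: "c \<in> I i" "e \<in> I i" "c \<le> e"
      have "((\<lambda>t. ?T (\<lambda>x. ?h (x(i := t)))) has_integral ?T (\<lambda>x. ?D (x(i := e)) - ?D (x(i := c)))) {c..e}"
      proof (rule fin_functional_has_integral[OF Tfin])
        fix x assume x: "x \<in> cuboid d I"
        have "((\<lambda>t. F (x(i := t))) has_integral g (x(i := e)) - g (x(i := c))) {c..e}"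
          using along_i[OF x] ce by (auto simp: right_primitive_on_def primitive_on_def)
        moreover have "((\<lambda>t. K m (x(i := t))) has_integral K n (x(i := e)) - K n (x(i := c))) {c..e}"
          unfolding K_def n_def by (rule representing_has_integral[where m = m and I = I, OF rep I \<alpha> x i m ce])
        ultimately have "((\<lambda>t. F (x(i := t)) - K m (x(i := t))) has_integral
          (g (x(i := e)) - g (x(i := c))) - (K n (x(i := e)) - K n (x(i := c)))) {c..e}"
          by (rule has_integral_diff)
        then show "((\<lambda>t. ?h (x(i := t))) has_integral ?D (x(i := e)) - ?D (x(i := c))) {c..e}"
          by (simp add: algebra_simps)
      qed
      then show "(?\<phi> ?h has_integral ?\<phi> ?D e - ?\<phi> ?D c) {c..e}"
        unfolding shift[of S _ ?h] shift[of S _ ?D] fin_functional_diff_fun[OF Tfin] .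
    qed
    then have "dd (S i) (?\<phi> ?D) = 0"
    proof (rule dd_primitive_eq_0)
      fix P assume P: "P \<subseteq> I i" "card P = Suc (m i)"
      have P': "node_family d I m (S(i := P))" using P nj by (intro family_upd[OF S]) auto
      show "dd P (?\<phi> ?h) = 0"
        unfolding dd_at_i[OF S P] fin_functional_diff_fun[OF fin_functional_tensor_dd[OF P']]
        using N P' by (auto simp: represented_by_def K_def[abs_def])
    qed (use I[OF i] node_familyD[OF S i] ni in auto)
    then have "tensor d (\<lambda>j. dd (S j)) ?D = 0"
      unfolding dd_at_i[OF S node_familyD(1,2)[OF S i]] self .
    then show ?thesis
      using Tg[OF S] by (simp add: fin_functional_diff_fun[OF fin_functional_tensor_dd[OF S]])
  qed
  then have "represented_by d I n \<alpha> f N"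
    using rep by (auto simp: represented_by_def K_def[abs_def])
  then show ?thesis unfolding n_def by blast
qed

text \<open>Induction on the sum of the orders. The order-one case stays a hypothesis, as its
  measures are built from cuts below.\<close>

lemma represented_by_if_box_convex:
  assumes I: "\<And>i. i \<in> {1..d} \<Longrightarrow> open (I i) \<and> is_interval (I i)"
    and \<alpha>: "\<alpha> \<in> cuboid d I"
    and base: "\<And>n f. (\<And>i. i \<in> {1..d} \<Longrightarrow> n i = 1) \<Longrightarrow> box_convex d I n f \<Longrightarrow> \<exists>N. represented_by d I n \<alpha> f N"
    and n: "\<And>i. i \<in> {1..d} \<Longrightarrow> 1 \<le> n i" and f: "box_convex d I n f"
  shows "\<exists>N. represented_by d I n \<alpha> f N"
  using n f
proof (induction "\<Sum>i=1..d. n i" arbitrary: n f rule: less_induct)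
  case less
  show ?case
  proof (cases "\<forall>i\<in>{1..d}. n i = 1")
    case True
    then show ?thesis using base less.prems by blast
  next
    case False
    then obtain i where i: "i \<in> {1..d}" "n i \<noteq> 1" by auto
    define m where "m = n(i := n i - 1)"
    have mi: "Suc (m i) = n i" "1 \<le> m i" using less.prems(1)[OF i(1)] i by (auto simp: m_def)
    have n: "n = m(i := Suc (m i))" unfolding mi by (auto simp: m_def)
    have lt: "(\<Sum>j=1..d. m j) < (\<Sum>j=1..d. n j)"
      using i less.prems(1)[OF i(1)] by (intro sum_strict_mono_ex1) (auto simp: m_def)
    have m: "1 \<le> m j" if "j \<in> {1..d}" for j
      using less.prems(1)[OF that] mi by (cases "j = i") (auto simp: m_def)
    have "\<exists>N. represented_by d I (m(i := Suc (m i))) \<alpha> f N"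
    proof (rule represented_by_Suc[where m = m and I = I, OF I \<alpha> i(1) mi(2)])
      show "box_convex d I (m(i := Suc (m i))) f" using less.prems(2) by (simp only: n[symmetric])
      fix F assume "box_convex d I m F"
      with lt m show "\<exists>N. represented_by d I m \<alpha> F N" by (rule less.hyps)
    qed
    then show ?thesis by (simp only: n[symmetric])
  qed
qed


section \<open>Measures on cuts\<close>

text \<open>The divided difference of order one without its denominators; it stays meaningful for
  degenerate boxes, where it is zero.\<close>

definition increment :: "nat \<Rightarrow> (nat \<Rightarrow> real) \<Rightarrow> (nat \<Rightarrow> real) \<Rightarrow> ((nat \<Rightarrow> real) \<Rightarrow> real) \<Rightarrow> real" where
  "increment d s t = tensor d (\<lambda>i \<phi>. \<phi> (t i) - \<phi> (s i))"

lemma fin_functional_increment_coord: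
  "s \<in> J \<Longrightarrow> t \<in> J \<Longrightarrow> fin_functional J (\<lambda>\<phi>. \<phi> t - \<phi> s)"
  by (intro fin_functional_diff fin_functional.eval)

lemma fin_functional_increment:
  assumes "\<And>i. i \<in> {1..d} \<Longrightarrow> s i \<in> J i \<and> t i \<in> J i"
  shows "fin_functional (cuboid d J) (increment d s t)"
  unfolding increment_def using assms by (intro fin_functional_tensor fin_functional_increment_coord) auto

lemma increment_cong:
  "(\<And>i. i \<in> {1..d} \<Longrightarrow> s i = s' i \<and> t i = t' i) \<Longrightarrow> increment d s t f = increment d s' t' f"
  unfolding increment_def by (rule tensor_cong_functional) auto

lemma increment_0: "increment 0 s t f = f (\<lambda>_. undefined)"
  by (simp add: increment_def)

lemma increment_Suc:
  "increment (Suc d) s t f =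
    increment d s t (\<lambda>y. f (y(Suc d := t (Suc d))) - f (y(Suc d := s (Suc d))))"
proof -
  have "fin_functional (cuboid d (\<lambda>_. UNIV)) (increment d s t)"
    by (rule fin_functional_increment) auto
  from fin_functional_diff_fun[OF this] show ?thesis unfolding increment_def tensor.simps by simp
qed

lemma increment_eq_0:
  assumes "i \<in> {1..d}" "s i = t i"
  shows "increment d s t f = 0"
  unfolding increment_def
  by (rule tensor_zero_functional[where I = "\<lambda>_. UNIV", OF _ assms(1)])
    (auto intro!: fin_functional_increment_coord simp: assms(2))

text \<open>In every coordinate the base point cancels in \<open>(t - a) - (s - a)\<close>. So the
  distribution function anchored at \<open>a\<close> has the same increments as
  \<open>f\<close>.\<close>

lemma increment_compose: "increment d s t (\<lambda>x. increment d a x f) = increment d s t f"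
proof -
  have "increment d s t (\<lambda>x. increment d a x f) =
      tensor d (\<lambda>i \<phi>. (\<phi> (t i) - \<phi> (a i)) - (\<phi> (s i) - \<phi> (a i))) f"
    unfolding increment_def
    by (rule tensor_compose[where I = "\<lambda>_. UNIV" and I' = "\<lambda>_. UNIV" and M = "\<lambda>i t \<phi>. \<phi> t - \<phi> (a i)"])
      (auto intro!: fin_functional_increment_coord)
  then show ?thesis by (simp add: increment_def)
qed

text \<open>A point of \<open>nat \<Rightarrow> real \<Rightarrow> bool\<close> stands for a family of cuts of the real line; \<open>\<omega> i t\<close> says that
  the cut in coordinate \<open>i\<close> lies to the left of \<open>t\<close>.  Unlike points, cuts can separate a value from
  both of its one-sided limits.\<close>

definition left_cuts :: "nat \<Rightarrow> (nat \<Rightarrow> real set) \<Rightarrow> (nat \<Rightarrow> real \<Rightarrow> bool) set" where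
  "left_cuts d T = {\<omega>. \<forall>i\<in>{1..d}. \<forall>t\<in>T i. \<omega> i t}"

definition finite_nodes :: "nat \<Rightarrow> (nat \<Rightarrow> real) \<Rightarrow> (nat \<Rightarrow> real) \<Rightarrow> (nat \<Rightarrow> real set) \<Rightarrow> bool" where
  "finite_nodes d a c T \<longleftrightarrow> (\<forall>i\<in>{1..d}. finite (T i) \<and> T i \<subseteq> {a i..c i})"

text \<open>The generators are stable under intersection, so identities between finite measures can
  be checked on events with finitely many nodes.\<close>

definition cut_space :: "nat \<Rightarrow> (nat \<Rightarrow> real) \<Rightarrow> (nat \<Rightarrow> real) \<Rightarrow> (nat \<Rightarrow> real \<Rightarrow> bool) measure" where
  "cut_space d a c = sigma UNIV (left_cuts d ` Collect (finite_nodes d a c))"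

lemma space_cut_space [simp]: "space (cut_space d a c) = UNIV"
  by (simp add: cut_space_def)

lemma sets_cut_space: "sets (cut_space d a c) = sigma_sets UNIV (left_cuts d ` Collect (finite_nodes d a c))"
  by (simp add: cut_space_def)

lemma left_cuts_in_sets: "finite_nodes d a c T \<Longrightarrow> left_cuts d T \<in> sets (cut_space d a c)"
  unfolding sets_cut_space by (intro sigma_sets.Basic) auto

lemma Int_stable_left_cuts: "Int_stable (left_cuts d ` Collect (finite_nodes d a c))"
proof (rule Int_stableI_image)
  fix T T' assume T: "T \<in> Collect (finite_nodes d a c)" "T' \<in> Collect (finite_nodes d a c)"
  have "left_cuts d T \<inter> left_cuts d T' = left_cuts d (\<lambda>i. T i \<union> T' i)"
    unfolding left_cuts_def by blast
  moreover have "finite_nodes d a c (\<lambda>i. T i \<union> T' i)"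
    using T unfolding finite_nodes_def by blast
  ultimately show "\<exists>k\<in>Collect (finite_nodes d a c). left_cuts d T \<inter> left_cuts d T' = left_cuts d k"
    by (intro bexI[of _ "\<lambda>i. T i \<union> T' i"]) auto
qed

text \<open>A cut lies to the left of all nodes in \<open>T i\<close> iff it lies to the left of the
  least one. The inserted \<open>c i\<close> covers empty \<open>T i\<close>, for which no condition
  is imposed: the cut then ranges over all of \<open>[a i, c i]\<close>.\<close>

definition cut_measure :: "nat \<Rightarrow> (nat \<Rightarrow> real) \<Rightarrow> (nat \<Rightarrow> real) \<Rightarrow> ((nat \<Rightarrow> real) \<Rightarrow> real) \<Rightarrow>
    (nat \<Rightarrow> real \<Rightarrow> bool) measure \<Rightarrow> bool" where
  "cut_measure d a c f N \<longleftrightarrow> finite_measure N \<and> sets N = sets (cut_space d a c) \<and>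
    (\<forall>T. finite_nodes d a c T \<longrightarrow>
      measure N (left_cuts d T) = increment d a (\<lambda>i. Min (insert (c i) (T i))) f)"

text \<open>Additive on the generators by linearity of increments, hence everywhere by a Dynkin
  argument. It relates measures obtained independently of each other from an existence
  statement.\<close>

lemma cut_measure_add:
  assumes N: "cut_measure d a c f N" "cut_measure d a c g N'" "cut_measure d a c h N''"
    and h: "h = (\<lambda>x. f x + g x)" and E: "E \<in> sets (cut_space d a c)"
  shows "measure N'' E = measure N E + measure N' E"
proof -
  interpret N: finite_measure N using N by (simp add: cut_measure_def)
  interpret N': finite_measure N' using N by (simp add: cut_measure_def)
  interpret N'': finite_measure N'' using N by (simp add: cut_measure_def)
  have s: "sets N = sets (cut_space d a c)" "sets N' = sets (cut_space d a c)" "sets N'' = sets (cut_space d a c)"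
    using N by (auto simp: cut_measure_def)
  then have sp: "space N = UNIV" "space N' = UNIV" "space N'' = UNIV"
    by (auto dest: sets_eq_imp_space_eq)
  let ?G = "left_cuts d ` Collect (finite_nodes d a c)"
  have inc: "fin_functional (cuboid d (\<lambda>_. UNIV)) (increment d a t)" for t
    by (rule fin_functional_increment) auto
  have gen: "measure N'' E = measure N E + measure N' E" if "E \<in> ?G" for E
    using that N by (auto simp: cut_measure_def h fin_functional_add_fun[OF inc])
  have univ: "measure N'' UNIV = measure N UNIV + measure N' UNIV"
  proof (rule gen)
    have "UNIV = left_cuts d (\<lambda>_. {})" by (auto simp: left_cuts_def)
    then show "UNIV \<in> ?G" by (intro image_eqI[of _ _ "\<lambda>_. {}"]) (auto simp: finite_nodes_def)
  qed
  have "E \<in> sigma_sets UNIV ?G" using E by (simp add: sets_cut_space)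
  with Int_stable_left_cuts subset_UNIV[of ?G, folded Pow_UNIV] show ?thesis
  proof (induction rule: sigma_sets_induct_disjoint)
    case (basic A)
    then show ?case by (rule gen)
  next
    case (compl A)
    then have "A \<in> sets N" "A \<in> sets N'" "A \<in> sets N''" by (auto simp: s sets_cut_space)
    then show ?case
      using compl univ N.finite_measure_compl[of A] N'.finite_measure_compl[of A] N''.finite_measure_compl[of A]
      by (simp add: sp)
  next
    case (union A)
    then have A: "range A \<subseteq> sets N" "range A \<subseteq> sets N'" "range A \<subseteq> sets N''" by (auto simp: s sets_cut_space)
    have "(\<lambda>i. measure N (A i) + measure N' (A i)) sums (measure N (\<Union> (range A)) + measure N' (\<Union> (range A)))"
      using union A by (intro sums_add N.finite_measure_UNION N'.finite_measure_UNION)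
    moreover have "(\<lambda>i. measure N'' (A i)) sums measure N'' (\<Union> (range A))"
      using union A by (intro N''.finite_measure_UNION)
    ultimately show ?case using union by (simp add: sums_unique2)
  qed simp
qed

lemma emeasure_unit_interval_le:
  assumes "r \<le> (1::ennreal)"
  shows "emeasure (restrict_space lborel {0..1}) {v \<in> {0..1}. ennreal v \<le> r} = r"
proof -
  obtain x where x: "r = ennreal x" "0 \<le> x" "x \<le> 1"
    using assms by (cases r rule: ennreal_cases) (auto simp: ennreal_le_1 top_unique)
  then have "{v \<in> {0..1}. ennreal v \<le> r} = {0..x}" by auto
  moreover have "emeasure (restrict_space lborel {0..1}) {0..x} = emeasure lborel {0..x}"
    using x by (intro emeasure_restrict_space) auto
  ultimately show ?thesis using x by simp
qed

lemma left_cuts_Suc: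
  "left_cuts (Suc d) T = {\<omega>. \<omega> \<in> left_cuts d T \<and> (\<forall>t\<in>T (Suc d). \<omega> (Suc d) t)}"
proof -
  have "{1..Suc d} = insert (Suc d) {1..d}" by auto
  then show ?thesis by (auto simp: left_cuts_def)
qed

text \<open>The new coordinate is realised as a quantile: \<open>\<rho> t\<close> is the density of the measure with last
  coordinate below \<open>t\<close>, and for uniform \<open>v \<in> [0, 1]\<close> the new cut is to the left of \<open>t\<close> iff \<open>v \<le> \<rho> t\<close>.\<close>

lemma cut_measure_exists:
  assumes ac: "\<And>i. i \<in> {1..d} \<Longrightarrow> a i \<le> c i"
    and f: "\<And>s t. (\<And>i. i \<in> {1..d} \<Longrightarrow> a i \<le> s i \<and> s i \<le> t i \<and> t i \<le> c i) \<Longrightarrow> 0 \<le> increment d s t f"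
  shows "\<exists>N. cut_measure d a c f N"
  using assms
proof (induction d arbitrary: f)
  case 0
  define v where "v = f (\<lambda>_. undefined)"
  have v: "0 \<le> v" using 0(2)[of a a] by (simp add: v_def increment_0)
  \<comment> \<open>No coordinate carries a condition here; any measure of total mass
    \<open>v\<close> will do, and Lebesgue measure on \<open>[0, v]\<close> pushed to one point is
    such.\<close>
  define N where "N = distr (restrict_space lborel {0..v}) (cut_space 0 a c) (\<lambda>_ _ _. True)"
  have meas: "(\<lambda>_ _ _. True) \<in> measurable (restrict_space lborel {0..v}) (cut_space 0 a c)" by simp
  have total: "emeasure N UNIV = ennreal v"
    unfolding N_def using v sets.top[of "cut_space 0 a c"]
    by (subst emeasure_distr[OF meas]) (auto simp: emeasure_restrict_space space_restrict_space)
  have "space N = UNIV" by (simp add: N_def)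
  with total have "finite_measure N" by (intro finite_measureI) simp
  moreover have "measure N (left_cuts 0 T) = increment 0 a t f" for T t
    using total v by (simp add: left_cuts_def increment_0 v_def[symmetric] measure_def)
  ultimately show ?case by (intro exI[of _ N]) (auto simp: cut_measure_def N_def)
next
  case (Suc d)
  define a' c' where "a' = a (Suc d)" and "c' = c (Suc d)"
  have ac': "a' \<le> c'" using Suc.prems(1)[of "Suc d"] by (simp add: a'_def c'_def)
  \<comment> \<open>The difference across the slab between \<open>\<sigma>\<close> and
    \<open>\<tau>\<close> in the last coordinate. Its measure will be the part of the desired
    measure whose last cut falls into the slab.\<close>
  define h where "h \<sigma> \<tau> = (\<lambda>y. f (y(Suc d := \<tau>)) - f (y(Suc d := \<sigma>)))" for \<sigma> \<tau>
  have inc_h: "increment d s t (h \<sigma> \<tau>) = increment (Suc d) (s(Suc d := \<sigma>)) (t(Suc d := \<tau>)) f" for s t \<sigma> \<tau>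
    unfolding increment_Suc h_def by (rule trans[OF increment_cong]) auto
  have "\<exists>N. cut_measure d a c (h \<sigma> \<tau>) N" if "a' \<le> \<sigma>" "\<sigma> \<le> \<tau>" "\<tau> \<le> c'" for \<sigma> \<tau>
  proof (rule Suc.IH)
    show "a i \<le> c i" if "i \<in> {1..d}" for i using Suc.prems(1) that by simp
    fix s t assume st: "\<And>i. i \<in> {1..d} \<Longrightarrow> a i \<le> s i \<and> s i \<le> t i \<and> t i \<le> c i"
    show "0 \<le> increment d s t (h \<sigma> \<tau>)"
      unfolding inc_h
    proof (rule Suc.prems(2))
      fix i assume "i \<in> {1..Suc d}"
      then show "a i \<le> (s(Suc d := \<sigma>)) i \<and> (s(Suc d := \<sigma>)) i \<le> (t(Suc d := \<tau>)) i \<and> (t(Suc d := \<tau>)) i \<le> c i"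
        using st[of i] that by (cases "i = Suc d") (auto simp: a'_def c'_def)
    qed
  qed
  then obtain N where N: "\<And>\<sigma> \<tau>. a' \<le> \<sigma> \<Longrightarrow> \<sigma> \<le> \<tau> \<Longrightarrow> \<tau> \<le> c' \<Longrightarrow> cut_measure d a c (h \<sigma> \<tau>) (N \<sigma> \<tau>)"
    by metis
  \<comment> \<open>The full slab: \<open>Q\<close> is the law of the first \<open>d\<close>
    coordinates.\<close>
  define Q where "Q = N a' c'"
  have Q: "cut_measure d a c (h a' c') Q" using N ac' by (simp add: Q_def)
  interpret Q: finite_measure Q using Q by (simp add: cut_measure_def)
  have sQ: "sets Q = sets (cut_space d a c)" using Q by (simp add: cut_measure_def)
  then have spQ: "space Q = UNIV" by (auto dest: sets_eq_imp_space_eq)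
  have fin: "finite_measure (N \<sigma> \<tau>)" and sN: "sets (N \<sigma> \<tau>) = sets Q" if "a' \<le> \<sigma>" "\<sigma> \<le> \<tau>" "\<tau> \<le> c'" for \<sigma> \<tau>
    using N[OF that] sQ by (auto simp: cut_measure_def)
  have add: "emeasure (N \<sigma> \<upsilon>) E = emeasure (N \<sigma> \<tau>) E + emeasure (N \<tau> \<upsilon>) E"
    if "a' \<le> \<sigma>" "\<sigma> \<le> \<tau>" "\<tau> \<le> \<upsilon>" "\<upsilon> \<le> c'" "E \<in> sets Q" for \<sigma> \<tau> \<upsilon> E
  proof -
    have "measure (N \<sigma> \<upsilon>) E = measure (N \<sigma> \<tau>) E + measure (N \<tau> \<upsilon>) E"
      using that by (intro cut_measure_add[OF N N N]) (auto simp: h_def fun_eq_iff sQ)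
    then show ?thesis
      using fin that by (simp add: finite_measure.emeasure_eq_measure)
  qed
  \<comment> \<open>By additivity every slab measure is dominated by \<open>Q\<close>.\<close>
  have ac_cont: "absolutely_continuous Q (N \<sigma> \<tau>)" if "a' \<le> \<sigma>" "\<sigma> \<le> \<tau>" "\<tau> \<le> c'" for \<sigma> \<tau>
    unfolding absolutely_continuous_def
  proof
    fix E assume "E \<in> null_sets Q"
    then have E: "E \<in> sets Q" "emeasure Q E = 0" by auto
    have "emeasure Q E = emeasure (N a' \<sigma>) E + (emeasure (N \<sigma> \<tau>) E + emeasure (N \<tau> c') E)"
      unfolding Q_def using add[of a' \<sigma> c' E] add[of \<sigma> \<tau> c' E] that E by simp
    then have "emeasure (N \<sigma> \<tau>) E = 0" using E by simp
    then show "E \<in> null_sets (N \<sigma> \<tau>)" using E sN[OF that] by (simp add: null_sets_def)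
  qed
  have "\<exists>\<rho>\<in>borel_measurable Q. density Q \<rho> = N \<sigma> \<tau>" if "a' \<le> \<sigma>" "\<sigma> \<le> \<tau>" "\<tau> \<le> c'" for \<sigma> \<tau>
    using Q.Radon_Nikodym[OF ac_cont[OF that] sN[OF that]] .
  then obtain r where r: "\<And>\<sigma> \<tau>. a' \<le> \<sigma> \<Longrightarrow> \<sigma> \<le> \<tau> \<Longrightarrow> \<tau> \<le> c' \<Longrightarrow>
      r \<sigma> \<tau> \<in> borel_measurable Q \<and> density Q (r \<sigma> \<tau>) = N \<sigma> \<tau>" by metis
  define \<rho> where "\<rho> \<tau> = r a' \<tau>" for \<tau>
  have \<rho>_meas [measurable]: "\<rho> \<tau> \<in> borel_measurable Q" if "\<tau> \<in> {a'..c'}" for \<tau>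
    using r that by (auto simp: \<rho>_def)
  \<comment> \<open>The exceptional set depends on the pair \<open>\<sigma>\<close>,
    \<open>\<tau>\<close>. This suffices because each generating event compares only finitely many
    nodes.\<close>
  have \<rho>_mono: "AE \<omega> in Q. \<rho> \<sigma> \<omega> \<le> \<rho> \<tau> \<omega>" if "a' \<le> \<sigma>" "\<sigma> \<le> \<tau>" "\<tau> \<le> c'" for \<sigma> \<tau>
  proof -
    have [measurable]: "\<rho> \<sigma> \<in> borel_measurable Q" "\<rho> \<tau> \<in> borel_measurable Q" "r \<sigma> \<tau> \<in> borel_measurable Q"
      using r that by (auto simp: \<rho>_def)
    have "density Q (\<rho> \<tau>) = density Q (\<lambda>\<omega>. \<rho> \<sigma> \<omega> + r \<sigma> \<tau> \<omega>)"
    proof (rule measure_eqI)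
      fix E assume "E \<in> sets (density Q (\<rho> \<tau>))"
      then have E [measurable]: "E \<in> sets Q" by simp
      have "emeasure (density Q (\<lambda>\<omega>. \<rho> \<sigma> \<omega> + r \<sigma> \<tau> \<omega>)) E =
          emeasure (density Q (\<rho> \<sigma>)) E + emeasure (density Q (r \<sigma> \<tau>)) E"
        by (simp add: emeasure_density distrib_right nn_integral_add)
      then show "emeasure (density Q (\<rho> \<tau>)) E = emeasure (density Q (\<lambda>\<omega>. \<rho> \<sigma> \<omega> + r \<sigma> \<tau> \<omega>)) E"
        using add[of a' \<sigma> \<tau> E] that E r by (simp add: \<rho>_def)
    qed simp
    then have "AE \<omega> in Q. \<rho> \<tau> \<omega> = \<rho> \<sigma> \<omega> + r \<sigma> \<tau> \<omega>"
      by (subst (asm) Q.density_unique_iff) auto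
    then show ?thesis by eventually_elim auto
  qed
  have \<rho>_1: "AE \<omega> in Q. \<rho> c' \<omega> = 1"
  proof -
    have "density Q (\<rho> c') = density Q (\<lambda>_. 1)"
      using r ac' by (simp add: \<rho>_def Q_def density_1)
    then show ?thesis using \<rho>_meas[of c'] ac' by (subst (asm) Q.density_unique_iff) auto
  qed
  let ?U = "restrict_space lborel {0..1::real}"
  have spU: "space ?U = {0..1}" by (simp add: space_restrict_space)
  have finU: "finite_measure ?U"
    by (rule finite_measureI) (simp add: spU emeasure_restrict_space)
  interpret U: finite_measure ?U by (rule finU)
  interpret P: pair_sigma_finite Q ?U ..
  define X where "X z = (fst z)(Suc d := (\<lambda>t. ennreal (snd z) \<le> \<rho> t (fst z)))" for z
  have X_left: "X z \<in> left_cuts (Suc d) T \<longleftrightarrow>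
      fst z \<in> left_cuts d T \<and> (\<forall>t\<in>T (Suc d). ennreal (snd z) \<le> \<rho> t (fst z))" for z T
    unfolding left_cuts_Suc X_def by (auto simp: left_cuts_def)
  have nodes: "finite_nodes d a c T" "finite (T (Suc d))" "T (Suc d) \<subseteq> {a'..c'}"
    if "finite_nodes (Suc d) a c T" for T
    using that by (auto simp: finite_nodes_def a'_def c'_def)
  have pre: "{z \<in> space (Q \<Otimes>\<^sub>M ?U). X z \<in> left_cuts (Suc d) T} \<in> sets (Q \<Otimes>\<^sub>M ?U)"
    if T: "finite_nodes (Suc d) a c T" for T
  proof -
    have 1: "left_cuts d T \<in> sets Q" using left_cuts_in_sets[OF nodes(1)[OF T]] sQ by simp
    have [measurable]: "(\<lambda>v. ennreal v) \<in> borel_measurable ?U"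
      by (intro measurable_restrict_space1) measurable
    have "{z \<in> space (Q \<Otimes>\<^sub>M ?U). fst z \<in> left_cuts d T} \<in> sets (Q \<Otimes>\<^sub>M ?U)"
      using measurable_sets[OF measurable_fst 1, of ?U] by (simp add: vimage_def Int_def conj_commute)
    moreover have "{z \<in> space (Q \<Otimes>\<^sub>M ?U). \<forall>t\<in>T (Suc d). ennreal (snd z) \<le> \<rho> t (fst z)} \<in> sets (Q \<Otimes>\<^sub>M ?U)"
    proof (rule sets.sets_Collect_finite_All[OF _ nodes(2)[OF T]])
      fix t assume "t \<in> T (Suc d)"
      then have [measurable]: "\<rho> t \<in> borel_measurable Q" using nodes(3)[OF T] by (intro \<rho>_meas) auto
      show "{z \<in> space (Q \<Otimes>\<^sub>M ?U). ennreal (snd z) \<le> \<rho> t (fst z)} \<in> sets (Q \<Otimes>\<^sub>M ?U)" by measurable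
    qed
    ultimately have "{z \<in> space (Q \<Otimes>\<^sub>M ?U). fst z \<in> left_cuts d T} \<inter>
        {z \<in> space (Q \<Otimes>\<^sub>M ?U). \<forall>t\<in>T (Suc d). ennreal (snd z) \<le> \<rho> t (fst z)} \<in> sets (Q \<Otimes>\<^sub>M ?U)"
      by (rule sets.Int)
    then show ?thesis unfolding X_left by (simp add: Int_def conj_ac cong: conj_cong)
  qed
  have X_meas: "X \<in> measurable (Q \<Otimes>\<^sub>M ?U) (cut_space (Suc d) a c)"
    unfolding cut_space_def
  proof (rule measurable_measure_of)
    fix A assume "A \<in> left_cuts (Suc d) ` Collect (finite_nodes (Suc d) a c)"
    then show "X -` A \<inter> space (Q \<Otimes>\<^sub>M ?U) \<in> sets (Q \<Otimes>\<^sub>M ?U)"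
      using pre by (auto simp: vimage_def Int_def conj_commute)
  qed auto
  define M where "M = distr (Q \<Otimes>\<^sub>M ?U) (cut_space (Suc d) a c) X"
  have sM: "sets M = sets (cut_space (Suc d) a c)" and spM: "space M = UNIV" by (auto simp: M_def)
  have M_eq: "emeasure M (left_cuts (Suc d) T) = ennreal (increment (Suc d) a (\<lambda>i. Min (insert (c i) (T i))) f)"
    if T: "finite_nodes (Suc d) a c T" for T
  proof -
    define \<tau> where "\<tau> = Min (insert c' (T (Suc d)))"
    have \<tau>_in: "\<tau> \<in> insert c' (T (Suc d))"
      unfolding \<tau>_def using nodes(2)[OF T] by (intro Min_in) auto
    then have \<tau>: "a' \<le> \<tau>" "\<tau> \<le> c'" using nodes(3)[OF T] ac' by auto
    have \<tau>_le: "\<tau> \<le> t" if "t \<in> T (Suc d)" for t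
      unfolding \<tau>_def using nodes(2)[OF T] that by (intro Min_le) auto
    let ?E = "left_cuts d T"
    have E: "?E \<in> sets Q" using left_cuts_in_sets[OF nodes(1)[OF T]] sQ by simp
    have "emeasure M (left_cuts (Suc d) T) =
        emeasure (Q \<Otimes>\<^sub>M ?U) {z \<in> space (Q \<Otimes>\<^sub>M ?U). X z \<in> left_cuts (Suc d) T}"
      unfolding M_def using left_cuts_in_sets[OF T]
      by (subst emeasure_distr[OF X_meas]) (auto simp: vimage_def Int_def conj_commute)
    also have "\<dots> = (\<integral>\<^sup>+\<omega>. emeasure ?U (Pair \<omega> -` {z \<in> space (Q \<Otimes>\<^sub>M ?U). X z \<in> left_cuts (Suc d) T}) \<partial>Q)"
      by (rule U.emeasure_pair_measure_alt[OF pre[OF T]])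
    also have "\<dots> = (\<integral>\<^sup>+\<omega>. \<rho> \<tau> \<omega> * indicator ?E \<omega> \<partial>Q)"
    proof (rule nn_integral_cong_AE)
      have "AE \<omega> in Q. \<forall>t\<in>T (Suc d). \<rho> \<tau> \<omega> \<le> \<rho> t \<omega>"
      proof (subst AE_ball_countable)
        show "countable (T (Suc d))" using nodes(2)[OF T] by (rule countable_finite)
        show "\<forall>t\<in>T (Suc d). AE \<omega> in Q. \<rho> \<tau> \<omega> \<le> \<rho> t \<omega>"
          using \<tau> \<tau>_le nodes(3)[OF T] by (intro ballI \<rho>_mono) auto
      qed
      moreover have "AE \<omega> in Q. \<rho> \<tau> \<omega> \<le> \<rho> c' \<omega>" using \<tau> by (intro \<rho>_mono) auto
      ultimately show "AE \<omega> in Q. emeasure ?U (Pair \<omega> -` {z \<in> space (Q \<Otimes>\<^sub>M ?U). X z \<in> left_cuts (Suc d) T}) =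
          \<rho> \<tau> \<omega> * indicator ?E \<omega>"
        using \<rho>_1
      proof eventually_elim
        case (elim \<omega>)
        have "Pair \<omega> -` {z \<in> space (Q \<Otimes>\<^sub>M ?U). X z \<in> left_cuts (Suc d) T} =
            (if \<omega> \<in> ?E then {v\<in>{0..1}. \<forall>t\<in>T (Suc d). ennreal v \<le> \<rho> t \<omega>} else {})"
          unfolding X_left by (auto simp: space_pair_measure spQ spU)
        moreover have "{v\<in>{0..1}. \<forall>t\<in>T (Suc d). ennreal v \<le> \<rho> t \<omega>} = {v\<in>{0..1}. ennreal v \<le> \<rho> \<tau> \<omega>}"
        proof (intro Collect_cong conj_cong refl iffI)
          fix v :: real assume v: "v \<in> {0..1}"
          show "ennreal v \<le> \<rho> \<tau> \<omega>" if "\<forall>t\<in>T (Suc d). ennreal v \<le> \<rho> t \<omega>"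
          \<comment> \<open>If \<open>\<tau> = c'\<close>, possibly with no node at all, the
            condition is automatic, as \<open>\<rho> c'\<close> is 1 almost everywhere. Otherwise
            \<open>\<tau>\<close> is itself a node.\<close>
          proof (cases "\<tau> = c'")
            case True
            then show ?thesis using v elim by (simp add: ennreal_le_1)
          next
            case False
            then show ?thesis using that \<tau>_in by auto
          qed
          show "\<forall>t\<in>T (Suc d). ennreal v \<le> \<rho> t \<omega>" if "ennreal v \<le> \<rho> \<tau> \<omega>"
            using that elim by (auto intro: order_trans)
        qed
        ultimately show ?case
          using elim emeasure_unit_interval_le[of "\<rho> \<tau> \<omega>"] by simp
      qed
    qed
    also have "\<dots> = emeasure (N a' \<tau>) ?E"
      using r[of a' \<tau>] \<tau> E emeasure_density[of "\<rho> \<tau>" Q ?E] by (simp add: \<rho>_def)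
    also have "\<dots> = ennreal (measure (N a' \<tau>) ?E)"
      using fin[of a' \<tau>] \<tau> by (simp add: finite_measure.emeasure_eq_measure)
    also have "measure (N a' \<tau>) ?E = increment d a (\<lambda>i. Min (insert (c i) (T i))) (h a' \<tau>)"
      using N[of a' \<tau>] \<tau> nodes(1)[OF T] by (simp add: cut_measure_def)
    also have "\<dots> = increment (Suc d) a (\<lambda>i. Min (insert (c i) (T i))) f"
      unfolding inc_h by (rule increment_cong) (auto simp: a'_def \<tau>_def c'_def)
    finally show ?thesis .
  qed
  have univ: "left_cuts (Suc d) (\<lambda>_. {}) = UNIV" "finite_nodes (Suc d) a c (\<lambda>_. {})"
    by (auto simp: left_cuts_def finite_nodes_def)
  have "finite_measure M"
    using M_eq[OF univ(2)] by (intro finite_measureI) (simp add: univ(1) spM)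
  moreover have "measure M (left_cuts (Suc d) T) = increment (Suc d) a (\<lambda>i. Min (insert (c i) (T i))) f"
    if T: "finite_nodes (Suc d) a c T" for T
  proof -
    have "0 \<le> increment (Suc d) a (\<lambda>i. Min (insert (c i) (T i))) f"
    proof (rule Suc.prems(2))
      fix i assume i: "i \<in> {1..Suc d}"
      then have "finite (T i)" "T i \<subseteq> {a i..c i}" using T by (auto simp: finite_nodes_def)
      then show "a i \<le> a i \<and> a i \<le> Min (insert (c i) (T i)) \<and> Min (insert (c i) (T i)) \<le> c i"
        using Suc.prems(1)[OF i] by auto
    qed
    then show ?thesis using M_eq[OF T] by (simp add: measure_def)
  qed
  ultimately show ?case using sM by (intro exI[of _ M]) (auto simp: cut_measure_def)
qed


section \<open>Box monotone functions\<close>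

text \<open>The pairs \<open>(u, b)\<close> which, read as cuts, separate \<open>s i\<close> from
  \<open>t i\<close> in every coordinate: \<open>s i \<le> u i < t i\<close> for side
  \<open>L\<close> and \<open>s i < u i \<le> t i\<close> for side \<open>R\<close>.\<close>

definition cell :: "nat \<Rightarrow> (nat \<Rightarrow> real set) \<Rightarrow> (nat \<Rightarrow> real) \<Rightarrow> (nat \<Rightarrow> real) \<Rightarrow>
    ((nat \<Rightarrow> real) \<times> (nat \<Rightarrow> side)) set" where
  "cell d I s t = {z\<in>space (pair_space d I). \<forall>i\<in>{1..d}.
     plus_indicator (snd z i) (fst z i) (s i) = 0 \<and> plus_indicator (snd z i) (fst z i) (t i) = 1}"

lemma plus_indicator_01: "plus_indicator b u t = 0 \<or> plus_indicator b u t = 1"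
  by (cases b) auto

lemma plus_indicator_mono: "s \<le> t \<Longrightarrow> plus_indicator b u s \<le> plus_indicator b u t"
  by (cases b) auto

lemma cell_in_sets: "cell d I s t \<in> sets (pair_space d I)"
proof -
  have [measurable]: "(\<lambda>z. fst z i) \<in> borel_measurable (pair_space d I)" for i
    by (rule measurable_coord_representing[OF refl])
  have [measurable]: "Measurable.pred (pair_space d I) (\<lambda>z. snd z i = L)" for i
    using sets_snd_representing[OF refl, of d I "\<lambda>b. b i = L"] by (simp add: pred_def)
  have "cell d I s t = {z\<in>space (pair_space d I). \<forall>i\<in>{1..d}.
     (if snd z i = L then s i \<le> fst z i \<and> fst z i < t i else s i < fst z i \<and> fst z i \<le> t i)}"
  proof -
    have "plus_indicator b u p = 0 \<and> plus_indicator b u q = 1 \<longleftrightarrow>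
        (if b = L then p \<le> u \<and> u < q else p < u \<and> u \<le> q)" for b u p q
      by (cases b) auto
    then show ?thesis by (simp add: cell_def)
  qed
  also have "\<dots> \<in> sets (pair_space d I)" by measurable
  finally show ?thesis .
qed

text \<open>Push the measure on cuts forward to position and side. The position alone decides
  whether the cut is to the left of \<open>t\<close>, except for ties
  \<open>U i \<omega> = t\<close>; sides have to resolve those ties that occur with positive mass,
  and there are only countably many such positions.\<close>

lemma pair_measure_on_box:
  assumes ac: "\<And>i. i \<in> {1..d} \<Longrightarrow> a i \<le> c i" and I: "\<And>i. i \<in> {1..d} \<Longrightarrow> {a i..c i} \<subseteq> I i"
    and f: "\<And>s t. (\<And>i. i \<in> {1..d} \<Longrightarrow> a i \<le> s i \<and> s i \<le> t i \<and> t i \<le> c i) \<Longrightarrow> 0 \<le> increment d s t f"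
  shows "\<exists>Q. finite_measure Q \<and> sets Q = sets (pair_space d I) \<and>
    (\<forall>i\<in>{1..d}. \<exists>C. countable C \<and> (AE z in Q. snd z i = L \<longrightarrow> fst z i \<in> C)) \<and>
    (\<forall>s t. (\<forall>i\<in>{1..d}. a i \<le> s i \<and> s i \<le> t i \<and> t i \<le> c i) \<longrightarrow>
      measure Q (cell d I s t) = increment d s t f)"
proof -
  obtain N where N: "cut_measure d a c f N" using cut_measure_exists[where a = a and c = c, OF ac f] by blast
  interpret N: finite_measure N using N by (simp add: cut_measure_def)
  have sN: "sets N = sets (cut_space d a c)" using N by (simp add: cut_measure_def)
  then have spN: "space N = UNIV" by (auto dest: sets_eq_imp_space_eq)
  have left_meas: "measure N (left_cuts d T) = increment d a (\<lambda>i. Min (insert (c i) (T i))) f"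
    and left_sets: "left_cuts d T \<in> sets N" if "finite_nodes d a c T" for T
    using N left_cuts_in_sets[OF that] that sN by (auto simp: cut_measure_def)
  have cut_sets: "{\<omega>. \<omega> i t} \<in> sets N" if "i \<in> {1..d}" "t \<in> {a i..c i}" for i t
  proof -
    have "{\<omega>. \<omega> i t} = left_cuts d ((\<lambda>_. {})(i := {t}))" using that by (auto simp: left_cuts_def)
    moreover have "finite_nodes d a c ((\<lambda>_. {})(i := {t}))" using that by (auto simp: finite_nodes_def)
    ultimately show ?thesis using left_sets by simp
  qed
  then have [measurable]: "Measurable.pred N (\<lambda>\<omega>. \<omega> i t)" if "i \<in> {1..d}" "t \<in> {a i..c i}" for i t
    using that by (simp add: pred_def spN)
  \<comment> \<open>Adding a node \<open>t\<close> above \<open>s\<close> does not change the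
    minimum of the nodes, so the two events have the same mass.\<close>
  have mono: "AE \<omega> in N. \<omega> i s \<longrightarrow> \<omega> i t"
    if i: "i \<in> {1..d}" and st: "a i \<le> s" "s \<le> t" "t \<le> c i" for i s t
  proof -
    let ?S = "left_cuts d ((\<lambda>_. {})(i := {s}))" and ?T = "left_cuts d ((\<lambda>_. {})(i := {s, t}))"
    have nodes: "finite_nodes d a c ((\<lambda>_. {})(i := {s}))" "finite_nodes d a c ((\<lambda>_. {})(i := {s, t}))"
      using st by (auto simp: finite_nodes_def)
    have "measure N ?S = measure N ?T"
      unfolding left_meas[OF nodes(1)] left_meas[OF nodes(2)]
      using st by (intro increment_cong) (auto simp: min_def)
    moreover have sub: "?T \<subseteq> ?S" by (auto simp: left_cuts_def)
    ultimately have "measure N (?S - ?T) = 0"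
      using N.finite_measure_Diff[OF left_sets[OF nodes(1)] left_sets[OF nodes(2)] sub] by simp
    then have "?S - ?T \<in> null_sets N"
      using left_sets[OF nodes(1)] left_sets[OF nodes(2)] by (simp add: null_sets_def N.emeasure_eq_measure)
    then have "AE \<omega> in N. \<omega> \<notin> ?S - ?T" by (rule AE_not_in)
    moreover have "?S = {\<omega>. \<omega> i s}" "?T = {\<omega>. \<omega> i s \<and> \<omega> i t}"
      using i by (auto simp: left_cuts_def split: if_splits)
    ultimately show ?thesis by simp
  qed
  have joint: "measure N {\<omega>. \<forall>i\<in>{1..d}. \<omega> i (x i)} = increment d a x f"
    if "\<And>i. i \<in> {1..d} \<Longrightarrow> x i \<in> {a i..c i}" for x
  proof -
    have nodes: "finite_nodes d a c (\<lambda>i. {x i})" using that by (auto simp: finite_nodes_def)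
    have "{\<omega>. \<forall>i\<in>{1..d}. \<omega> i (x i)} = left_cuts d (\<lambda>i. {x i})" by (auto simp: left_cuts_def)
    moreover have "increment d a (\<lambda>i. Min (insert (c i) {x i})) f = increment d a x f"
    proof (rule increment_cong)
      fix i assume "i \<in> {1..d}"
      then show "a i = a i \<and> Min (insert (c i) {x i}) = x i" using that[of i] by (simp add: min_def)
    qed
    ultimately show ?thesis using left_meas[OF nodes] by simp
  qed
  have joint_sets: "{\<omega>. \<forall>i\<in>{1..d}. \<omega> i (x i)} \<in> sets N"
    if "\<And>i. i \<in> {1..d} \<Longrightarrow> x i \<in> {a i..c i}" for x
  proof -
    have "{\<omega>\<in>space N. \<forall>i\<in>{1..d}. \<omega> i (x i)} \<in> sets N"
    proof (rule sets.sets_Collect_finite_All)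
      fix i assume "i \<in> {1..d}"
      then show "{\<omega> \<in> space N. \<omega> i (x i)} \<in> sets N" using cut_sets that by (simp add: spN)
    qed simp
    then show ?thesis by (simp add: spN)
  qed
  have incr_meas: "measure N {\<omega>. \<forall>i\<in>{1..d}. \<not> \<omega> i (s i) \<and> \<omega> i (t i)} = increment d s t f"
    and incr_sets: "{\<omega>. \<forall>i\<in>{1..d}. \<not> \<omega> i (s i) \<and> \<omega> i (t i)} \<in> sets N"
    if st: "\<And>i. i \<in> {1..d} \<Longrightarrow> a i \<le> s i \<and> s i \<le> t i \<and> t i \<le> c i" for s t
  proof -
    let ?J = "\<lambda>i. {a i..c i}"
    let ?E = "{\<omega>. \<forall>i\<in>{1..d}. \<not> \<omega> i (s i) \<and> \<omega> i (t i)}"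
    have mem: "s i \<in> ?J i \<and> t i \<in> ?J i" if "i \<in> {1..d}" for i using st[OF that] by auto
    have F: "fin_functional (cuboid d ?J) (increment d s t)"
      by (rule fin_functional_increment[OF mem])
    \<comment> \<open>Inclusion-exclusion: as \<open>p x \<omega>\<close> is a product over
      coordinates, its increment factorises and is almost everywhere the indicator of
      \<open>?E\<close>. Taking expectations turns it into an increment of the anchored distribution
      function.\<close>
    define p where "p x \<omega> = (\<Prod>i=1..d. of_bool (\<omega> i (x i)) :: real)" for x and \<omega> :: "nat \<Rightarrow> real \<Rightarrow> bool"
    have p: "p x \<omega> = indicator {\<omega>. \<forall>i\<in>{1..d}. \<omega> i (x i)} \<omega>" for x \<omega>
    proof (cases "\<forall>i\<in>{1..d}. \<omega> i (x i)")
      case True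
      then show ?thesis unfolding p_def by simp
    next
      case False
      then show ?thesis unfolding p_def by (auto simp: indicator_def)
    qed
    have pint: "integrable N (p x)" "(\<integral>\<omega>. p x \<omega> \<partial>N) = increment d a x f" if "x \<in> cuboid d ?J" for x
    proof -
      have x: "\<And>i. i \<in> {1..d} \<Longrightarrow> x i \<in> ?J i" using that by auto
      show "integrable N (p x)" unfolding p[abs_def]
        using joint_sets[OF x] by (simp add: N.emeasure_eq_measure)
      show "(\<integral>\<omega>. p x \<omega> \<partial>N) = increment d a x f" unfolding p
        using joint_sets[OF x] joint[OF x] by (simp add: spN)
    qed
    show sets: "?E \<in> sets N"
    proof -
      have "{\<omega>\<in>space N. \<forall>i\<in>{1..d}. \<not> \<omega> i (s i) \<and> \<omega> i (t i)} \<in> sets N"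
      proof (rule sets.sets_Collect_finite_All)
        fix i assume i: "i \<in> {1..d}"
        have "{\<omega>. \<omega> i (t i)} - {\<omega>. \<omega> i (s i)} \<in> sets N"
          using mem[OF i] i by (intro sets.Diff cut_sets) auto
        moreover have "{\<omega>. \<omega> i (t i)} - {\<omega>. \<omega> i (s i)} = {\<omega> \<in> space N. \<not> \<omega> i (s i) \<and> \<omega> i (t i)}"
          by (auto simp: spN)
        ultimately show "{\<omega> \<in> space N. \<not> \<omega> i (s i) \<and> \<omega> i (t i)} \<in> sets N" by simp
      qed simp
      then show ?thesis by (simp add: spN)
    qed
    have "measure N ?E = (\<integral>\<omega>. indicator ?E \<omega> \<partial>N)" using sets by (simp add: spN)
    also have "\<dots> = (\<integral>\<omega>. increment d s t (\<lambda>x. p x \<omega>) \<partial>N)"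
    proof (rule integral_cong_AE)
      have "AE \<omega> in N. \<forall>i\<in>{1..d}. \<omega> i (s i) \<longrightarrow> \<omega> i (t i)"
        using st by (intro AE_finite_allI mono) auto
      then show "AE \<omega> in N. indicator ?E \<omega> = increment d s t (\<lambda>x. p x \<omega>)"
      proof eventually_elim
        case (elim \<omega>)
        have "increment d s t (\<lambda>x. p x \<omega>) = (\<Prod>i=1..d. of_bool (\<omega> i (t i)) - of_bool (\<omega> i (s i)))"
          unfolding increment_def p_def
          using mem by (intro tensor_prod[where I = ?J] fin_functional_increment_coord) auto
        also have "\<dots> = (\<Prod>i=1..d. of_bool (\<not> \<omega> i (s i) \<and> \<omega> i (t i)))"
          using elim by (intro prod.cong) auto
        also have "\<dots> = indicator ?E \<omega>"
        proof (cases "\<omega> \<in> ?E")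
          case True
          then show ?thesis by simp
        next
          case False
          then obtain i where "i \<in> {1..d}" "\<not> (\<not> \<omega> i (s i) \<and> \<omega> i (t i))" by auto
          then have "(\<Prod>i=1..d. of_bool (\<not> \<omega> i (s i) \<and> \<omega> i (t i)) :: real) = 0"
            by (intro prod_zero) auto
          then show ?thesis using False by simp
        qed
        finally show ?case by simp
      qed
      show "(\<lambda>\<omega>. increment d s t (\<lambda>x. p x \<omega>)) \<in> borel_measurable N"
        using fin_functional_integral(1)[OF F pint(1)] by simp
    qed (use sets in simp)
    also have "\<dots> = increment d s t (\<lambda>x. \<integral>\<omega>. p x \<omega> \<partial>N)"
      by (rule fin_functional_integral(2)[OF F pint(1), symmetric])
    also have "\<dots> = increment d s t (\<lambda>x. increment d a x f)"
      by (rule fin_functional_cong[OF F pint(2)])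
    finally show "measure N ?E = increment d s t f" by (simp add: increment_compose)
  qed
  \<comment> \<open>Restricting to rational levels makes the position \<open>U i\<close> measurable
    and leaves countably many exceptional sets.\<close>
  define P where "P i = {q\<in>\<rat>. a i \<le> q \<and> q \<le> c i}" for i
  have countP: "countable (P i)" for i unfolding P_def using countable_rat by (rule countable_subset[rotated]) auto
  define U where "U i \<omega> = Inf (insert (c i) {q\<in>P i. \<omega> i q})" for i and \<omega> :: "nat \<Rightarrow> real \<Rightarrow> bool"
  have U_less: "U i \<omega> < r \<longleftrightarrow> c i < r \<or> (\<exists>q\<in>P i. q < r \<and> \<omega> i q)" if "i \<in> {1..d}" for i \<omega> r
  proof -
    have "bdd_below (insert (c i) {q\<in>P i. \<omega> i q})"
      using ac[OF that] by (intro bdd_belowI[of _ "a i"]) (auto simp: P_def)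
    then show ?thesis unfolding U_def by (subst cInf_less_iff) auto
  qed
  have U_bounds: "U i \<omega> \<in> {a i..c i}" if "i \<in> {1..d}" for i \<omega>
  proof -
    have "\<not> U i \<omega> < a i" using U_less[OF that] ac[OF that] by (auto simp: P_def)
    moreover have "U i \<omega> \<le> c i" using U_less[OF that, of \<omega>] by (meson dense_le not_less_iff_gr_or_eq less_le_not_le not_le)
    ultimately show ?thesis by simp
  qed
  have U_meas [measurable]: "U i \<in> borel_measurable N" if i: "i \<in> {1..d}" for i
  proof (rule borel_measurable_iff_less[THEN iffD2], rule allI)
    fix r
    have "{\<omega> \<in> space N. U i \<omega> < r} = (if c i < r then space N else (\<Union>q\<in>P i \<inter> {..<r}. {\<omega>. \<omega> i q}))"
      using U_less[OF i] by (auto simp: spN)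
    also have "\<dots> \<in> sets N"
      using countP[of i] i by (auto intro!: sets.countable_UN' cut_sets simp: P_def)
    finally show "{\<omega> \<in> space N. U i \<omega> < r} \<in> sets N" .
  qed
  have U_cut: "AE \<omega> in N. (U i \<omega> < t \<longrightarrow> \<omega> i t) \<and> (\<omega> i t \<longrightarrow> U i \<omega> \<le> t)"
    if i: "i \<in> {1..d}" and t: "t \<in> {a i..c i}" for i t
  proof -
    have "AE \<omega> in N. \<forall>q\<in>P i. (q \<le> t \<longrightarrow> \<omega> i q \<longrightarrow> \<omega> i t) \<and> (t \<le> q \<longrightarrow> \<omega> i t \<longrightarrow> \<omega> i q)"
    proof (subst AE_ball_countable[OF countP], rule ballI)
      fix q assume q: "q \<in> P i"
      show "AE \<omega> in N. (q \<le> t \<longrightarrow> \<omega> i q \<longrightarrow> \<omega> i t) \<and> (t \<le> q \<longrightarrow> \<omega> i t \<longrightarrow> \<omega> i q)"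
        using mono[OF i, of q t] mono[OF i, of t q] q t by (cases "q \<le> t"; cases "t \<le> q") (auto simp: P_def)
    qed
    then show ?thesis
    proof eventually_elim
      case (elim \<omega>)
      have "\<omega> i t" if "U i \<omega> < t"
        using that U_less[OF i, of \<omega> t] elim t by auto
      moreover have "U i \<omega> \<le> t" if wt: "\<omega> i t"
      proof (rule ccontr)
        assume "\<not> U i \<omega> \<le> t"
        then obtain q where q: "q \<in> \<rat>" "t < q" "q < U i \<omega>" using Rats_dense_in_real[of t "U i \<omega>"] by auto
        then have "q \<in> P i" using U_bounds[OF i, of \<omega>] t by (auto simp: P_def)
        then have "\<omega> i q" using elim wt q by auto
        obtain q' where q': "q < q'" "q' < U i \<omega>" using dense[OF q(3)] by auto
        then have "U i \<omega> < q'" using U_less[OF i, of \<omega> q'] \<open>q \<in> P i\<close> \<open>\<omega> i q\<close> by auto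
        then show False using q' by simp
      qed
      ultimately show ?case by auto
    qed
  qed
  \<comment> \<open>The atoms of the law of \<open>U i\<close>.\<close>
  define D where "D i = {u. measure (distr N borel (U i)) {u} \<noteq> 0} \<inter> {a i..c i}" for i
  have countD: "countable (D i)" if i: "i \<in> {1..d}" for i
  proof -
    interpret distr: finite_measure "distr N borel (U i)" by (rule N.finite_measure_distr[OF U_meas[OF i]])
    show ?thesis unfolding D_def using distr.countable_support by (rule countable_subset[rotated]) auto
  qed
  have not_D: "AE \<omega> in N. U i \<omega> \<noteq> u" if i: "i \<in> {1..d}" and u: "u \<in> {a i..c i} - D i" for i u
  proof -
    have "measure N {\<omega>\<in>space N. U i \<omega> = u} = 0"
      using u measure_distr[OF U_meas[OF i], of "{u}"] by (simp add: D_def vimage_def Int_def conj_commute)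
    then have "{\<omega>\<in>space N. U i \<omega> = u} \<in> null_sets N"
      using U_meas[OF i] by (simp add: null_sets_def N.emeasure_eq_measure)
    then have "AE \<omega> in N. \<omega> \<notin> {\<omega>\<in>space N. U i \<omega> = u}" by (rule AE_not_in)
    then show ?thesis by (simp add: spN)
  qed
  \<comment> \<open>At an atom \<open>u\<close> the side records whether the cut lies to the left of
    \<open>u\<close> itself; \<open>L\<close> says that it does not, in accordance with
    \<open>plus_indicator L u u = 0\<close>. Ties at other levels are null, so \<open>R\<close> is
    harmless there.\<close>
  define B where "B i \<omega> = (if U i \<omega> \<in> D i \<and> \<not> \<omega> i (U i \<omega>) then L else R)" for i and \<omega> :: "nat \<Rightarrow> real \<Rightarrow> bool"
  have B_sets: "{\<omega>\<in>space N. B i \<omega> = b} \<in> sets N" if i: "i \<in> {1..d}" for i b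
  proof -
    have L: "{\<omega>\<in>space N. B i \<omega> = L} \<in> sets N"
    proof -
      have "{\<omega>\<in>space N. B i \<omega> = L} = (\<Union>u\<in>D i. {\<omega>\<in>space N. U i \<omega> = u} - {\<omega>. \<omega> i u})"
        by (auto simp: B_def spN)
      also have "\<dots> \<in> sets N"
      proof (rule sets.countable_UN''[OF countD[OF i]])
        fix u assume "u \<in> D i"
        then have "{\<omega>. \<omega> i u} \<in> sets N" using i by (intro cut_sets) (auto simp: D_def)
        moreover have "{\<omega>\<in>space N. U i \<omega> = u} \<in> sets N" using U_meas[OF i] by measurable
        ultimately show "{\<omega>\<in>space N. U i \<omega> = u} - {\<omega>. \<omega> i u} \<in> sets N" using sets.Diff by blast
      qed
      finally show ?thesis .
    qed
    moreover have "{\<omega>\<in>space N. B i \<omega> = R} = space N - {\<omega>\<in>space N. B i \<omega> = L}" by (auto simp: B_def)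
    ultimately show ?thesis by (cases b) auto
  qed
  have cut_iff: "AE \<omega> in N. plus_indicator (B i \<omega>) (U i \<omega>) t = of_bool (\<omega> i t)"
    if i: "i \<in> {1..d}" and t: "t \<in> {a i..c i}" for i t
  proof -
    have "AE \<omega> in N. t \<notin> D i \<longrightarrow> U i \<omega> \<noteq> t" using not_D[OF i, of t] t by (cases "t \<in> D i") auto
    with U_cut[OF i t] show ?thesis
    proof eventually_elim
      case (elim \<omega>)
      then show ?case
        by (cases "U i \<omega>" t rule: linorder_cases) (auto simp: B_def)
    qed
  qed
  define G where "G \<omega> = ((\<lambda>i\<in>{1..d}. U i \<omega>), (\<lambda>i\<in>{1..d}. B i \<omega>))" for \<omega>
  have G_meas: "G \<in> measurable N (pair_space d I)"
    unfolding pair_space_def G_def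
  proof (rule measurable_Pair)
    show "(\<lambda>\<omega>. \<lambda>i\<in>{1..d}. U i \<omega>) \<in> measurable N (restrict_space borel (cuboid d I))"
    proof (rule measurable_restrict_space2)
      show "(\<lambda>\<omega>. \<lambda>i\<in>{1..d}. U i \<omega>) \<in> space N \<rightarrow> cuboid d I"
        using U_bounds I by (intro Pi_I restrict_PiE_iff[THEN iffD2] ballI) blast
      show "(\<lambda>\<omega>. \<lambda>i\<in>{1..d}. U i \<omega>) \<in> borel_measurable N"
      proof (rule measurable_coordinatewise_then_product)
        fix i
        show "(\<lambda>\<omega>. (\<lambda>i\<in>{1..d}. U i \<omega>) i) \<in> borel_measurable N"
          using U_meas[of i] by (cases "i \<in> {1..d}") auto
      qed
    qed
    show "(\<lambda>\<omega>. \<lambda>i\<in>{1..d}. B i \<omega>) \<in> measurable N (count_space (side_families d))"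
      unfolding measurable_count_space_eq2[OF finite_side_families]
    proof (intro conjI ballI)
      fix b assume b: "b \<in> side_families d"
      have "(\<lambda>\<omega>. \<lambda>i\<in>{1..d}. B i \<omega>) -` {b} \<inter> space N = {\<omega>\<in>space N. \<forall>i\<in>{1..d}. B i \<omega> = b i}"
        using b by (auto simp: fun_eq_iff PiE_iff extensional_def)
      also have "\<dots> \<in> sets N" by (intro sets.sets_Collect_finite_All B_sets) auto
      finally show "(\<lambda>\<omega>. \<lambda>i\<in>{1..d}. B i \<omega>) -` {b} \<inter> space N \<in> sets N" .
    qed auto
  qed
  define Q where "Q = distr N (pair_space d I) G"
  have "measure Q (cell d I s t) = increment d s t f"
    if st: "\<forall>i\<in>{1..d}. a i \<le> s i \<and> s i \<le> t i \<and> t i \<le> c i" for s t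
  proof -
    have st': "\<And>i. i \<in> {1..d} \<Longrightarrow> a i \<le> s i \<and> s i \<le> t i \<and> t i \<le> c i" using st by blast
    have "measure Q (cell d I s t) = measure N (G -` cell d I s t \<inter> space N)"
      unfolding Q_def by (rule measure_distr[OF G_meas cell_in_sets])
    also have "\<dots> = measure N {\<omega>. \<forall>i\<in>{1..d}. \<not> \<omega> i (s i) \<and> \<omega> i (t i)}"
    proof (rule measure_eq_AE)
      have "AE \<omega> in N. \<forall>i\<in>{1..d}. plus_indicator (B i \<omega>) (U i \<omega>) (s i) = of_bool (\<omega> i (s i))"
        using st' by (intro AE_finite_allI cut_iff) force+
      moreover have "AE \<omega> in N. \<forall>i\<in>{1..d}. plus_indicator (B i \<omega>) (U i \<omega>) (t i) = of_bool (\<omega> i (t i))"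
        using st' by (intro AE_finite_allI cut_iff) force+
      ultimately show "AE \<omega> in N. \<omega> \<in> G -` cell d I s t \<inter> space N \<longleftrightarrow>
          \<omega> \<in> {\<omega>. \<forall>i\<in>{1..d}. \<not> \<omega> i (s i) \<and> \<omega> i (t i)}"
      proof eventually_elim
        case (elim \<omega>)
        have "G \<omega> \<in> space (pair_space d I)" using measurable_space[OF G_meas, of \<omega>] spN by simp
        then have "G \<omega> \<in> cell d I s t \<longleftrightarrow> (\<forall>i\<in>{1..d}.
            plus_indicator (B i \<omega>) (U i \<omega>) (s i) = 0 \<and> plus_indicator (B i \<omega>) (U i \<omega>) (t i) = 1)"
          unfolding cell_def G_def by simp
        also have "\<dots> \<longleftrightarrow> (\<forall>i\<in>{1..d}. \<not> \<omega> i (s i) \<and> \<omega> i (t i))"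
          using elim by (intro ball_cong) auto
        finally show ?case by (simp add: spN)
      qed
    qed (use measurable_sets[OF G_meas cell_in_sets] incr_sets[OF st'] in auto)
    also have "\<dots> = increment d s t f" by (rule incr_meas[OF st'])
    finally show ?thesis .
  qed
  moreover have "\<exists>C. countable C \<and> (AE z in Q. snd z i = L \<longrightarrow> fst z i \<in> C)" if i: "i \<in> {1..d}" for i
  proof (intro exI[of _ "D i"] conjI countD[OF i])
    have Db: "D i \<in> sets borel" by (rule sets.countable[OF _ countD[OF i]]) simp
    have [measurable]: "(\<lambda>z. fst z i) \<in> borel_measurable (pair_space d I)"
      by (rule measurable_coord_representing[OF refl])
    have [measurable]: "Measurable.pred (pair_space d I) (\<lambda>z. snd z i = L)"
      using sets_snd_representing[OF refl, of d I "\<lambda>b. b i = L"] by (simp add: pred_def)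
    have "{z \<in> space (pair_space d I). snd z i = L \<longrightarrow> fst z i \<in> D i} \<in> sets (pair_space d I)"
      using Db by measurable
    then show "AE z in Q. snd z i = L \<longrightarrow> fst z i \<in> D i"
      unfolding Q_def by (subst AE_distr_iff[OF G_meas]) (use i in \<open>auto simp: G_def B_def split: if_splits\<close>)
  qed
  moreover have "finite_measure Q" unfolding Q_def by (rule N.finite_measure_distr[OF G_meas])
  moreover have "sets Q = sets (pair_space d I)" by (simp add: Q_def)
  ultimately show ?thesis by blast
qed


section \<open>Order one: from boxes to the whole cuboid\<close>

lemma node_pair:
  assumes "card S = Suc 1"
  obtains s t :: real where "s < t" "S = {s, t}"
proof -
  obtain p q where "S = {p, q}" "p \<noteq> q" using assms by (metis One_nat_def Suc_1 card_2_iff)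
  then show ?thesis using that[of p q] that[of q p] by (cases "p < q") auto
qed

lemma tensor_dd_pairs:
  assumes st: "\<And>i. i \<in> {1..d} \<Longrightarrow> s i < t i" and S: "\<And>i. i \<in> {1..d} \<Longrightarrow> S i = {s i, t i}"
  shows "tensor d (\<lambda>i. dd (S i)) f = (\<Prod>i=1..d. 1 / (t i - s i)) * increment d s t f"
proof -
  have "tensor d (\<lambda>i. dd (S i)) f = tensor d (\<lambda>i \<phi>. 1 / (t i - s i) * (\<phi> (t i) - \<phi> (s i))) f"
  proof (rule tensor_cong_functional)
    fix i assume i: "i \<in> {1..d}"
    then have "s i \<noteq> t i" using st[OF i] by simp
    then show "dd (S i) = (\<lambda>\<phi>. 1 / (t i - s i) * (\<phi> (t i) - \<phi> (s i)))"
      by (simp add: S[OF i] dd_two fun_eq_iff)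
  qed
  also have "\<dots> = (\<Prod>i=1..d. 1 / (t i - s i)) * increment d s t f"
    unfolding increment_def
    by (rule tensor_scale[where I = "\<lambda>_. UNIV"]) (simp add: fin_functional_increment_coord)
  finally show ?thesis .
qed

lemma increment_nonneg:
  assumes f: "box_convex d I n f" and n: "\<And>i. i \<in> {1..d} \<Longrightarrow> n i = 1"
    and st: "\<And>i. i \<in> {1..d} \<Longrightarrow> s i \<in> I i \<and> t i \<in> I i \<and> s i \<le> t i"
  shows "0 \<le> increment d s t f"
\<comment> \<open>Convexity needs two distinct nodes in each coordinate; degenerate boxes are
  treated apart.\<close>
proof (cases "\<exists>i\<in>{1..d}. s i = t i")
  case True
  then show ?thesis using increment_eq_0 by fastforce
next
  case False
  then have lt: "s i < t i" if "i \<in> {1..d}" for i using st[OF that] that by force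
  define S where "S i = {s i, t i}" for i
  have "node_family d I n S"
    unfolding node_family_def
  proof
    fix i assume i: "i \<in> {1..d}"
    show "S i \<subseteq> I i \<and> card (S i) = Suc (n i)" using st[OF i] lt[OF i] n[OF i] by (simp add: S_def)
  qed
  then have "0 \<le> tensor d (\<lambda>i. dd (S i)) f" using f by (simp add: box_convex_iff_dd)
  moreover have "tensor d (\<lambda>i. dd (S i)) f = (\<Prod>i=1..d. 1 / (t i - s i)) * increment d s t f"
    using lt by (intro tensor_dd_pairs) (auto simp: S_def)
  moreover have "0 < (\<Prod>i=1..d. 1 / (t i - s i))" using lt by (intro prod_pos) simp
  ultimately show ?thesis by (simp add: zero_le_mult_iff)
qed

text \<open>Clamping \<open>s\<close> and \<open>t\<close> to \<open>[p, q]\<close> intersects the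
  two ranges. If they do not overlap, both ends clamp to the same point and no cut separates
  them.\<close>

lemma plus_indicator_clamp:
  assumes "s \<le> t" "p \<le> q"
  shows "plus_indicator b u (max p (min q s)) = 0 \<and> plus_indicator b u (max p (min q t)) = 1 \<longleftrightarrow>
    (plus_indicator b u s = 0 \<and> plus_indicator b u t = 1) \<and>
    (plus_indicator b u p = 0 \<and> plus_indicator b u q = 1)"
  using assms by (cases b) (auto simp: max_def min_def)

lemma cell_Int:
  assumes "\<And>i. i \<in> {1..d} \<Longrightarrow> s i \<le> t i" "\<And>i. i \<in> {1..d} \<Longrightarrow> p i \<le> q i"
  shows "cell d I s t \<inter> cell d I p q =
    cell d I (\<lambda>i. max (p i) (min (q i) (s i))) (\<lambda>i. max (p i) (min (q i) (t i)))"
  unfolding cell_def using plus_indicator_clamp[OF assms] by blast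

lemma cell_mono:
  assumes "\<And>i. i \<in> {1..d} \<Longrightarrow> p i \<le> s i" "\<And>i. i \<in> {1..d} \<Longrightarrow> t i \<le> q i"
  shows "cell d I s t \<subseteq> cell d I p q"
proof -
  have "plus_indicator b u p' = 0" if "plus_indicator b u s' = 0" "p' \<le> s'" for b u p' s'
    using plus_indicator_mono[OF that(2), of b u] plus_indicator_01[of b u p'] that(1) by auto
  moreover have "plus_indicator b u q' = 1" if "plus_indicator b u t' = 1" "t' \<le> q'" for b u q' t'
    using plus_indicator_mono[OF that(2), of b u] plus_indicator_01[of b u q'] that(1) by auto
  ultimately show ?thesis using assms unfolding cell_def by blast
qed

definition glue_measure :: "'a measure \<Rightarrow> (nat \<Rightarrow> 'a measure) \<Rightarrow> (nat \<Rightarrow> 'a set) \<Rightarrow> 'a measure" where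
  "glue_measure M Q Z = measure_of (space M) (sets M) (\<lambda>X. \<Sum>k. emeasure (Q k) (X \<inter> Z k))"

lemma sets_glue_measure [simp]: "sets (glue_measure M Q Z) = sets M"
  by (simp add: glue_measure_def)

text \<open>Countable additivity is an interchange of two nonnegative series, done by reading one as
  an integral over counting measure.\<close>

lemma emeasure_glue_measure:
  assumes Q: "\<And>k. sets (Q k) = sets M" and Z: "\<And>k. Z k \<in> sets M" and X: "X \<in> sets M"
  shows "emeasure (glue_measure M Q Z) X = (\<Sum>k. emeasure (Q k) (X \<inter> Z k))"
  unfolding glue_measure_def
proof (rule emeasure_measure_of_sigma)
  show "countably_additive (sets M) (\<lambda>X. \<Sum>k. emeasure (Q k) (X \<inter> Z k))"
    unfolding countably_additive_def
  proof (intro allI impI)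
    fix A :: "nat \<Rightarrow> 'a set"
    assume A: "range A \<subseteq> sets M" "disjoint_family A"
    have "(\<Sum>n. \<Sum>k. emeasure (Q k) (A n \<inter> Z k)) =
        (\<Sum>n. \<integral>\<^sup>+k. emeasure (Q k) (A n \<inter> Z k) \<partial>count_space UNIV)"
      by (simp add: nn_integral_count_space_nat)
    also have "\<dots> = (\<integral>\<^sup>+k. (\<Sum>n. emeasure (Q k) (A n \<inter> Z k)) \<partial>count_space UNIV)"
      by (rule nn_integral_suminf[symmetric]) simp
    also have "\<dots> = (\<integral>\<^sup>+k. emeasure (Q k) (\<Union> (range A) \<inter> Z k) \<partial>count_space UNIV)"
    proof (rule nn_integral_cong)
      fix k
      have "(\<Sum>n. emeasure (Q k) (A n \<inter> Z k)) = emeasure (Q k) (\<Union>n. A n \<inter> Z k)"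
        using A Z Q by (intro suminf_emeasure) (auto simp: disjoint_family_on_def)
      then show "(\<Sum>n. emeasure (Q k) (A n \<inter> Z k)) = emeasure (Q k) (\<Union> (range A) \<inter> Z k)" by simp
    qed
    finally show "(\<Sum>n. \<Sum>k. emeasure (Q k) (A n \<inter> Z k)) = (\<Sum>k. emeasure (Q k) (\<Union> (range A) \<inter> Z k))"
      by (simp add: nn_integral_count_space_nat)
  qed
qed (auto simp: positive_def X sets.sigma_algebra_axioms)

text \<open>On two nodes \<open>dd\<close> is an increment divided by the distance. Applied to the
  product kernel, it gives the indicator of a cell with the same normalising constant as for
  \<open>f\<close>.\<close>

lemma represented_by_increments:
  assumes I: "\<And>i. i \<in> {1..d} \<Longrightarrow> open (I i) \<and> is_interval (I i)" and \<alpha>: "\<alpha> \<in> cuboid d I"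
    and n: "\<And>i. i \<in> {1..d} \<Longrightarrow> n i = 1" and N: "representing d I N"
    and incr: "\<And>s t. (\<And>i. i \<in> {1..d} \<Longrightarrow> s i \<in> I i \<and> t i \<in> I i \<and> s i \<le> t i) \<Longrightarrow>
      measure N (cell d I s t) = increment d s t f"
  shows "represented_by d I n \<alpha> f N"
  unfolding represented_by_def
proof (intro conjI allI impI N)
  fix S assume S: "node_family d I n S"
  have "\<exists>s t. s < t \<and> S i = {s, t}" if "i \<in> {1..d}" for i
    using node_familyD(2)[OF S that] n[OF that] node_pair[of "S i"] by metis
  then obtain s t where st: "\<And>i. i \<in> {1..d} \<Longrightarrow> s i < t i \<and> S i = {s i, t i}" by metis
  let ?c = "\<Prod>i=1..d. 1 / (t i - s i)"
  have Nc: "cell d I s t \<in> sets N" using cell_in_sets representing_sets[OF N] by blast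
  have "tensor d (\<lambda>i. dd (S i)) (\<lambda>x. \<integral>z. kern d n \<alpha> x (snd z) (fst z) \<partial>N) =
      (\<integral>z. tensor d (\<lambda>i. dd (S i)) (\<lambda>x. kern d n \<alpha> x (snd z) (fst z)) \<partial>N)"
    by (rule representing_tensor[OF N I \<alpha> S])
  also have "\<dots> = (\<integral>z. ?c * indicator (cell d I s t) z \<partial>N)"
  proof (rule Bochner_Integration.integral_cong[OF refl])
    fix z assume z: "z \<in> space N"
    let ?p = "\<lambda>i. plus_indicator (snd z i) (fst z i)"
    have "tensor d (\<lambda>i. dd (S i)) (\<lambda>x. kern d n \<alpha> x (snd z) (fst z)) =
        (\<Prod>i=1..d. 1 / (t i - s i) * (?p i (t i) - ?p i (s i)))"
      unfolding tensor_dd_kern[OF S]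
    proof (rule prod.cong[OF refl])
      fix i assume i: "i \<in> {1..d}"
      have "card (S i) = Suc (n i)" "1 \<le> n i" using node_familyD(2)[OF S i] n[OF i] by auto
      from dd_kernel[OF this] have "dd (S i) (\<lambda>x. kernel (n i) (snd z i) (\<alpha> i) x (fst z i)) = dd (S i) (?p i)"
        using n[OF i] by simp
      also have "\<dots> = 1 / (t i - s i) * (?p i (t i) - ?p i (s i))"
        using st[OF i] by (simp add: dd_two)
      finally show "dd (S i) (\<lambda>x. kernel (n i) (snd z i) (\<alpha> i) x (fst z i)) =
          1 / (t i - s i) * (?p i (t i) - ?p i (s i))" .
    qed
    also have "\<dots> = ?c * (\<Prod>i=1..d. ?p i (t i) - ?p i (s i))" by (rule prod.distrib)
    also have "(\<Prod>i=1..d. ?p i (t i) - ?p i (s i)) = indicator (cell d I s t) z"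
    proof -
      have zs: "z \<in> space (pair_space d I)" using z sets_eq_imp_space_eq[OF representing_sets[OF N]] by simp
      have diff: "?p i (t i) - ?p i (s i) = of_bool (?p i (s i) = 0 \<and> ?p i (t i) = 1)"
        if "i \<in> {1..d}" for i
        using plus_indicator_mono[of "s i" "t i" "snd z i" "fst z i"] st[OF that]
          plus_indicator_01[of "snd z i" "fst z i" "s i"] plus_indicator_01[of "snd z i" "fst z i" "t i"] by auto
      show ?thesis
      proof (cases "z \<in> cell d I s t")
        case True
        then have "?p i (t i) - ?p i (s i) = 1" if "i \<in> {1..d}" for i using that by (auto simp: cell_def)
        then show ?thesis using True by simp
      next
        case False
        then obtain i where i: "i \<in> {1..d}" "\<not> (?p i (s i) = 0 \<and> ?p i (t i) = 1)"
          using zs unfolding cell_def by blast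
        then have "?p i (t i) - ?p i (s i) = 0" using diff[OF i(1)] by simp
        then show ?thesis using False i(1) by (intro trans[OF prod_zero]) auto
      qed
    qed
    finally show "tensor d (\<lambda>i. dd (S i)) (\<lambda>x. kern d n \<alpha> x (snd z) (fst z)) = ?c * indicator (cell d I s t) z" .
  qed
  also have "\<dots> = ?c * measure N (cell d I s t)"
    using sets.sets_into_space[OF Nc] by (simp add: Int_absorb2)
  also have "measure N (cell d I s t) = increment d s t f"
  proof (rule incr)
    fix i assume i: "i \<in> {1..d}"
    show "s i \<in> I i \<and> t i \<in> I i \<and> s i \<le> t i" using st[OF i] node_familyD(1)[OF S i] by auto
  qed
  also have "?c * increment d s t f = tensor d (\<lambda>i. dd (S i)) f"
    using st by (intro tensor_dd_pairs[symmetric]) auto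
  finally show "tensor d (\<lambda>i. dd (S i)) f =
      tensor d (\<lambda>i. dd (S i)) (\<lambda>x. \<integral>z. kern d n \<alpha> x (snd z) (fst z) \<partial>N)" by simp
qed

text \<open>The measures on an exhausting sequence of boxes agree on cells, since the mass of a cell only
  depends on \<open>f\<close>; gluing them along the differences of consecutive boxes therefore telescopes.\<close>

lemma represented_by_order_one:
  assumes I: "\<And>i. i \<in> {1..d} \<Longrightarrow> open (I i) \<and> is_interval (I i)" and \<alpha>: "\<alpha> \<in> cuboid d I"
    and n: "\<And>i. i \<in> {1..d} \<Longrightarrow> n i = 1" and f: "box_convex d I n f"
  shows "\<exists>N. represented_by d I n \<alpha> f N"
proof -
  have ne: "open (I i) \<and> I i \<noteq> {}" if "i \<in> {1..d}" for i using I[OF that] \<alpha> that by auto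
  obtain a c :: "nat \<Rightarrow> nat \<Rightarrow> real" where
      ac': "\<forall>k. \<forall>i\<in>{1..d}. a k i \<in> I i \<and> c k i \<in> I i \<and> a k i \<le> c k i"
      and mono': "\<forall>k l. k \<le> l \<longrightarrow> (\<forall>i\<in>{1..d}. a l i \<le> a k i \<and> c k i \<le> c l i)"
      and ex: "\<forall>u. (\<forall>i\<in>{1..d}. u i \<in> I i) \<longrightarrow> (\<exists>k. \<forall>i\<in>{1..d}. a k i < u i \<and> u i < c k i)"
    using box_exhaustion[of d I] ne by blast
  have ac: "a k i \<in> I i" "c k i \<in> I i" "a k i \<le> c k i" if "i \<in> {1..d}" for i k using ac' that by auto
  have mono: "a l i \<le> a k i" "c k i \<le> c l i" if "i \<in> {1..d}" "k \<le> l" for i k l using mono' that by auto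
  have sub: "{a k i..c k i} \<subseteq> I i" if "i \<in> {1..d}" for k i
    using I[OF that] ac[OF that] by (intro interval_subset) auto
  let ?M = "pair_space d I"
  define good where "good k Q \<longleftrightarrow> finite_measure Q \<and> sets Q = sets ?M \<and>
    (\<forall>i\<in>{1..d}. \<exists>C. countable C \<and> (AE z in Q. snd z i = L \<longrightarrow> fst z i \<in> C)) \<and>
    (\<forall>s t. (\<forall>i\<in>{1..d}. a k i \<le> s i \<and> s i \<le> t i \<and> t i \<le> c k i) \<longrightarrow>
      measure Q (cell d I s t) = increment d s t f)" for k Q
  have "\<exists>Q. good k Q" for k
    unfolding good_def
  proof (rule pair_measure_on_box[OF ac(3) sub])
    fix s t assume st: "\<And>i. i \<in> {1..d} \<Longrightarrow> a k i \<le> s i \<and> s i \<le> t i \<and> t i \<le> c k i"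
    show "0 \<le> increment d s t f"
    proof (rule increment_nonneg[OF f n])
      fix i assume i: "i \<in> {1..d}"
      have "s i \<in> {a k i..c k i}" "t i \<in> {a k i..c k i}" using st[OF i] by auto
      then show "s i \<in> I i \<and> t i \<in> I i \<and> s i \<le> t i"
        using st[OF i] sub[OF i, of k] by blast
    qed
  qed
  then obtain Q where good: "\<And>k. good k (Q k)" by metis
  have Q: "\<And>k. finite_measure (Q k)" "\<And>k. sets (Q k) = sets ?M"
    "\<And>k. \<forall>i\<in>{1..d}. \<exists>C. countable C \<and> (AE z in Q k. snd z i = L \<longrightarrow> fst z i \<in> C)"
    "\<And>k s t. \<forall>i\<in>{1..d}. a k i \<le> s i \<and> s i \<le> t i \<and> t i \<le> c k i \<Longrightarrow>
      measure (Q k) (cell d I s t) = increment d s t f"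
    using good unfolding good_def by blast+
  define E where "E k = cell d I (a k) (c k)" for k
  \<comment> \<open>The disjoint shells of the exhaustion; on the shell \<open>Z k\<close> the
    measure \<open>Q k\<close> is used.\<close>
  define Z where "Z k = E k - (if k = 0 then {} else E (k - 1))" for k
  have E: "E k \<in> sets ?M" for k unfolding E_def by (rule cell_in_sets)
  then have Z: "Z k \<in> sets ?M" for k by (auto simp: Z_def)
  have E_mono: "E k \<subseteq> E l" if "k \<le> l" for k l unfolding E_def using mono that by (intro cell_mono) auto
  define N where "N = glue_measure ?M Q Z"
  have sN: "sets N = sets ?M" by (simp add: N_def)
  have emN: "emeasure N X = (\<Sum>k. emeasure (Q k) (X \<inter> Z k))" if "X \<in> sets ?M" for X
    unfolding N_def using Q(2) Z that by (rule emeasure_glue_measure)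
  have cellN: "emeasure N (cell d I s t) = ennreal (increment d s t f)"
    if st: "\<And>i. i \<in> {1..d} \<Longrightarrow> s i \<in> I i \<and> t i \<in> I i \<and> s i \<le> t i" for s t
  proof -
    let ?X = "cell d I s t"
    \<comment> \<open>The mass of the part of the cell inside the box \<open>k\<close>, computed
      from \<open>f\<close> by clamping the corners.\<close>
    define v where "v k = increment d (\<lambda>i. max (a k i) (min (c k i) (s i))) (\<lambda>i. max (a k i) (min (c k i) (t i))) f" for k
    \<comment> \<open>Shifted by one so that \<open>w 0 = 0\<close> and the masses of the shells are
      its consecutive differences.\<close>
    define w where "w k = (if k = 0 then 0 else v (k - 1))" for k :: nat
    have Q_cell: "measure (Q l) (?X \<inter> E k) = v k" if "k \<le> l" for k l
    proof -
      have "?X \<inter> E k = cell d I (\<lambda>i. max (a k i) (min (c k i) (s i))) (\<lambda>i. max (a k i) (min (c k i) (t i)))"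
        unfolding E_def using st ac by (intro cell_Int) auto
      moreover have "\<forall>i\<in>{1..d}. a l i \<le> max (a k i) (min (c k i) (s i)) \<and>
          max (a k i) (min (c k i) (s i)) \<le> max (a k i) (min (c k i) (t i)) \<and>
          max (a k i) (min (c k i) (t i)) \<le> c l i"
      proof
        fix i assume i: "i \<in> {1..d}"
        show "a l i \<le> max (a k i) (min (c k i) (s i)) \<and>
          max (a k i) (min (c k i) (s i)) \<le> max (a k i) (min (c k i) (t i)) \<and>
          max (a k i) (min (c k i) (t i)) \<le> c l i"
          using mono[OF i that] ac(3)[OF i, of k] st[OF i] by (auto simp: max_def min_def)
      qed
      ultimately show ?thesis using Q(4) unfolding v_def by simp
    qed
    have Xs: "?X \<in> sets ?M" by (rule cell_in_sets)
    have diff: "measure (Q k) (?X \<inter> Z k) = w (Suc k) - w k" for k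
    proof (cases k)
      case 0
      then show ?thesis using Q_cell[of 0 0] by (simp add: Z_def w_def)
    next
      case (Suc j)
      have "?X \<inter> Z k = (?X \<inter> E k) - (?X \<inter> E j)" using Suc by (auto simp: Z_def)
      moreover have "measure (Q k) ((?X \<inter> E k) - (?X \<inter> E j)) = measure (Q k) (?X \<inter> E k) - measure (Q k) (?X \<inter> E j)"
        using Xs E E_mono[of j k] Suc Q(2) by (intro finite_measure.finite_measure_Diff[OF Q(1)]) auto
      ultimately show ?thesis using Q_cell[of k k] Q_cell[of j k] Suc by (simp add: w_def)
    qed
    \<comment> \<open>Once the box contains both corners of the cell, clamping has no effect and the
      sequence is constant.\<close>
    have lim: "w \<longlonglongrightarrow> increment d s t f"
    proof (rule tendsto_eventually)
      obtain k1 where k1: "\<forall>i\<in>{1..d}. a k1 i < s i \<and> s i < c k1 i" using ex st by blast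
      obtain k2 where k2: "\<forall>i\<in>{1..d}. a k2 i < t i \<and> t i < c k2 i" using ex st by blast
      have "w k = increment d s t f" if k: "Suc (max k1 k2) \<le> k" for k
      proof -
        obtain j where j: "k = Suc j" "k1 \<le> j" "k2 \<le> j" using k by (cases k) auto
        have "v j = increment d s t f"
          unfolding v_def
        proof (rule increment_cong)
          fix i assume i: "i \<in> {1..d}"
          have "a j i < s i" "s i < c j i" "a j i < t i" "t i < c j i"
            using mono[OF i j(2)] mono[OF i j(3)] k1[rule_format, OF i] k2[rule_format, OF i] by linarith+
          then show "max (a j i) (min (c j i) (s i)) = s i \<and> max (a j i) (min (c j i) (t i)) = t i" by simp
        qed
        then show ?thesis using j(1) by (simp add: w_def)
      qed
      then show "\<forall>\<^sub>F k in sequentially. w k = increment d s t f"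
        unfolding eventually_sequentially by blast
    qed
    have "(\<lambda>k. w (Suc k) - w k) sums (increment d s t f - w 0)" by (rule telescope_sums[OF lim])
    then have "(\<lambda>k. w (Suc k) - w k) sums increment d s t f" by (simp add: w_def)
    moreover have "0 \<le> w (Suc k) - w k" for k unfolding diff[symmetric] by simp
    ultimately have "(\<Sum>k. ennreal (w (Suc k) - w k)) = ennreal (increment d s t f)"
      by (intro suminf_ennreal_eq)
    then show ?thesis
      unfolding emN[OF Xs] by (simp add: finite_measure.emeasure_eq_measure[OF Q(1)] diff)
  qed
  have "representing d I N"
    unfolding representing_def
  proof (intro conjI allI impI ballI sN; (elim conjE)?)
    fix K :: "(nat \<Rightarrow> real) set" assume K: "compact K" "K \<subseteq> cuboid d I"
    show "emeasure N (K \<times> side_families d) < \<infinity>"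
    proof (cases "K = {}")
      case False
      \<comment> \<open>Each coordinate attains its extrema on \<open>K\<close>, so these lie in the
        open interval \<open>I i\<close> and some box of the exhaustion surrounds \<open>K\<close>
        strictly. Strictness puts \<open>K\<close> into \<open>E k\<close> whatever the
        sides.\<close>
      have "\<exists>lo\<in>I i. \<exists>hi\<in>I i. \<forall>u\<in>K. lo \<le> u i \<and> u i \<le> hi" if i: "i \<in> {1..d}" for i
      proof -
        have cont: "continuous_on K (\<lambda>u. u i)" by (rule continuous_on_subset[OF continuous_on_product_coordinates]) auto
        obtain u v where "u \<in> K" "\<forall>y\<in>K. u i \<le> y i" "v \<in> K" "\<forall>y\<in>K. y i \<le> v i"
          using continuous_attains_inf[OF K(1) False cont] continuous_attains_sup[OF K(1) False cont] by metis
        moreover have "w i \<in> I i" if "w \<in> K" for w by (rule PiE_mem[OF subsetD[OF K(2) that] i])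
        ultimately show ?thesis by blast
      qed
      then obtain lo hi where lh: "\<And>i. i \<in> {1..d} \<Longrightarrow> lo i \<in> I i \<and> hi i \<in> I i \<and> (\<forall>u\<in>K. lo i \<le> u i \<and> u i \<le> hi i)"
        by metis
      obtain k1 where k1: "\<forall>i\<in>{1..d}. a k1 i < lo i \<and> lo i < c k1 i" using ex lh by blast
      obtain k2 where k2: "\<forall>i\<in>{1..d}. a k2 i < hi i \<and> hi i < c k2 i" using ex lh by blast
      define k where "k = max k1 k2"
      have "K \<times> side_families d \<subseteq> E k"
      proof
        fix z assume z: "z \<in> K \<times> side_families d"
        have "plus_indicator (snd z i) (fst z i) (a k i) = 0 \<and> plus_indicator (snd z i) (fst z i) (c k i) = 1"
          if i: "i \<in> {1..d}" for i
        proof -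
          have "a k i < lo i" "hi i < c k i"
            using mono[OF i, of k1 k] mono[OF i, of k2 k] k1[rule_format, OF i] k2[rule_format, OF i]
            by (simp_all add: k_def)
          moreover have "lo i \<le> fst z i" "fst z i \<le> hi i" using lh[OF i] z by auto
          ultimately show ?thesis by (cases "snd z i") auto
        qed
        moreover have "z \<in> space ?M" using z K(2) by (simp add: space_pair_space mem_Times_iff subsetD)
        ultimately show "z \<in> E k" by (simp add: E_def cell_def)
      qed
      then have "emeasure N (K \<times> side_families d) \<le> emeasure N (E k)"
        using E sN by (intro emeasure_mono) auto
      also have "\<dots> < \<infinity>" unfolding E_def using ac by (subst cellN) auto
      finally show ?thesis .
    qed simp
  next
    fix i assume i: "i \<in> {1..d}"
    obtain C where C: "\<And>k. countable (C k) \<and> (AE z in Q k. snd z i = L \<longrightarrow> fst z i \<in> C k)"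
    proof -
      have "\<forall>k. \<exists>C. countable C \<and> (AE z in Q k. snd z i = L \<longrightarrow> fst z i \<in> C)" using Q(3) i by blast
      from choice[OF this] show ?thesis using that by blast
    qed
    define D where "D = (\<Union>k. C k)"
    have D: "countable D" using C by (auto simp: D_def)
    have Db: "D \<in> sets borel" by (rule sets.countable[OF _ D]) simp
    define Bad where "Bad = {z\<in>space ?M. \<not> (snd z i = L \<longrightarrow> fst z i \<in> D)}"
    have Bad: "Bad \<in> sets ?M"
    proof -
      have [measurable]: "(\<lambda>z. fst z i) \<in> borel_measurable ?M"
        by (rule measurable_coord_representing[OF refl])
      have [measurable]: "Measurable.pred ?M (\<lambda>z. snd z i = L)"
        using sets_snd_representing[OF refl, of d I "\<lambda>b. b i = L"] by (simp add: pred_def)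
      show ?thesis unfolding Bad_def using Db by measurable
    qed
    have "emeasure (Q k) (Bad \<inter> Z k) = 0" for k
    proof -
      have "AE z in Q k. snd z i = L \<longrightarrow> fst z i \<in> D"
        using conjunct2[OF C[of k]] by eventually_elim (auto simp: D_def)
      then have "emeasure (Q k) Bad = 0"
        using Bad Q(2)[of k] sets_eq_imp_space_eq[OF Q(2)[of k]] unfolding Bad_def
        by (subst (asm) AE_iff_measurable) auto
      moreover have "emeasure (Q k) (Bad \<inter> Z k) \<le> emeasure (Q k) Bad"
        using Bad Q(2) by (intro emeasure_mono) auto
      ultimately show ?thesis by simp
    qed
    then have "emeasure N Bad = 0" by (simp add: emN[OF Bad])
    then have "AE z in N. snd z i = L \<longrightarrow> fst z i \<in> D"
      using Bad sN sets_eq_imp_space_eq[OF sN] unfolding Bad_def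
      by (subst AE_iff_measurable) auto
    then show "\<exists>C. countable C \<and> (AE z in N. snd z i = L \<longrightarrow> fst z i \<in> C)" using D by blast
  qed
  moreover have "measure N (cell d I s t) = increment d s t f"
    if "\<And>i. i \<in> {1..d} \<Longrightarrow> s i \<in> I i \<and> t i \<in> I i \<and> s i \<le> t i" for s t
    using cellN[OF that] increment_nonneg[OF f n that] by (simp add: measure_def)
  ultimately show ?thesis using represented_by_increments[where n = n, OF I \<alpha> n] by blast
qed

theorem corollary34:
  fixes d :: nat and I :: "nat \<Rightarrow> real set" and f :: "(nat \<Rightarrow> real) \<Rightarrow> real"
    and \<alpha> :: "nat \<Rightarrow> real" and n :: "nat \<Rightarrow> nat"
  assumes "1 \<le> d"
    and "\<And>i. i \<in> {1..d} \<Longrightarrow> open (I i) \<and> is_interval (I i)"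
    and "\<alpha> \<in> cuboid d I"
    and "\<And>i. i \<in> {1..d} \<Longrightarrow> 1 \<le> n i"
  shows "box_convex d I n f \<longleftrightarrow>
    (\<exists>(W :: (nat \<Rightarrow> real) \<Rightarrow> real) (\<mu> :: (nat \<Rightarrow> side) \<Rightarrow> (nat \<Rightarrow> real) measure).
       pseudo_polynomial d I (\<lambda>i. n i - 1) W \<and>
       (\<forall>b\<in>sides d n.
          borel_measure_on (cuboid d I) (\<mu> b) \<and>
          finite_on_compacts (cuboid d I) (\<mu> b) \<and>
          (\<forall>i\<in>{1..d}. b i = L \<longrightarrow> discrete_measure (marginal i (\<mu> b)))) \<and>
       (\<forall>x\<in>cuboid d I.
          f x = W x + (\<Sum>b\<in>sides d n. \<integral>u.
            (\<Prod>j=1..d. (x j - u j) ^ (n j - 1) / fact (n j - 1) * chi (b j) (\<alpha> j) (x j) (u j))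
            \<partial>\<mu> b)))"
  unfolding kern_unfold[symmetric]
proof
  assume f: "box_convex d I n f"
  have "\<exists>N. represented_by d I n \<alpha> f N"
    using assms(2,3) _ assms(4) f
  proof (rule represented_by_if_box_convex)
    fix m g assume "\<And>i. i \<in> {1..d} \<Longrightarrow> m i = 1" "box_convex d I m g"
    with assms(2,3) show "\<exists>N. represented_by d I m \<alpha> g N" by (rule represented_by_order_one)
  qed
  then obtain N where "represented_by d I n \<alpha> f N" by blast
  with assms(2-4) show "\<exists>W \<mu>. pseudo_polynomial d I (\<lambda>i. n i - 1) W \<and>
       (\<forall>b\<in>sides d n. borel_measure_on (cuboid d I) (\<mu> b) \<and> finite_on_compacts (cuboid d I) (\<mu> b) \<and>
          (\<forall>i\<in>{1..d}. b i = L \<longrightarrow> discrete_measure (marginal i (\<mu> b)))) \<and>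
       (\<forall>x\<in>cuboid d I. f x = W x + (\<Sum>b\<in>sides d n. \<integral>u. kern d n \<alpha> x b u \<partial>\<mu> b))"
    by (rule representation_if_represented_by)
next
  assume "\<exists>W \<mu>. pseudo_polynomial d I (\<lambda>i. n i - 1) W \<and>
       (\<forall>b\<in>sides d n. borel_measure_on (cuboid d I) (\<mu> b) \<and> finite_on_compacts (cuboid d I) (\<mu> b) \<and>
          (\<forall>i\<in>{1..d}. b i = L \<longrightarrow> discrete_measure (marginal i (\<mu> b)))) \<and>
       (\<forall>x\<in>cuboid d I. f x = W x + (\<Sum>b\<in>sides d n. \<integral>u. kern d n \<alpha> x b u \<partial>\<mu> b))"
  then obtain W and \<mu> :: "(nat \<Rightarrow> side) \<Rightarrow> (nat \<Rightarrow> real) measure" where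
    "pseudo_polynomial d I (\<lambda>i. n i - 1) W"
    "\<forall>b\<in>sides d n. borel_measure_on (cuboid d I) (\<mu> b) \<and> finite_on_compacts (cuboid d I) (\<mu> b)"
    "\<forall>x\<in>cuboid d I. f x = W x + (\<Sum>b\<in>sides d n. \<integral>u. kern d n \<alpha> x b u \<partial>\<mu> b)"
    by blast
  then show "box_convex d I n f"
    using assms by (intro box_convex_if_representation[where \<B> = "sides d n"]) auto
qed

end
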